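(* Let $n\ge 1$ and let $L=L^{c,c^{-1}}\subset SL_{n+1}(\mathbb{C})$ (for the Coxeter element $c=s_1\cdots s_n$ in type $A_n$, standard numbering) be the variety of all tridiagonal matrices of determinant $1$ of the form $$M=\begin{pmatrix} v_1 & y_1 & 0 & \cdots & 0\\ 1 & v_2 & y_2 & \ddots & \vdots\\ 0 & 1 & \ddots & \ddots & 0\\ \vdots & \ddots & \ddots & \ddots & y_n\\ 0 & \cdots & 0 & 1 & v_{n+1}\end{pmatrix}$$ with all $y_1,\dots,y_n$ non-zero. Let $x_{[i,j]}\in\mathbb{C}[L]$ be the regular function given by the minor of $M$ with rows and columns $i,i+1,\dots,j$, with the convention $x_{[i,j]}=1$ unless $1\le i\le j\le n+1$ (so $x_{[i,i]}=v_i$ and $x_{[1,n+1]}=\det M=1$). Then: (1) The algebra $\mathcal{A}=\mathbb{C}[L]$ is the (complexified) cluster algebra of type $A_n$ with principal coefficients at the initial seed $(\mathbf{x},\mathbf{y},B)$ given by $\mathbf{x}=(x_{[1,1]},x_{[1,2]},\dots,x_{[1,n]})$, $\mathbf{y}=(y_1,\dots,y_n)$, and $B=(b_{i,j})$ the $n\times n$ matrix with $b_{i,i+1}=1$, $b_{i+1,i}=-1$ for $1\le i\le n-1$, and all other entries $0$. (2) The set of cluster variables in $\mathcal{A}$ is $\{x_{[i,j]}: 1\le i\le j\le n+1,\ (i,j)\ne(1,n+1)\}$. (3) The exchange relations in $\mathcal{A}$ are $$x_{[i,k]}\,x_{[j,\ell]}=y_{j-1}y_j\cdots y_k\,x_{[i,j-2]}\,x_{[k+2,\ell]}+x_{[i,\ell]}\,x_{[j,k]}$$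 for $1\le i\le j-1\le k\le \ell-1\le n$.
   Context: Cluster algebras. A semifield $\mathbb{P}$ is an abelian multiplicative group with a commutative, associative addition $\oplus$ over which multiplication distributes. The tropical semifield $\mathrm{Trop}(u_j:j\in J)$ is the free abelian multiplicative group on the $u_j$ with $\prod u_j^{a_j}\oplus\prod u_j^{b_j}=\prod u_j^{\min(a_j,b_j)}$. Let $\mathbb{ZP}$ be the group ring, $\mathbb{Q}(\mathbb{P})$ its fraction field, and $\mathcal{F}$ a field isomorphic to the field of rational functions in $n$ variables over $\mathbb{Q}(\mathbb{P})$. A seed is $(\mathbf{x},\mathbf{y},B)$ with $\mathbf{x}=(x_i)_{i\in I}$, $|I|=n$, a free generating set of $\mathcal{F}$ over $\mathbb{Q}(\mathbb{P})$ (the cluster), $\mathbf{y}=(y_i)_{i\in I}$ a tuple in $\mathbb{P}$ (the coefficient tuple), $B=(b_{i,j})$ a skew-symmetrizable integer matrix (the exchange matrix). With $[b]_+=\max(b,0)$, the mutation $\mu_k$ gives the seed $(\mathbf{x}',\mathbf{y}',B')$: $b'_{i,j}=-b_{i,j}$ if $i=k$ or $j=k$, otherwise $b'_{i,j}=b_{i,j}+[b_{i,k}]_+[b_{k,j}]_+-[-b_{i,k}]_+[-b_{k,j}]_+$; $y'_k=y_k^{-1}$, $y'_j=y_jy_k^{[b_{k,j}]_+}(y_k\oplus1)^{-b_{k,j}}$ for $j\ne k$; $x'_j=x_j$ for $j\neq k$, and $x'_k$ is given by the exchange relation $x_kx'_k=\dfrac{y_k\prod_i x_i^{[b_{i,k}]_+}+\prod_i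 x_i^{[-b_{i,k}]_+}}{y_k\oplus1}$. The cluster variables are all elements of clusters of seeds obtained from the initial seed by sequences of mutations; the exchange relations are those from all mutations of such seeds; the cluster algebra is the $\mathbb{ZP}$-subalgebra of $\mathcal{F}$ generated by all cluster variables. The initial seed has principal coefficients if $\mathbb{P}=\mathrm{Trop}(y_i:i\in I)$ is generated by the initial coefficient tuple. Complexified version: a $\mathbb{C}$-algebra $\mathcal{A}$ (a domain) "is the cluster algebra with principal coefficients at $(\mathbf{x},\mathbf{y},B)$" means that the elements of $\mathbf{x}$ and $\mathbf{y}$ together are algebraically independent over $\mathbb{C}$ and generate the fraction field of $\mathcal{A}$ over $\mathbb{C}$, and that $\mathcal{A}$ is generated over $\mathbb{C}$ by the $y_i^{\pm1}$ and all cluster variables. Type: a cluster algebra is of finite type if it has finitely many seeds. It is of type $A_n$ if some seed has exchange matrix $B(c')=(b_{i,j})$ of the form $b_{i,j}=-a_{i,j}$ if $a_{i,j}\neq0$, $i\ne j$, and $s_i$ precedes $s_j$ in $c'$; $b_{i,j}=a_{i,j}$ if $a_{i,j}\ne0$, $i\neq j$, and $s_j$ precedes $s_i$; $b_{i,j}=0$ otherwise, for some Coxeter element $c'$ (product of all simple reflections in some order) of the Weyl group of the Cartan matrix $(a_{i,j})$ of type $A_n$. *)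

theory Defs
  imports
    "HOL-Computational_Algebra.Polynomial_Factorial"
    "HOL-Library.Poly_Mapping"
    "HOL-Library.Multiset"
    "HOL-Library.Cardinality"
    "Jordan_Normal_Form.Determinant"
    "Jordan_Normal_Form.DL_Submatrix"
begin

section \<open>Semifields and the tropical semifield\<close>

text \<open>The auxiliary addition of a semifield is written \<open>+\<close>; there is no zero element.
  In particular \<open>y + 1\<close> below is the semifield sum of \<open>y\<close> and the multiplicative unit.\<close>

class semifield = comm_semiring + comm_monoid_mult + inverse +
  assumes semifield_left_inverse: "inverse a * a = 1"
    and semifield_divide: "a / b = a * inverse b"

text \<open>An element of \<open>'j trop\<close> is a Laurent monomial in variables indexed by \<open>'j\<close>, given by
  its finitely supported exponent vector.\<close>

typedef 'j trop = "{a :: 'j \<Rightarrow> int. finite {j. a j \<noteq> 0}}"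
  morphisms expo Trop
  by (rule exI[of _ "\<lambda>_. 0"]) simp

setup_lifting type_definition_trop

instantiation trop :: (type) semifield
begin

lift_definition one_trop :: "'a trop" is "\<lambda>_. 0" by simp

lift_definition times_trop :: "'a trop \<Rightarrow> 'a trop \<Rightarrow> 'a trop" is "\<lambda>a b j. a j + b j"
proof -
  fix a b :: "'a \<Rightarrow> int"
  assume "finite {j. a j \<noteq> 0}" "finite {j. b j \<noteq> 0}"
  then show "finite {j. a j + b j \<noteq> 0}"
    by (rule finite_subset[rotated, OF finite_UnI]) auto
qed

lift_definition plus_trop :: "'a trop \<Rightarrow> 'a trop \<Rightarrow> 'a trop" is "\<lambda>a b j. min (a j) (b j)"
proof -
  fix a b :: "'a \<Rightarrow> int"
  assume "finite {j. a j \<noteq> 0}" "finite {j. b j \<noteq> 0}"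
  then show "finite {j. min (a j) (b j) \<noteq> 0}"
    by (rule finite_subset[rotated, OF finite_UnI]) (auto simp: min_def)
qed

lift_definition inverse_trop :: "'a trop \<Rightarrow> 'a trop" is "\<lambda>a j. - a j" by simp

definition divide_trop :: "'a trop \<Rightarrow> 'a trop \<Rightarrow> 'a trop" where
  "divide_trop a b = a * inverse b"

instance
proof
  fix a b c :: "'a trop"
  show "a * b * c = a * (b * c)" by transfer (simp add: add.assoc)
  show "a * b = b * a" by transfer (simp add: add.commute)
  show "1 * a = a" by transfer simp
  show "a + b + c = a + (b + c)" by transfer (simp add: min.assoc)
  show "a + b = b + a" by transfer (simp add: min.commute)
  show "(a + b) * c = a * c + b * c" by transfer (auto simp: min_def)
  show "inverse a * a = 1" by transfer simp
  show "a div b = a * inverse b" by (rule divide_trop_def)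
qed

end

lift_definition trop_var :: "'j \<Rightarrow> 'j trop" is "\<lambda>i j. if j = i then 1 else 0"
  by simp


section \<open>Seeds, mutation, cluster variables, exchange relations\<close>

text \<open>The index set \<open>I\<close> of a seed is the (finite) type \<open>'i\<close>; \<open>'p\<close> is the coefficient semifield
  and \<open>'f\<close> the ambient field.  The field enters through a map \<open>\<iota> :: 'p \<Rightarrow> 'f\<close> by which
  coefficients are regarded as elements of the ambient field.\<close>

record ('i, 'p, 'f) seed =
  cluster :: "'i \<Rightarrow> 'f"
  coeffs :: "'i \<Rightarrow> 'p"
  exmat :: "'i \<Rightarrow> 'i \<Rightarrow> int"

definition pos_part :: "int \<Rightarrow> int" where
  "pos_part b = max b 0"

definition skew_symmetrizable :: "('i \<Rightarrow> 'i \<Rightarrow> int) \<Rightarrow> bool" where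
  "skew_symmetrizable B \<longleftrightarrow>
     (\<exists>d :: 'i \<Rightarrow> int. (\<forall>i. d i > 0) \<and> (\<forall>i j. d i * B i j = - (d j * B j i)))"

definition mutate_exmat :: "'i \<Rightarrow> ('i \<Rightarrow> 'i \<Rightarrow> int) \<Rightarrow> 'i \<Rightarrow> 'i \<Rightarrow> int" where
  "mutate_exmat k B = (\<lambda>i j. if i = k \<or> j = k then - B i j
     else B i j + pos_part (B i k) * pos_part (B k j) - pos_part (- B i k) * pos_part (- B k j))"

definition mutate_coeffs ::
  "'i \<Rightarrow> ('i \<Rightarrow> 'i \<Rightarrow> int) \<Rightarrow> ('i \<Rightarrow> 'p::semifield) \<Rightarrow> 'i \<Rightarrow> 'p" where
  "mutate_coeffs k B y = (\<lambda>j. if j = k then inverse (y k)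
     else y j * y k powi pos_part (B k j) * (y k + 1) powi (- B k j))"

definition mutate_cluster ::
  "('p::semifield \<Rightarrow> 'f::field) \<Rightarrow> 'i::finite \<Rightarrow> ('i, 'p, 'f) seed \<Rightarrow> 'i \<Rightarrow> 'f" where
  "mutate_cluster \<iota> k S = (let x = cluster S; y = coeffs S; B = exmat S in
     x(k := (\<iota> (y k) * (\<Prod>i\<in>UNIV. x i powi pos_part (B i k))
              + (\<Prod>i\<in>UNIV. x i powi pos_part (- B i k)))
            / \<iota> (y k + 1) / x k))"

definition mutate ::
  "('p::semifield \<Rightarrow> 'f::field) \<Rightarrow> 'i::finite \<Rightarrow> ('i, 'p, 'f) seed \<Rightarrow> ('i, 'p, 'f) seed" where
  "mutate \<iota> k S = \<lparr> cluster = mutate_cluster \<iota> k S,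
                   coeffs = mutate_coeffs k (exmat S) (coeffs S),
                   exmat = mutate_exmat k (exmat S) \<rparr>"

inductive_set mutation_class ::
  "('p::semifield \<Rightarrow> 'f::field) \<Rightarrow> ('i::finite, 'p, 'f) seed \<Rightarrow> ('i, 'p, 'f) seed set"
  for \<iota> S0 where
  initial: "S0 \<in> mutation_class \<iota> S0"
| step: "S \<in> mutation_class \<iota> S0 \<Longrightarrow> mutate \<iota> k S \<in> mutation_class \<iota> S0"

definition cluster_variables ::
  "('p::semifield \<Rightarrow> 'f::field) \<Rightarrow> ('i::finite, 'p, 'f) seed \<Rightarrow> 'f set" where
  "cluster_variables \<iota> S0 = (\<Union>S\<in>mutation_class \<iota> S0. range (cluster S))"

text \<open>An exchange relation is an identity \<open>x x' = p\<^sup>+ m\<^sup>+ + p\<^sup>- m\<^sup>-\<close> with coefficients \<open>p\<^sup>\<plusminus>\<close> and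
  monomials \<open>m\<^sup>\<plusminus>\<close> in cluster variables, up to the order of the factors and of the summands.
  It is recorded formally, as the multiset of the two factors on the left together with the
  multiset of the two terms on the right; a term is a pair of its coefficient and its monomial,
  the latter as the multiset of its cluster variable factors.\<close>

type_synonym 'f exrel = "'f multiset \<times> ('f \<times> 'f multiset) multiset"

definition exchange_relation ::
  "('p::semifield \<Rightarrow> 'f::field) \<Rightarrow> 'i::finite \<Rightarrow> ('i, 'p, 'f) seed \<Rightarrow> 'f exrel" where
  "exchange_relation \<iota> k S = (let x = cluster S; y = coeffs S; B = exmat S in
     ({# x k, mutate_cluster \<iota> k S k #},
      {# (\<iota> (y k) / \<iota> (y k + 1), \<Sum>i\<in>UNIV. replicate_mset (nat (pos_part (B i k))) (x i)),
         (1 / \<iota> (y k + 1), \<Sum>i\<in>UNIV. replicate_mset (nat (pos_part (- B i k))) (x i)) #}))"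

definition exchange_relations ::
  "('p::semifield \<Rightarrow> 'f::field) \<Rightarrow> ('i::finite, 'p, 'f) seed \<Rightarrow> 'f exrel set" where
  "exchange_relations \<iota> S0 = {exchange_relation \<iota> k S |k S. S \<in> mutation_class \<iota> S0}"


section \<open>Type A\<close>

text \<open>\<open>type_A_cartan a\<close>: up to the numbering of the simple reflections, \<open>a\<close> is the Cartan matrix
  of type \<open>A\<^sub>n\<close> with \<open>n\<close> the cardinality of the index type.\<close>

definition type_A_cartan :: "('i::finite \<Rightarrow> 'i \<Rightarrow> int) \<Rightarrow> bool" where
  "type_A_cartan a \<longleftrightarrow> (\<exists>num :: 'i \<Rightarrow> nat. bij_betw num UNIV {1..CARD('i)} \<and>
     (\<forall>i j. a i j = (if i = j then 2
                     else if num i = num j + 1 \<or> num j = num i + 1 then -1 else 0)))"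

text \<open>A Coxeter element is given by the order \<open>c\<close> in which the simple reflections are multiplied.
  The matrix below only compares \<open>i\<close> and \<open>j\<close> when \<open>s\<^sub>i\<close> and \<open>s\<^sub>j\<close> do not commute, and
  then the comparison does not depend on the chosen order.\<close>

definition precedes :: "'i list \<Rightarrow> 'i \<Rightarrow> 'i \<Rightarrow> bool" where
  "precedes c i j \<longleftrightarrow> (\<exists>p q. p < q \<and> q < length c \<and> c ! p = i \<and> c ! q = j)"

definition coxeter_exmat :: "('i \<Rightarrow> 'i \<Rightarrow> int) \<Rightarrow> 'i list \<Rightarrow> 'i \<Rightarrow> 'i \<Rightarrow> int" where
  "coxeter_exmat a c = (\<lambda>i j.
     if a i j \<noteq> 0 \<and> i \<noteq> j \<and> precedes c i j then - a i j
     else if a i j \<noteq> 0 \<and> i \<noteq> j \<and> precedes c j i then a i j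
     else 0)"

definition cluster_type_A ::
  "('p::semifield \<Rightarrow> 'f::field) \<Rightarrow> ('i::finite, 'p, 'f) seed \<Rightarrow> bool" where
  "cluster_type_A \<iota> S0 \<longleftrightarrow> (\<exists>S\<in>mutation_class \<iota> S0. \<exists>a c.
     type_A_cartan a \<and> distinct c \<and> set c = UNIV \<and> exmat S = coxeter_exmat a c)"


section \<open>Cluster algebras with principal coefficients over the complex numbers\<close>

text \<open>The structure of a complex algebra on a ring is given by the homomorphism \<open>\<kappa>\<close> from \<open>complex\<close>.\<close>

definition complex_algebra :: "(complex \<Rightarrow> 'a::comm_ring_1) \<Rightarrow> bool" where
  "complex_algebra \<kappa> \<longleftrightarrow> \<kappa> 1 = 1 \<and> (\<forall>a b. \<kappa> (a + b) = \<kappa> a + \<kappa> b) \<and> (\<forall>a b. \<kappa> (a * b) = \<kappa> a * \<kappa> b)"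

inductive_set subalgebra_generated :: "(complex \<Rightarrow> 'a::comm_ring_1) \<Rightarrow> 'a set \<Rightarrow> 'a set"
  for \<kappa> S where
  scalar: "\<kappa> c \<in> subalgebra_generated \<kappa> S"
| gen: "a \<in> S \<Longrightarrow> a \<in> subalgebra_generated \<kappa> S"
| add: "a \<in> subalgebra_generated \<kappa> S \<Longrightarrow> b \<in> subalgebra_generated \<kappa> S \<Longrightarrow>
    a + b \<in> subalgebra_generated \<kappa> S"
| mult: "a \<in> subalgebra_generated \<kappa> S \<Longrightarrow> b \<in> subalgebra_generated \<kappa> S \<Longrightarrow>
    a * b \<in> subalgebra_generated \<kappa> S"

inductive_set subfield_generated :: "(complex \<Rightarrow> 'f::field) \<Rightarrow> 'f set \<Rightarrow> 'f set"
  for \<kappa> S where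
  scalar: "\<kappa> c \<in> subfield_generated \<kappa> S"
| gen: "a \<in> S \<Longrightarrow> a \<in> subfield_generated \<kappa> S"
| add: "a \<in> subfield_generated \<kappa> S \<Longrightarrow> b \<in> subfield_generated \<kappa> S \<Longrightarrow>
    a + b \<in> subfield_generated \<kappa> S"
| mult: "a \<in> subfield_generated \<kappa> S \<Longrightarrow> b \<in> subfield_generated \<kappa> S \<Longrightarrow>
    a * b \<in> subfield_generated \<kappa> S"
| inv: "a \<in> subfield_generated \<kappa> S \<Longrightarrow> inverse a \<in> subfield_generated \<kappa> S"

text \<open>Polynomials over \<open>complex\<close> in variables indexed by \<open>'v\<close> are elements of
  \<open>('v \<Rightarrow>\<^sub>0 nat) \<Rightarrow>\<^sub>0 complex\<close>.\<close>

definition eval_mpoly ::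
  "(complex \<Rightarrow> 'a::comm_ring_1) \<Rightarrow> ('v \<Rightarrow> 'a) \<Rightarrow> (('v \<Rightarrow>\<^sub>0 nat) \<Rightarrow>\<^sub>0 complex) \<Rightarrow> 'a" where
  "eval_mpoly \<kappa> z p = (\<Sum>m\<in>Poly_Mapping.keys p.
     \<kappa> (Poly_Mapping.lookup p m) * (\<Prod>v\<in>Poly_Mapping.keys m. z v ^ Poly_Mapping.lookup m v))"

definition algebraically_independent ::
  "(complex \<Rightarrow> 'a::comm_ring_1) \<Rightarrow> ('v \<Rightarrow> 'a) \<Rightarrow> bool" where
  "algebraically_independent \<kappa> z \<longleftrightarrow> (\<forall>p. eval_mpoly \<kappa> z p = 0 \<longrightarrow> p = 0)"

text \<open>With principal coefficients the semifield is \<open>Trop(y\<^sub>i : i \<in> I)\<close> and the initial coefficient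
  tuple consists of its generators.  A family \<open>y\<close> of nonzero elements of the ambient field
  realises the Laurent monomials in the generators as elements of that field.\<close>

definition principal_coeff :: "('i::finite \<Rightarrow> 'f::field) \<Rightarrow> 'i trop \<Rightarrow> 'f" where
  "principal_coeff y p = (\<Prod>i\<in>UNIV. y i powi expo p i)"

definition principal_seed ::
  "('i \<Rightarrow> 'f) \<Rightarrow> ('i \<Rightarrow> 'i \<Rightarrow> int) \<Rightarrow> ('i, 'i trop, 'f) seed" where
  "principal_seed x B = \<lparr> cluster = x, coeffs = trop_var, exmat = B \<rparr>"

text \<open>The algebra \<open>\<A>\<close> is the whole type \<open>'a\<close>, a domain, with structure map \<open>\<kappa>\<close>; the seed lives in
  its field of fractions, of which \<open>\<A>\<close> is the subring \<open>range to_fract\<close>.\<close>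

definition principal_cluster_algebra ::
  "(complex \<Rightarrow> 'a::idom) \<Rightarrow> ('i::finite \<Rightarrow> 'a fract) \<Rightarrow> ('i \<Rightarrow> 'a fract) \<Rightarrow> ('i \<Rightarrow> 'i \<Rightarrow> int) \<Rightarrow> bool"
  where
  "principal_cluster_algebra \<kappa> x y B \<longleftrightarrow>
     complex_algebra \<kappa> \<and>
     skew_symmetrizable B \<and>
     algebraically_independent (to_fract \<circ> \<kappa>) (case_sum x y) \<and>
     subfield_generated (to_fract \<circ> \<kappa>) (range x \<union> range y) = UNIV \<and>
     range to_fract = subalgebra_generated (to_fract \<circ> \<kappa>)
       (range y \<union> inverse ` range y \<union> cluster_variables (principal_coeff y) (principal_seed x B))"


section \<open>The variety of tridiagonal matrices and its coordinate ring\<close>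

text \<open>Matrix indices start at 0: for \<open>M \<in> tridiag_variety n\<close> the entry \<open>v\<^sub>i\<close> is \<open>M $$ (i - 1, i - 1)\<close>
  and \<open>y\<^sub>i\<close> is \<open>M $$ (i - 1, i)\<close>.\<close>

definition tridiag_variety :: "nat \<Rightarrow> complex mat set" where
  "tridiag_variety n = {M \<in> carrier_mat (n + 1) (n + 1).
     (\<forall>i<n. M $$ (i + 1, i) = 1) \<and>
     (\<forall>i<n. M $$ (i, i + 1) \<noteq> 0) \<and>
     (\<forall>i\<le>n. \<forall>j\<le>n. i + 1 < j \<or> j + 1 < i \<longrightarrow> M $$ (i, j) = 0) \<and>
     det M = 1}"

inductive_set polynomial_functions :: "nat \<Rightarrow> (complex mat \<Rightarrow> complex) set" for n where
  const: "(\<lambda>_. c) \<in> polynomial_functions n"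
| entry: "i \<le> n \<Longrightarrow> j \<le> n \<Longrightarrow> (\<lambda>M. M $$ (i, j)) \<in> polynomial_functions n"
| add: "f \<in> polynomial_functions n \<Longrightarrow> g \<in> polynomial_functions n \<Longrightarrow>
    (\<lambda>M. f M + g M) \<in> polynomial_functions n"
| mult: "f \<in> polynomial_functions n \<Longrightarrow> g \<in> polynomial_functions n \<Longrightarrow>
    (\<lambda>M. f M * g M) \<in> polynomial_functions n"

text \<open>The variety is the principal open subset \<open>y\<^sub>1 \<dots> y\<^sub>n \<noteq> 0\<close> of a closed set of matrices, so its
  regular functions are the quotients of polynomial functions by powers of \<open>y\<^sub>1 \<dots> y\<^sub>n\<close>.
  Functions on the variety are extended by 0 to all matrices.\<close>

definition superdiag_prod :: "nat \<Rightarrow> complex mat \<Rightarrow> complex" where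
  "superdiag_prod n M = (\<Prod>i<n. M $$ (i, i + 1))"

definition regular_functions :: "nat \<Rightarrow> (complex mat \<Rightarrow> complex) set" where
  "regular_functions n = {f. \<exists>p\<in>polynomial_functions n. \<exists>k.
     f = (\<lambda>M. if M \<in> tridiag_variety n then p M / superdiag_prod n M ^ k else 0)}"

subsection \<open>The coordinate ring is a domain\<close>

lemma regular_functionsI:
  assumes "p \<in> polynomial_functions n"
    and "\<And>M. M \<in> tridiag_variety n \<Longrightarrow> f M = p M / superdiag_prod n M ^ k"
    and "\<And>M. M \<notin> tridiag_variety n \<Longrightarrow> f M = 0"
  shows "f \<in> regular_functions n"
  unfolding regular_functions_def using assms by (auto intro!: bexI[of _ p] exI[of _ k])

lemma regular_functionsE:
  assumes "f \<in> regular_functions n"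
  obtains p k where "p \<in> polynomial_functions n"
    "\<And>M. M \<in> tridiag_variety n \<Longrightarrow> f M = p M / superdiag_prod n M ^ k"
    "\<And>M. M \<notin> tridiag_variety n \<Longrightarrow> f M = 0"
  using assms unfolding regular_functions_def by force

lemma regular_functions_outside:
  "f \<in> regular_functions n \<Longrightarrow> M \<notin> tridiag_variety n \<Longrightarrow> f M = 0"
  unfolding regular_functions_def by auto

lemma superdiag_prod_nonzero: "M \<in> tridiag_variety n \<Longrightarrow> superdiag_prod n M \<noteq> 0"
  by (auto simp: superdiag_prod_def tridiag_variety_def)

lemma polynomial_functions_sum:
  "(\<And>a. a \<in> A \<Longrightarrow> f a \<in> polynomial_functions n) \<Longrightarrow>
   (\<lambda>M. \<Sum>a\<in>A. f a M) \<in> polynomial_functions n"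
  by (induction A rule: infinite_finite_induct) (auto intro: polynomial_functions.intros)

lemma polynomial_functions_prod:
  "(\<And>a. a \<in> A \<Longrightarrow> f a \<in> polynomial_functions n) \<Longrightarrow>
   (\<lambda>M. \<Prod>a\<in>A. f a M) \<in> polynomial_functions n"
  by (induction A rule: infinite_finite_induct) (auto intro: polynomial_functions.intros)

lemma polynomial_functions_power:
  "f \<in> polynomial_functions n \<Longrightarrow> (\<lambda>M. f M ^ k) \<in> polynomial_functions n"
  by (induction k) (auto intro: polynomial_functions.intros)

lemma superdiag_prod_polynomial: "superdiag_prod n \<in> polynomial_functions n"
  unfolding superdiag_prod_def[abs_def]
  by (rule polynomial_functions_prod) (auto intro: polynomial_functions.intros)

lemma polynomial_functions_det:
  assumes "\<And>a b. a < m \<Longrightarrow> b < m \<Longrightarrow> (\<lambda>M. F M a b) \<in> polynomial_functions n"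
  shows "(\<lambda>M. det (mat m m (\<lambda>(a, b). F M a b))) \<in> polynomial_functions n"
proof -
  have "(\<lambda>M. det (mat m m (\<lambda>(a, b). F M a b))) =
     (\<lambda>M. \<Sum>p\<in>{p. p permutes {0..<m}}. signof p * (\<Prod>i=0..<m. F M i (p i)))"
    unfolding det_def by (intro ext) (auto intro!: sum.cong prod.cong simp: permutes_in_image)
  moreover have "\<dots> \<in> polynomial_functions n"
    by (intro polynomial_functions_sum polynomial_functions.mult polynomial_functions_prod
        polynomial_functions.const assms) (auto simp: permutes_in_image)
  ultimately show ?thesis by simp
qed

lemma regular_functions_add:
  assumes "f \<in> regular_functions n" "g \<in> regular_functions n"
  shows "(\<lambda>M. f M + g M) \<in> regular_functions n"
proof -
  obtain p k where p: "p \<in> polynomial_functions n"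
    "\<And>M. M \<in> tridiag_variety n \<Longrightarrow> f M = p M / superdiag_prod n M ^ k"
    "\<And>M. M \<notin> tridiag_variety n \<Longrightarrow> f M = 0" by (rule regular_functionsE[OF assms(1)]) blast
  obtain q l where q: "q \<in> polynomial_functions n"
    "\<And>M. M \<in> tridiag_variety n \<Longrightarrow> g M = q M / superdiag_prod n M ^ l"
    "\<And>M. M \<notin> tridiag_variety n \<Longrightarrow> g M = 0" by (rule regular_functionsE[OF assms(2)]) blast
  have "(\<lambda>M. p M * superdiag_prod n M ^ l + q M * superdiag_prod n M ^ k) \<in> polynomial_functions n"
    by (intro polynomial_functions.intros polynomial_functions_power superdiag_prod_polynomial p q)
  then show ?thesis
    by (rule regular_functionsI[where k = "k + l"])
      (simp_all add: p q superdiag_prod_nonzero field_simps power_add)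
qed

lemma regular_functions_mult:
  assumes "f \<in> regular_functions n" "g \<in> regular_functions n"
  shows "(\<lambda>M. f M * g M) \<in> regular_functions n"
proof -
  obtain p k where p: "p \<in> polynomial_functions n"
    "\<And>M. M \<in> tridiag_variety n \<Longrightarrow> f M = p M / superdiag_prod n M ^ k"
    "\<And>M. M \<notin> tridiag_variety n \<Longrightarrow> f M = 0" by (rule regular_functionsE[OF assms(1)]) blast
  obtain q l where q: "q \<in> polynomial_functions n"
    "\<And>M. M \<in> tridiag_variety n \<Longrightarrow> g M = q M / superdiag_prod n M ^ l"
    "\<And>M. M \<notin> tridiag_variety n \<Longrightarrow> g M = 0" by (rule regular_functionsE[OF assms(2)]) blast
  show ?thesis
    by (rule regular_functionsI[OF polynomial_functions.mult[OF p(1) q(1)], where k = "k + l"])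
      (simp_all add: p q power_add)
qed

lemma regular_functions_restrict:
  assumes "p \<in> polynomial_functions n"
  shows "(\<lambda>M. if M \<in> tridiag_variety n then p M else 0) \<in> regular_functions n"
  by (rule regular_functionsI[OF assms, where k = 0]) auto

fun continuant :: "nat \<Rightarrow> (nat \<Rightarrow> 'a::comm_ring_1) \<Rightarrow> (nat \<Rightarrow> 'a) \<Rightarrow> 'a" where
  "continuant 0 v y = 1"
| "continuant (Suc 0) v y = v 0"
| "continuant (Suc (Suc m)) v y = v (Suc m) * continuant (Suc m) v y - y m * continuant m v y"

definition tri_mat :: "nat \<Rightarrow> (nat \<Rightarrow> 'a::comm_ring_1) \<Rightarrow> (nat \<Rightarrow> 'a) \<Rightarrow> 'a mat" where
  "tri_mat m v y = mat m m (\<lambda>(i, j).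
     if i = j then v i else if j = i + 1 then y i else if i = j + 1 then 1 else 0)"

lemma tri_mat_carrier [simp]: "tri_mat m v y \<in> carrier_mat m m"
  by (simp add: tri_mat_def)

lemma det_tri_mat_step:
  fixes v y :: "nat \<Rightarrow> 'a::comm_ring_1"
  shows "det (tri_mat (Suc (Suc m)) v y) =
    v (Suc m) * det (tri_mat (Suc m) v y) - y m * det (tri_mat m v y)"
proof -
  define A where "A = tri_mat (Suc (Suc m)) v y"
  define B where "B = mat_delete A (Suc m) m"
  have A: "A \<in> carrier_mat (Suc (Suc m)) (Suc (Suc m))" by (simp add: A_def)
  have B: "B \<in> carrier_mat (Suc m) (Suc m)"
    using A by (auto simp: B_def mat_delete_def)
  have c1: "cofactor A (Suc m) (Suc m) = det (tri_mat (Suc m) v y)"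
  proof -
    have "mat_delete A (Suc m) (Suc m) = tri_mat (Suc m) v y"
      by (rule eq_matI) (auto simp: A_def tri_mat_def mat_delete_def)
    then show ?thesis by (simp add: cofactor_def)
  qed
  have "det B = (\<Sum>i<Suc m. B $$ (i, m) * cofactor B i m)"
    by (rule laplace_expansion_column[OF B]) simp
  also have "\<dots> = B $$ (m, m) * cofactor B m m"
    by (simp add: B_def A_def tri_mat_def mat_delete_def)
  also have "B $$ (m, m) = y m"
    by (simp add: B_def A_def tri_mat_def mat_delete_def)
  also have "cofactor B m m = det (tri_mat m v y)"
  proof -
    have "mat_delete B m m = tri_mat m v y"
      by (rule eq_matI) (auto simp: A_def B_def tri_mat_def mat_delete_def)
    then show ?thesis by (simp add: cofactor_def)
  qed
  finally have c2: "cofactor A (Suc m) m = - (y m * det (tri_mat m v y))"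
    by (simp add: cofactor_def B_def)
  have "det A = (\<Sum>j<Suc (Suc m). A $$ (Suc m, j) * cofactor A (Suc m) j)"
    by (rule laplace_expansion_row[OF A]) simp
  also have "\<dots> = A $$ (Suc m, m) * cofactor A (Suc m) m + A $$ (Suc m, Suc m) * cofactor A (Suc m) (Suc m)"
    by (simp add: A_def tri_mat_def)
  finally show ?thesis
    unfolding c1 c2 by (simp add: A_def tri_mat_def)
qed

lemma det_tri_mat: "det (tri_mat m v y) = continuant m v y"
proof (induction m v y rule: continuant.induct)
  case (1 v y)
  show ?case by (simp add: tri_mat_def det_dim_zero)
next
  case (2 v y)
  have "det (tri_mat (Suc 0) v y) = tri_mat (Suc 0) v y $$ (0, 0)"
    by (rule det_single) (simp add: tri_mat_def)
  then show ?case by (simp add: tri_mat_def)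
next
  case (3 m v y)
  then show ?case by (simp add: det_tri_mat_step)
qed

lemma continuant_cong:
  "(\<And>i. i < m \<Longrightarrow> v i = v' i) \<Longrightarrow> (\<And>i. Suc i < m \<Longrightarrow> y i = y' i) \<Longrightarrow>
   continuant m v y = continuant m v' y'"
  by (induction m v y rule: continuant.induct) auto

lemma poly_continuant:
  "poly (continuant m v y) t = continuant m (\<lambda>i. poly (v i) t) (\<lambda>i. poly (y i) t)"
  by (induction m v y rule: continuant.induct) auto

lemma tri_mat_in_variety:
  "tri_mat (Suc n) v y \<in> tridiag_variety n \<longleftrightarrow> continuant (Suc n) v y = 1 \<and> (\<forall>i<n. y i \<noteq> 0)"
proof -
  have "det (tri_mat (Suc n) v y) = continuant (Suc n) v y" by (rule det_tri_mat)
  moreover have "tri_mat (Suc n) v y \<in> carrier_mat (Suc n) (Suc n)" by simp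
  ultimately show ?thesis
    unfolding tridiag_variety_def by (auto simp: tri_mat_def)
qed

lemma variety_tri_mat:
  assumes "M \<in> tridiag_variety n"
  shows "M = tri_mat (Suc n) (\<lambda>i. M $$ (i, i)) (\<lambda>i. M $$ (i, Suc i))"
proof (rule eq_matI)
  fix i j assume "i < dim_row (tri_mat (Suc n) (\<lambda>i. M $$ (i, i)) (\<lambda>i. M $$ (i, Suc i)))"
    and "j < dim_col (tri_mat (Suc n) (\<lambda>i. M $$ (i, i)) (\<lambda>i. M $$ (i, Suc i)))"
  then have ij: "i \<le> n" "j \<le> n" by (auto simp: tri_mat_def)
  consider "i = j" | "j = i + 1" | "i = j + 1" | "i + 1 < j \<or> j + 1 < i" by linarith
  then show "M $$ (i, j) = tri_mat (Suc n) (\<lambda>i. M $$ (i, i)) (\<lambda>i. M $$ (i, Suc i)) $$ (i, j)"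
    using ij assms by cases (auto simp: tri_mat_def tridiag_variety_def)
qed (use assms in \<open>auto simp: tri_mat_def tridiag_variety_def\<close>)

lemma tridiag_variety_nonempty: "tridiag_variety n \<noteq> {}"
proof -
  define v y :: "nat \<Rightarrow> complex" where "v = (\<lambda>i. if i = 0 then 1 else 2)" and "y = (\<lambda>_. 1)"
  have "continuant m v y = 1" for m
    by (induction m rule: induct_nat_012) (auto simp: v_def y_def)
  then have "tri_mat (Suc n) v y \<in> tridiag_variety n"
    unfolding tri_mat_in_variety by (simp add: y_def)
  then show ?thesis by blast
qed

lemma polynomial_on_rational_curve:
  assumes "p \<in> polynomial_functions n"
    and "\<And>i j. i \<le> n \<Longrightarrow> j \<le> n \<Longrightarrow> \<exists>e. \<forall>t. poly D t \<noteq> 0 \<longrightarrow> poly D t * C t $$ (i, j) = poly e t"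
  shows "\<exists>R m. \<forall>t. poly D t \<noteq> 0 \<longrightarrow> poly D t ^ m * p (C t) = poly R t"
  using assms(1)
proof induction
  case (const c)
  show ?case by (rule exI[of _ "[:c:]"], rule exI[of _ 0]) simp
next
  case (entry i j)
  then obtain e where "\<forall>t. poly D t \<noteq> 0 \<longrightarrow> poly D t * C t $$ (i, j) = poly e t"
    using assms(2) by blast
  then show ?case by (intro exI[of _ e] exI[of _ 1]) simp
next
  case (add f g)
  then obtain R m R' m' where
    "\<forall>t. poly D t \<noteq> 0 \<longrightarrow> poly D t ^ m * f (C t) = poly R t"
    "\<forall>t. poly D t \<noteq> 0 \<longrightarrow> poly D t ^ m' * g (C t) = poly R' t" by blast
  then show ?case
    by (intro exI[of _ "D ^ m' * R + D ^ m * R'"] exI[of _ "m + m'"])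
      (auto simp: power_add algebra_simps)
next
  case (mult f g)
  then obtain R m R' m' where
    "\<forall>t. poly D t \<noteq> 0 \<longrightarrow> poly D t ^ m * f (C t) = poly R t"
    "\<forall>t. poly D t \<noteq> 0 \<longrightarrow> poly D t ^ m' * g (C t) = poly R' t" by blast
  moreover have eq: "poly D t ^ (m + m') * (f (C t) * g (C t)) =
      (poly D t ^ m * f (C t)) * (poly D t ^ m' * g (C t))" for t
    unfolding power_add by (simp only: ac_simps)
  ultimately have "\<forall>t. poly D t \<noteq> 0 \<longrightarrow>
      poly D t ^ (m + m') * (f (C t) * g (C t)) = poly (R * R') t"
    unfolding eq poly_mult by metis
  then show ?case by blast
qed

lemma exists_poly_nonzero:
  fixes P :: "complex poly"
  assumes "P \<noteq> 0"
  shows "\<exists>t. poly P t \<noteq> 0"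
  using assms poly_all_0_iff_0 by blast

lemma continuant_shift_last:
  fixes v y :: "nat \<Rightarrow> 'a::comm_ring_1"
  shows "continuant (Suc m) (v(m := v m + t)) y = continuant (Suc m) v y + t * continuant m v y"
proof (cases m)
  case (Suc k)
  have "continuant (Suc k) (v(m := v m + t)) y = continuant (Suc k) v y"
    "continuant k (v(m := v m + t)) y = continuant k v y"
    by (rule continuant_cong; simp add: Suc)+
  then show ?thesis by (simp add: Suc algebra_simps)
qed simp

lemma nonvanishing_generic_point:
  assumes n: "n \<ge> 1" and f: "f \<in> regular_functions n" and M: "f M \<noteq> 0"
  shows "\<exists>v y. tri_mat (Suc n) v y \<in> tridiag_variety n \<and> f (tri_mat (Suc n) v y) \<noteq> 0
    \<and> continuant n v y \<noteq> 0"
proof -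
  obtain m where m: "n = Suc m" using n by (cases n) auto
  obtain p k where p: "p \<in> polynomial_functions n"
    "\<And>M. M \<in> tridiag_variety n \<Longrightarrow> f M = p M / superdiag_prod n M ^ k"
    "\<And>M. M \<notin> tridiag_variety n \<Longrightarrow> f M = 0" by (rule regular_functionsE[OF f]) blast
  have inL: "M \<in> tridiag_variety n" using p(3) M by blast
  obtain v y where vy: "M = tri_mat (Suc n) v y" using variety_tri_mat[OF inL] by blast
  show ?thesis
  proof (cases "continuant n v y = 0")
    case False
    then show ?thesis using M inL vy by blast
  next
    case True
    define c where "c = continuant m v y"
    have c1: "continuant (Suc n) v y = 1" and y0: "\<forall>i<n. y i \<noteq> 0"
      using inL unfolding vy tri_mat_in_variety by auto
    have yc: "- y m * c = 1" using c1 True by (simp add: m c_def)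
    then have c0: "c \<noteq> 0" by auto
    define V where "V t = v(m := v m + t)" for t
    define Y where "Y t = y(m := y m + v (Suc m) * t)" for t
    have cm: "continuant m (V t) (Y t) = c" for t
      unfolding c_def by (rule continuant_cong) (auto simp: V_def Y_def)
    have cn: "continuant n (V t) (Y t) = t * c" for t
    proof -
      have "continuant n (V t) (Y t) = continuant n (V t) y"
        by (rule continuant_cong) (auto simp: Y_def m)
      also have "\<dots> = t * c"
        using continuant_shift_last[of m v t y] True by (simp add: V_def m c_def)
      finally show ?thesis .
    qed
    have cSn: "continuant (Suc n) (V t) (Y t) = 1" for t
    proof -
      have "continuant (Suc n) (V t) (Y t) = v (Suc m) * (t * c) - (y m + v (Suc m) * t) * c"
        using cn[of t] cm[of t] by (simp add: m) (simp add: V_def Y_def)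
      then show ?thesis using yc by (simp add: algebra_simps)
    qed
    define C where "C t = tri_mat (Suc n) (V t) (Y t)" for t
    have "\<exists>e. \<forall>t. poly 1 t \<noteq> 0 \<longrightarrow> poly 1 t * C t $$ (i, j) = poly e t" if "i \<le> n" "j \<le> n" for i j
    proof -
      have "\<forall>t. C t $$ (i, j) = poly (if i = j then (if i = m then [:v m, 1:] else [:v i:])
          else if j = i + 1 then (if i = m then [:y m, v (Suc m):] else [:y i:])
          else if i = j + 1 then 1 else 0) t"
        using that by (auto simp: C_def tri_mat_def V_def Y_def)
      then show ?thesis by (metis mult_1 poly_1)
    qed
    from polynomial_on_rational_curve[OF p(1) this]
    obtain R where R: "\<And>t. p (C t) = poly R t" by auto
    have C0: "C 0 = M" by (simp add: C_def V_def Y_def vy)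
    have "p M \<noteq> 0" using M p(2)[OF inL] by auto
    then have "R \<noteq> 0" using R[of 0] C0 by auto
    moreover have "[:y m, v (Suc m):] \<noteq> 0" using y0 m by auto
    moreover have "[:0, 1::complex:] \<noteq> 0" by simp
    ultimately obtain t where t: "poly (R * [:y m, v (Suc m):] * [:0, 1:]) t \<noteq> 0"
      using exists_poly_nonzero by (metis no_zero_divisors)
    then have tR: "poly R t \<noteq> 0" and tY: "y m + v (Suc m) * t \<noteq> 0" and t0: "t \<noteq> 0"
      by (auto simp: mult.commute simp del: mult_pCons_left mult_pCons_right)
    have "\<forall>i<n. Y t i \<noteq> 0" using tY y0 by (auto simp: Y_def)
    then have CL: "C t \<in> tridiag_variety n" using cSn by (simp add: C_def tri_mat_in_variety)
    moreover have "f (C t) \<noteq> 0"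
      using p(2)[OF CL] superdiag_prod_nonzero[OF CL] tR R[of t] by auto
    moreover have "continuant n (V t) (Y t) \<noteq> 0" using t0 c0 cn by auto
    ultimately show ?thesis unfolding C_def by blast
  qed
qed

lemma regular_functions_no_zero_divisors:
  assumes n: "n \<ge> 1" and f: "f \<in> regular_functions n" and g: "g \<in> regular_functions n"
    and fM: "f M \<noteq> 0" and gN: "g N \<noteq> 0"
  shows "\<exists>M. f M * g M \<noteq> 0"
proof -
  obtain m where m: "n = Suc m" using n by (cases n) auto
  obtain p k where p: "p \<in> polynomial_functions n"
    "\<And>M. M \<in> tridiag_variety n \<Longrightarrow> f M = p M / superdiag_prod n M ^ k"
    "\<And>M. M \<notin> tridiag_variety n \<Longrightarrow> f M = 0" by (rule regular_functionsE[OF f]) blast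
  obtain q l where q: "q \<in> polynomial_functions n"
    "\<And>M. M \<in> tridiag_variety n \<Longrightarrow> g M = q M / superdiag_prod n M ^ l"
    "\<And>M. M \<notin> tridiag_variety n \<Longrightarrow> g M = 0" by (rule regular_functionsE[OF g]) blast
  obtain v y where a: "tri_mat (Suc n) v y \<in> tridiag_variety n" "f (tri_mat (Suc n) v y) \<noteq> 0"
    "continuant n v y \<noteq> 0" using nonvanishing_generic_point[OF n f fM] by blast
  obtain v' y' where b: "tri_mat (Suc n) v' y' \<in> tridiag_variety n"
    "g (tri_mat (Suc n) v' y') \<noteq> 0"
    "continuant n v' y' \<noteq> 0" using nonvanishing_generic_point[OF n g gN] by blast
  define PV where "PV i = [:v i, v' i - v i:]" for i
  define PY where "PY i = [:y i, y' i - y i:]" for i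
  define D where "D = continuant n PV PY"
  define E where "E = 1 + PY m * continuant m PV PY"
  define W where "W t i = (if i = n then poly E t / poly D t else poly (PV i) t)" for t i
  define Y where "Y t i = poly (PY i) t" for t i
  define C where "C t = tri_mat (Suc n) (W t) (Y t)" for t
  have cn: "continuant n (W t) (Y t) = poly D t" for t
    unfolding D_def poly_continuant by (rule continuant_cong) (auto simp: W_def Y_def)
  have cm: "continuant m (W t) (Y t) = poly (continuant m PV PY) t" for t
    unfolding poly_continuant by (rule continuant_cong) (auto simp: W_def Y_def m)
  have cSn: "continuant (Suc n) (W t) (Y t) = 1" if "poly D t \<noteq> 0" for t
  proof -
    have "continuant (Suc n) (W t) (Y t) =
        W t n * continuant n (W t) (Y t) - Y t m * continuant m (W t) (Y t)"
      by (simp add: m)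
    also have "\<dots> = 1" using that unfolding cn cm by (simp add: W_def E_def Y_def)
    finally show ?thesis .
  qed
  have curve: "\<exists>e. \<forall>t. poly D t \<noteq> 0 \<longrightarrow> poly D t * C t $$ (i, j) = poly e t"
    if "i \<le> n" "j \<le> n" for i j
  proof -
    have "\<forall>t. poly D t \<noteq> 0 \<longrightarrow> poly D t * C t $$ (i, j) =
        poly (if i = j then (if i = n then E else D * PV i)
          else if j = i + 1 then D * PY i else if i = j + 1 then D else 0) t"
      using that by (auto simp: C_def tri_mat_def W_def Y_def)
    then show ?thesis by blast
  qed
  obtain R r where R: "\<And>t. poly D t \<noteq> 0 \<Longrightarrow> poly D t ^ r * p (C t) = poly R t"
    using polynomial_on_rational_curve[OF p(1) curve] by blast
  obtain S s where S: "\<And>t. poly D t \<noteq> 0 \<Longrightarrow> poly D t ^ s * q (C t) = poly S t"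
    using polynomial_on_rational_curve[OF q(1) curve] by blast
  have D0: "poly D 0 = continuant n v y" unfolding D_def poly_continuant by (simp add: PV_def PY_def)
  have D1: "poly D 1 = continuant n v' y'" unfolding D_def poly_continuant by (simp add: PV_def PY_def)
  have last: "w n = (1 + z m * continuant m w z) / continuant n w z"
    if "tri_mat (Suc n) w z \<in> tridiag_variety n" "continuant n w z \<noteq> 0" for w z
    using that unfolding tri_mat_in_variety by (auto simp: m field_simps)
  have C0: "C 0 = tri_mat (Suc n) v y"
  proof -
    have "W 0 = v"
      using last[OF a(1,3)] D0 by (auto simp: W_def E_def poly_continuant PV_def PY_def fun_eq_iff simp flip: distrib_right)
    moreover have "Y 0 = y" by (auto simp: Y_def PY_def)
    ultimately show ?thesis by (simp add: C_def tri_mat_def)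
  qed
  have C1: "C 1 = tri_mat (Suc n) v' y'"
  proof -
    have "W 1 = v'"
      using last[OF b(1,3)] D1 by (auto simp: W_def E_def poly_continuant PV_def PY_def fun_eq_iff simp flip: distrib_right)
    moreover have "Y 1 = y'" by (auto simp: Y_def PY_def)
    ultimately show ?thesis by (simp add: C_def tri_mat_def)
  qed
  have "p (C 0) \<noteq> 0" using a(2) p(2)[OF a(1)] unfolding C0 by auto
  then have "R \<noteq> 0" using R[of 0] D0 a(3) by auto
  have "q (C 1) \<noteq> 0" using b(2) q(2)[OF b(1)] unfolding C1 by auto
  then have "S \<noteq> 0" using S[of 1] D1 b(3) by auto
  have "D \<noteq> 0" using D0 a(3) by auto
  have "PY i \<noteq> 0" if "i < n" for i
    using a(1) that unfolding tri_mat_in_variety PY_def by auto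
  then have "(\<Prod>i<n. PY i) \<noteq> 0" by simp
  with \<open>R \<noteq> 0\<close> \<open>S \<noteq> 0\<close> \<open>D \<noteq> 0\<close> obtain t where t: "poly (R * S * D * (\<Prod>i<n. PY i)) t \<noteq> 0"
    using exists_poly_nonzero by (metis no_zero_divisors)
  then have Dt: "poly D t \<noteq> 0" and Rt: "poly R t \<noteq> 0" and St: "poly S t \<noteq> 0"
    and Yt: "\<forall>i<n. Y t i \<noteq> 0" by (auto simp: poly_prod Y_def)
  have CL: "C t \<in> tridiag_variety n"
    unfolding C_def tri_mat_in_variety using cSn[OF Dt] Yt by blast
  have "p (C t) \<noteq> 0" "q (C t) \<noteq> 0" using R[OF Dt] S[OF Dt] Rt St by auto
  then have "f (C t) * g (C t) \<noteq> 0"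
    using p(2)[OF CL] q(2)[OF CL] superdiag_prod_nonzero[OF CL] by auto
  then show ?thesis by blast
qed

text \<open>The coordinate ring of the variety for \<open>n = CARD('n)\<close>; the type parameter only carries the
  number \<open>n\<close>, and every \<open>n \<ge> 1\<close> is the cardinality of some finite type.\<close>

typedef ('n::finite) coord_ring = "regular_functions CARD('n)"
  morphisms fun_of Coord
  using regular_functions_restrict[OF polynomial_functions.const] by blast

setup_lifting type_definition_coord_ring

lift_definition scalar :: "complex \<Rightarrow> 'n::finite coord_ring"
  is "\<lambda>c M. if M \<in> tridiag_variety CARD('n) then c else 0"
  by (rule regular_functions_restrict) (rule polynomial_functions.const)

instantiation coord_ring :: (finite) idom
begin

lift_definition zero_coord_ring :: "'a coord_ring" is "\<lambda>_. 0"
  using regular_functions_restrict[OF polynomial_functions.const[of 0]] by simp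

lift_definition one_coord_ring :: "'a coord_ring"
  is "\<lambda>M. if M \<in> tridiag_variety CARD('a) then 1 else 0"
  by (rule regular_functions_restrict) (rule polynomial_functions.const)

lift_definition plus_coord_ring :: "'a coord_ring \<Rightarrow> 'a coord_ring \<Rightarrow> 'a coord_ring"
  is "\<lambda>f g M. f M + g M" by (rule regular_functions_add)

lift_definition times_coord_ring :: "'a coord_ring \<Rightarrow> 'a coord_ring \<Rightarrow> 'a coord_ring"
  is "\<lambda>f g M. f M * g M" by (rule regular_functions_mult)

lift_definition uminus_coord_ring :: "'a coord_ring \<Rightarrow> 'a coord_ring" is "\<lambda>f M. - f M"
proof -
  fix f assume f: "f \<in> regular_functions CARD('a)"
  have "(\<lambda>M. (if M \<in> tridiag_variety CARD('a) then -1 else 0) * f M) \<in> regular_functions CARD('a)"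
    by (intro regular_functions_mult f regular_functions_restrict polynomial_functions.const)
  moreover have "(\<lambda>M. (if M \<in> tridiag_variety CARD('a) then -1 else 0) * f M) = (\<lambda>M. - f M)"
    using f by (auto simp: regular_functions_outside)
  ultimately show "(\<lambda>M. - f M) \<in> regular_functions CARD('a)" by simp
qed

definition minus_coord_ring :: "'a coord_ring \<Rightarrow> 'a coord_ring \<Rightarrow> 'a coord_ring" where
  "minus_coord_ring f g = f + - g"

instance
proof
  fix a b c :: "'a coord_ring"
  show "a * b * c = a * (b * c)" by transfer (simp add: mult.assoc)
  show "a * b = b * a" by transfer (simp add: mult.commute)
  show "1 * a = a" by transfer (auto simp: regular_functions_outside)
  show "a + b + c = a + (b + c)" by transfer (simp add: add.assoc)
  show "a + b = b + a" by transfer (simp add: add.commute)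
  show "0 + a = a" by transfer simp
  show "- a + a = 0" by transfer simp
  show "a - b = a + - b" by (rule minus_coord_ring_def)
  show "(a + b) * c = a * c + b * c" "a * (b + c) = a * b + a * c"
    by (transfer; simp add: algebra_simps)+
  show "0 * a = 0" "a * 0 = 0" by (transfer; simp)+
  show "(0 :: 'a coord_ring) \<noteq> 1"
    using tridiag_variety_nonempty[of "CARD('a)"] by transfer (auto simp: fun_eq_iff)
  show "a \<noteq> 0 \<Longrightarrow> b \<noteq> 0 \<Longrightarrow> a * b \<noteq> 0"
  proof transfer
    fix f g :: "complex mat \<Rightarrow> complex"
    assume "f \<in> regular_functions CARD('a)" "g \<in> regular_functions CARD('a)"
      and "f \<noteq> (\<lambda>_. 0)" "g \<noteq> (\<lambda>_. 0)"
    moreover have "CARD('a) \<ge> 1" by (simp add: Suc_leI)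
    ultimately show "(\<lambda>M. f M * g M) \<noteq> (\<lambda>_. 0)"
      using regular_functions_no_zero_divisors[of "CARD('a)" f g] by (metis ext)
  qed
qed

end

subsection \<open>Coordinates and principal minors\<close>

text \<open>\<open>y\<^sub>i\<close> for \<open>1 \<le> i \<le> n\<close>, with value 1 at other indices.\<close>

lift_definition y_fun :: "nat \<Rightarrow> 'n::finite coord_ring"
  is "\<lambda>i M. if M \<in> tridiag_variety CARD('n)
            then (if 1 \<le> i \<and> i \<le> CARD('n) then M $$ (i - 1, i) else 1) else 0"
proof (rule regular_functions_restrict)
  fix i
  show "(\<lambda>M. if 1 \<le> i \<and> i \<le> CARD('n) then M $$ (i - 1, i) else 1)
      \<in> polynomial_functions CARD('n)"
    by (cases "1 \<le> i \<and> i \<le> CARD('n)") (auto intro: polynomial_functions.intros)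
qed

lemma regular_functions_minor:
  "(\<lambda>M. if M \<in> tridiag_variety n
        then (if 1 \<le> i \<and> i \<le> j \<and> j \<le> n + 1 then det (submatrix M {i - 1..j - 1} {i - 1..j - 1}) else 1)
        else 0) \<in> regular_functions n"
proof (cases "1 \<le> i \<and> i \<le> j \<and> j \<le> n + 1")
  case True
  define m where "m = j + 1 - i"
  define F where "F M a b = M $$ (pick {i - 1..j - 1} a, pick {i - 1..j - 1} b)" for M :: "complex mat" and a b
  have pick: "pick {i - 1..j - 1} a \<le> n" if "a < m" for a
  proof -
    have "a < card {i - 1..j - 1}" using that True by (simp add: m_def)
    then have "pick {i - 1..j - 1} a \<in> {i - 1..j - 1}" by (rule pick_in_set_le)
    then show ?thesis using True by auto
  qed
  have sub: "submatrix M {i - 1..j - 1} {i - 1..j - 1} = mat m m (\<lambda>(a, b). F M a b)"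
    if "M \<in> tridiag_variety n" for M
  proof -
    have "M \<in> carrier_mat (n + 1) (n + 1)" using that by (simp add: tridiag_variety_def)
    moreover have "{k. k < n + 1 \<and> k \<in> {i - 1..j - 1}} = {i - 1..j - 1}" using True by auto
    moreover have "card {i - 1..j - 1} = m" using True by (simp add: m_def)
    ultimately show ?thesis by (simp add: submatrix_def F_def)
  qed
  have "(\<lambda>M. det (mat m m (\<lambda>(a, b). F M a b))) \<in> polynomial_functions n"
    unfolding F_def by (intro polynomial_functions_det polynomial_functions.entry pick)
  from regular_functions_restrict[OF this] show ?thesis
    using True sub by (simp cong: if_cong)
next
  case False
  then have "(1 \<le> i \<and> i \<le> j \<and> j \<le> n + 1) = False" by blast
  then show ?thesis
    using regular_functions_restrict[OF polynomial_functions.const[of 1]] by (simp only: if_False)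
qed

text \<open>\<open>minor i j\<close> is the minor with rows and columns \<open>i, \<dots>, j\<close> (numbered from 1).\<close>

lift_definition minor :: "nat \<Rightarrow> nat \<Rightarrow> 'n::finite coord_ring"
  is "\<lambda>i j M. if M \<in> tridiag_variety CARD('n)
              then (if 1 \<le> i \<and> i \<le> j \<and> j \<le> CARD('n) + 1
                    then det (submatrix M {i - 1..j - 1} {i - 1..j - 1}) else 1)
              else 0"
  by (rule regular_functions_minor)


section \<open>The initial seed and the relations between minors\<close>

text \<open>The index type \<open>'n\<close> of the seeds is identified with \<open>{1..n}\<close> by a bijection \<open>num\<close>.\<close>

definition initial_x :: "('n::finite \<Rightarrow> nat) \<Rightarrow> 'n \<Rightarrow> 'n coord_ring fract" where
  "initial_x num = (\<lambda>i. to_fract (minor 1 (num i)))"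

definition initial_y :: "('n::finite \<Rightarrow> nat) \<Rightarrow> 'n \<Rightarrow> 'n coord_ring fract" where
  "initial_y num = (\<lambda>i. to_fract (y_fun (num i)))"

definition initial_B :: "('n \<Rightarrow> nat) \<Rightarrow> 'n \<Rightarrow> 'n \<Rightarrow> int" where
  "initial_B num = (\<lambda>i j. if num j = num i + 1 then 1 else if num i = num j + 1 then -1 else 0)"

text \<open>Writing \<open>x i j\<close> for \<open>minor i j\<close>, the identity
  \<open>x i k * x j l = y (j-1) * \<dots> * y k * x i (j-2) * x (k+2) l + x i l * x j k\<close>
  as a formal exchange relation; factors on the right that equal 1 by convention, or as \<open>det M\<close>, are
  dropped from the monomials.\<close>

definition minor_relation :: "nat \<Rightarrow> nat \<Rightarrow> nat \<Rightarrow> nat \<Rightarrow> 'n::finite coord_ring fract exrel" where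
  "minor_relation i j k l = (let x = (\<lambda>a b. to_fract (minor a b)) in
     ({# x i k, x j l #},
      {# (\<Prod>m\<in>{j - 1..k}. to_fract (y_fun m),
            filter_mset (\<lambda>z. z \<noteq> 1) {# x i (j - 2), x (k + 2) l #}),
         (1, filter_mset (\<lambda>z. z \<noteq> 1) {# x i l, x j k #}) #}))"

end

(* The minor x_[i,j] belongs to the chord (i - 1, j + 1) of a polygon with vertices 0, ..., n + 2,
   with boundary edges carrying the value 1.  The minors satisfy the weighted Ptolemy relation
     P(a,c) P(b,d) = y_b ... y_(c-1) P(a,b) P(c,d) + P(a,d) P(b,c)   for a < b < c < d,
   since both sides obey the three-term recurrence of continuants in d.  Every seed in the
   mutation class is a labelled triangulation: the cluster consists of the P-values of its
   diagonals, the exchange matrix counts oriented adjacencies inside triangles, and the coefficient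
   at a diagonal is Z_m' / Z_m with Z_m = y_1 ... y_(m-1), where m and m' are the middle vertices of
   the triangles below and above the diagonal.  Mutation is a flip, and its exchange relation is the
   Ptolemy relation of the quadrilateral.  The initial seed is the fan at vertex 0; every
   quadrilateral occurs because the fan at a turns by flips into the fan at a + 1, and a fan
   contracts to any given pair of adjacent triangles at its apex. *)

theory Submission
  imports Defs
begin

section \<open>Triangulations and flips\<close>

text \<open>What fixes the coefficients is sign coherence. The exponents of a quotient Z_m' / Z_m
  are all in {0, 1} or all in {0, -1}, so y \<oplus> 1 is 1 or y itself. Hence the exchange
  relations at the two diagonals of a quadrilateral are one and the same Ptolemy relation, with y_b
  ... y_(c-1) on the same term. Middle vertices are the right data because a flip of (a, c) changes
  them only at the sides (a, d) and (b, c), exactly where the column of (a, c) has the entry -1.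
  Diagonals never have the value 1, so trivial factors of a formal relation can be discarded by
  their value, which discards precisely the boundary edges. The ring is treated apart from the
  combinatorics. Algebraic independence comes from evaluation: the initial x and y take arbitrary
  non-zero values at points of the variety. The diagonal entries of M are rational in the initial x
  and y, which gives the fraction field, and they are themselves cluster variables, which gives the
  algebra.\<close>

definition diagonals :: "nat \<Rightarrow> (nat \<times> nat) set" where
  "diagonals N = {(p, q). p + 1 < q \<and> q \<le> N \<and> (p, q) \<noteq> (0, N)}"

definition edge :: "nat \<Rightarrow> (nat \<times> nat) set \<Rightarrow> nat \<times> nat \<Rightarrow> bool" where
  "edge N X e \<longleftrightarrow> snd e = fst e + 1 \<or> e = (0, N) \<or> e \<in> X"

definition noncrossing :: "(nat \<times> nat) set \<Rightarrow> bool" where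
  "noncrossing X \<longleftrightarrow> (\<forall>p q p' q'. (p, q) \<in> X \<longrightarrow> (p', q') \<in> X \<longrightarrow> \<not> (p < p' \<and> p' < q \<and> q < q'))"

definition triangles :: "nat \<Rightarrow> (nat \<times> nat) set \<Rightarrow> (nat \<times> nat \<times> nat) set" where
  "triangles N X = {(p, m, q). p < m \<and> m < q \<and> q \<le> N \<and>
     edge N X (p, m) \<and> edge N X (m, q) \<and> edge N X (p, q)}"

definition inner :: "(nat \<times> nat \<times> nat) set \<Rightarrow> nat \<times> nat \<Rightarrow> nat \<Rightarrow> bool" where
  "inner T e m \<longleftrightarrow> (fst e, m, snd e) \<in> T"

text \<open>The triangle above \<open>e\<close> has \<open>e\<close> as one of its two short sides,
  so its middle vertex \<open>m\<close> is an endpoint of \<open>e\<close>. This vertex, and not the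
  one opposite \<open>e\<close>, enters the coefficient.\<close>

definition outer :: "(nat \<times> nat \<times> nat) set \<Rightarrow> nat \<times> nat \<Rightarrow> nat \<Rightarrow> bool" where
  "outer T e m \<longleftrightarrow> (\<exists>p q. (p, m, q) \<in> T \<and> (e = (p, m) \<or> e = (m, q)))"

text \<open>Each triangle is the oriented cycle left, base, right, left; on the fan this orientation
  yields b_(i,i+1) = 1. Boundary edges take part as well and drop out because exchange matrices are
  read off at diagonals only.\<close>

definition arrow :: "nat \<times> nat \<times> nat \<Rightarrow> nat \<times> nat \<Rightarrow> nat \<times> nat \<Rightarrow> int" where
  "arrow t u v = (let left = (fst t, fst (snd t)); right = snd t; base = (fst t, snd (snd t)) in
     of_bool (u = left \<and> v = base \<or> u = base \<and> v = right \<or> u = right \<and> v = left))"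

lemma arrow_triple:
  "arrow (p, m, q) u v =
     of_bool (u = (p, m) \<and> v = (p, q) \<or> u = (p, q) \<and> v = (m, q) \<or> u = (m, q) \<and> v = (p, m))"
  unfolding arrow_def Let_def fst_conv snd_conv ..

text \<open>Summing over triangles, rather than asking for one, makes the effect of a flip a comparison of
  four summands.\<close>

definition quiver :: "(nat \<times> nat \<times> nat) set \<Rightarrow> nat \<times> nat \<Rightarrow> nat \<times> nat \<Rightarrow> int" where
  "quiver T u v = (\<Sum>t\<in>T. arrow t u v - arrow t v u)"

text \<open>A triangle on either side of each diagonal is demanded directly, in place of maximality:
  this is what a flip consumes, and it survives a flip without any counting of diagonals.\<close>

definition triangulation :: "nat \<Rightarrow> (nat \<times> nat) set \<Rightarrow> bool" where
  "triangulation N X \<longleftrightarrow> X \<subseteq> diagonals N \<and> noncrossing X \<and>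
     (\<forall>e\<in>X. (\<exists>m. inner (triangles N X) e m) \<and> (\<exists>m. outer (triangles N X) e m))"

lemma finite_triangles [simp]: "finite (triangles N X)"
  by (rule finite_subset[of _ "{..N} \<times> {..N} \<times> {..N}"]) (auto simp: triangles_def)

lemma edges_noncrossing:
  assumes "noncrossing X" "X \<subseteq> diagonals N" "edge N X (p, q)" "edge N X (p', q')"
    and "p < p'" "p' < q" "q < q'" "q' \<le> N"
  shows False
proof -
  have "q \<le> N" "p' \<noteq> 0" "q \<noteq> N" "q \<noteq> p + 1" "q' \<noteq> p' + 1" using assms(5-8) by auto
  then have "(p, q) \<in> X" "(p', q') \<in> X" using assms(3,4) by (auto simp: edge_def)
  then show False using assms(1,5-7) unfolding noncrossing_def by blast
qed

text \<open>For middle vertices m < m' over the same base (p, q), the side (p, m') of one triangle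
  crosses the side (m, q) of the other.\<close>

lemma inner_unique:
  assumes X: "noncrossing X" "X \<subseteq> diagonals N"
    and "inner (triangles N X) e m" "inner (triangles N X) e m'"
  shows "m = m'"
proof -
  have "\<not> m < m'" if "(p, m, q) \<in> triangles N X" "(p, m', q) \<in> triangles N X" for p m m' q
    using edges_noncrossing[OF X, of p m' m q] that unfolding triangles_def by blast
  then show ?thesis using assms(3,4) unfolding inner_def by (meson linorder_neqE_nat)
qed

text \<open>Only the middle vertex is claimed to be unique, so the one possible conflict is a chord
  that is the left side of one triangle and the right side of another. The bases of these two would
  cross.\<close>

lemma outer_unique:
  assumes X: "noncrossing X" "X \<subseteq> diagonals N"
    and "outer (triangles N X) e m" "outer (triangles N X) e m'"
  shows "m = m'"
proof -
  have "False" if "(p, m, q) \<in> triangles N X" "(r, p, m) \<in> triangles N X" for p m q r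
    using edges_noncrossing[OF X, of r m p q] that unfolding triangles_def by blast
  then show ?thesis using assms(3,4) unfolding outer_def by blast
qed

text \<open>\<open>X\<close> contains neither diagonal of the quadrilateral, so the triangulations
  before and after a flip, in either direction, arise from the same set by inserting one
  chord.\<close>

locale square =
  fixes N :: nat and X :: "(nat \<times> nat) set" and a b c d :: nat
  assumes ord: "a < b" "b < c" "c < d" "d \<le> N"
    and sides: "edge N X (a, b)" "edge N X (b, c)" "edge N X (c, d)" "edge N X (a, d)"
    and diags: "X \<subseteq> diagonals N" "(a, c) \<notin> X" "(b, d) \<notin> X"
begin

abbreviation "X1 \<equiv> insert (a, c) X"
abbreviation "X2 \<equiv> insert (b, d) X"
abbreviation "T0 \<equiv> triangles N X"
abbreviation "T1 \<equiv> triangles N X1"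
abbreviation "T2 \<equiv> triangles N X2"

lemma diags12: "(a, c) \<in> diagonals N" "(b, d) \<in> diagonals N"
  using ord by (auto simp: diagonals_def)

lemma X12: "X1 \<subseteq> diagonals N" "X2 \<subseteq> diagonals N"
  using diags diags12 by auto


lemma edge_insert: "edge N (insert f X) e \<longleftrightarrow> e = f \<or> edge N X e"
  by (auto simp: edge_def)

lemma not_edge: "\<not> edge N X (a, c)" "\<not> edge N X (b, d)"
  using diags diags12 by (auto simp: edge_def diagonals_def)

lemma crossing_free_edge:
  assumes "noncrossing Y" "Y \<subseteq> diagonals N" "edge N Y (p, q)" "q \<le> N" "edge N Y (p', q')" "q' \<le> d"
  shows "\<not> (p' < p \<and> p < q' \<and> q' < q)" "\<not> (p < p' \<and> p' < q \<and> q < q')"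
  using edges_noncrossing[OF assms(1,2,5,3)] edges_noncrossing[OF assms(1,2,3,5)] assms(4,6) ord(4)
  by auto

text \<open>A chord that crosses (b, d) crosses one of the four sides or is (a, c) itself, and (a,
  c) is not in \<open>X\<close>.\<close>

lemma noncrossing12:
  assumes "noncrossing X1"
  shows "noncrossing X2"
proof -
  have no: "\<not> (p < b \<and> b < q \<and> q < d)" "\<not> (b < p \<and> p < d \<and> d < q)" if "(p, q) \<in> X" for p q
  proof -
    have pq: "edge N X1 (p, q)" "q \<le> N" "(p, q) \<noteq> (a, c)"
      using that diags by (auto simp: edge_def diagonals_def)
    have e: "edge N X1 (a, b)" "edge N X1 (b, c)" "edge N X1 (c, d)" "edge N X1 (a, d)"
      using sides by (auto simp: edge_insert)
    note cr = crossing_free_edge[OF assms X12(1) pq(1,2)]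
    show "\<not> (p < b \<and> b < q \<and> q < d)"
      using cr(1)[OF e(1)] cr(2)[OF e(2)] cr(2)[OF e(3)] cr(2)[OF e(4)] pq(3) ord
      by (metis less_imp_le less_trans linorder_neqE_nat order_refl)
    show "\<not> (b < p \<and> p < d \<and> d < q)"
      using cr(1)[OF e(4)] ord(1) by auto
  qed
  have "noncrossing X" using assms unfolding noncrossing_def by blast
  then show ?thesis using no unfolding noncrossing_def by blast
qed

lemma noncrossing21:
  assumes "noncrossing X2"
  shows "noncrossing X1"
proof -
  have no: "\<not> (p < a \<and> a < q \<and> q < c)" "\<not> (a < p \<and> p < c \<and> c < q)" if "(p, q) \<in> X" for p q
  proof -
    have pq: "edge N X2 (p, q)" "q \<le> N" "(p, q) \<noteq> (b, d)"
      using that diags by (auto simp: edge_def diagonals_def)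
    have e: "edge N X2 (a, b)" "edge N X2 (b, c)" "edge N X2 (c, d)" "edge N X2 (a, d)"
      using sides by (auto simp: edge_insert)
    note cr = crossing_free_edge[OF assms X12(2) pq(1,2)]
    show "\<not> (a < p \<and> p < c \<and> c < q)"
      using cr(1)[OF e(1)] cr(1)[OF e(2)] cr(2)[OF e(3)] cr(1)[OF e(4)] pq(3) ord
      by (metis less_imp_le less_trans linorder_neqE_nat order_refl)
    show "\<not> (p < a \<and> a < q \<and> q < c)"
      using cr(2)[OF e(4)] ord by auto
  qed
  have "noncrossing X" using assms unfolding noncrossing_def by blast
  then show ?thesis using no unfolding noncrossing_def by blast
qed

end

locale flip_square = square +
  assumes nc1: "noncrossing X1"
begin

lemmas nc2 = noncrossing12[OF nc1]

text \<open>A triangle of \<open>T1\<close> that is not in \<open>T0\<close> has (a, c) as base,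
  left side or right side. The sides of the quadrilateral then force the middle vertex b, force the
  last vertex d, or are crossed in every case.\<close>

lemma T1_eq: "T1 = T0 \<union> {(a, b, c), (a, c, d)}"
proof (intro equalityI subsetI)
  fix t assume "t \<in> T1"
  then obtain p m q where t: "t = (p, m, q)" "p < m" "m < q" "q \<le> N"
    and e: "edge N X1 (p, m)" "edge N X1 (m, q)" "edge N X1 (p, q)"
    by (auto simp: triangles_def)
  have s: "edge N X1 (a, b)" "edge N X1 (b, c)" "edge N X1 (c, d)" "edge N X1 (a, d)"
    using sides by (auto simp: edge_insert)
  note cr = edges_noncrossing[OF nc1 X12(1)]
  consider "p = a" "q = c" | "p = a" "m = c" | "m = a" "q = c" | "t \<in> T0"
    using t e by (auto simp: triangles_def edge_insert)
  then show "t \<in> T0 \<union> {(a, b, c), (a, c, d)}"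
  proof cases
    case 1
    have "\<not> b < m" using cr[OF e(1) s(2)] 1 t ord by auto
    moreover have "\<not> m < b" using cr[OF s(1) e(2)] 1 t ord by auto
    ultimately show ?thesis using 1 t by simp
  next
    case 2
    have "\<not> q < d" using cr[OF e(3) s(3)] 2 t ord by auto
    moreover have "\<not> d < q" using cr[OF s(4) e(2)] 2 t ord by auto
    ultimately show ?thesis using 2 t by simp
  next
    case 3
    then show ?thesis using cr[OF e(3) s(4)] t ord by simp
  qed simp
qed (use ord sides in \<open>auto simp: triangles_def edge_insert\<close>)

lemma T2_eq: "T2 = T0 \<union> {(a, b, d), (b, c, d)}"
proof (intro equalityI subsetI)
  fix t assume "t \<in> T2"
  then obtain p m q where t: "t = (p, m, q)" "p < m" "m < q" "q \<le> N"
    and e: "edge N X2 (p, m)" "edge N X2 (m, q)" "edge N X2 (p, q)"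
    by (auto simp: triangles_def)
  have s: "edge N X2 (a, b)" "edge N X2 (b, c)" "edge N X2 (c, d)" "edge N X2 (a, d)"
    using sides by (auto simp: edge_insert)
  note cr = edges_noncrossing[OF nc2 X12(2)]
  consider "p = b" "q = d" | "p = b" "m = d" | "m = b" "q = d" | "t \<in> T0"
    using t e by (auto simp: triangles_def edge_insert)
  then show "t \<in> T0 \<union> {(a, b, d), (b, c, d)}"
  proof cases
    case 1
    have "\<not> m < c" using cr[OF s(2) e(2)] 1 t ord by auto
    moreover have "\<not> c < m" using cr[OF e(1) s(3)] 1 t ord by auto
    ultimately show ?thesis using 1 t by simp
  next
    case 2
    then show ?thesis using cr[OF s(4) e(3)] t ord by simp
  next
    case 3
    have "\<not> p < a" using cr[OF e(1) s(4)] 3 t ord by auto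
    moreover have "\<not> a < p" using cr[OF s(1) e(3)] 3 t ord by auto
    ultimately show ?thesis using 3 t by simp
  qed simp
qed (use ord sides in \<open>auto simp: triangles_def edge_insert\<close>)

lemma T0_sides:
  assumes "(p, m, q) \<in> T0"
  shows "(p, m) \<noteq> (a, c)" "(m, q) \<noteq> (a, c)" "(p, q) \<noteq> (a, c)"
    "(p, m) \<noteq> (b, d)" "(m, q) \<noteq> (b, d)" "(p, q) \<noteq> (b, d)"
  using assms not_edge unfolding triangles_def by auto

lemma not_T0: "(a, b, c) \<notin> T0" "(a, c, d) \<notin> T0" "(a, b, d) \<notin> T0" "(b, c, d) \<notin> T0"
  using T0_sides by blast+

text \<open>The flip changes the inner middle vertex only at (a, d), from c to b, and the outer one
  only at (b, c), from b to c. These are the two sides with \<open>\<beta>\<close> equal to -1,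
  which is why coefficient mutation agrees with the flip.\<close>

lemma inner12: "inner T1 u m \<Longrightarrow> u \<noteq> (a, c) \<Longrightarrow> inner T2 u (if u = (a, d) then b else m)"
  unfolding T1_eq T2_eq inner_def by (cases u) auto

lemma inner21: "inner T2 u m \<Longrightarrow> u \<noteq> (b, d) \<Longrightarrow> inner T1 u (if u = (a, d) then c else m)"
  unfolding T1_eq T2_eq inner_def by (cases u) auto

lemma outer12: "outer T1 u m \<Longrightarrow> u \<noteq> (a, c) \<Longrightarrow> outer T2 u (if u = (b, c) then c else m)"
  unfolding T1_eq T2_eq outer_def using ord by auto

lemma outer21: "outer T2 u m \<Longrightarrow> u \<noteq> (b, d) \<Longrightarrow> outer T1 u (if u = (b, c) then b else m)"
  unfolding T1_eq T2_eq outer_def using ord by auto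

lemma diag_inner_outer: "inner T1 (a, c) b" "outer T1 (a, c) c" "inner T2 (b, d) c" "outer T2 (b, d) b"
  unfolding T1_eq T2_eq inner_def outer_def by auto

text \<open>The column of the exchange matrix at the diagonal \<open>(a, c)\<close>.\<close>

definition \<beta> :: "nat \<times> nat \<Rightarrow> int" where
  "\<beta> u = of_bool (u = (a, b)) + of_bool (u = (c, d)) - of_bool (u = (b, c)) - of_bool (u = (a, d))"

lemma quiver_T0: "quiver T0 u (a, c) = 0" "quiver T0 u (b, d) = 0"
proof -
  have "arrow t u e - arrow t e u = 0" if "t \<in> T0" "e = (a, c) \<or> e = (b, d)" for t e
  proof (cases t)
    case (fields p m q)
    then have "(p, m, q) \<in> T0" using that(1) by simp
    then have e: "e \<noteq> (p, m)" "e \<noteq> (m, q)" "e \<noteq> (p, q)" using T0_sides[of p m q] that(2) by metis+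
    show ?thesis unfolding fields arrow_triple by (simp add: e)
  qed
  then show "quiver T0 u (a, c) = 0" "quiver T0 u (b, d) = 0"
    unfolding quiver_def by (blast intro: sum.neutral)+
qed

lemma ne: "a \<noteq> b" "a \<noteq> c" "a \<noteq> d" "b \<noteq> c" "b \<noteq> d" "c \<noteq> d"
    "b \<noteq> a" "c \<noteq> a" "d \<noteq> a" "c \<noteq> b" "d \<noteq> b" "d \<noteq> c"
  using ord by auto

lemma quiver_T1: "quiver T1 u v = quiver T0 u v + (arrow (a, b, c) u v - arrow (a, b, c) v u)
   + (arrow (a, c, d) u v - arrow (a, c, d) v u)"
proof -
  have "T1 = insert (a, b, c) (insert (a, c, d) T0)" unfolding T1_eq by blast
  moreover have "(a, b, c) \<notin> insert (a, c, d) T0" using not_T0 ne by auto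
  ultimately show ?thesis unfolding quiver_def by (simp add: not_T0 ne)
qed

lemma quiver_T2: "quiver T2 u v = quiver T0 u v + (arrow (a, b, d) u v - arrow (a, b, d) v u)
   + (arrow (b, c, d) u v - arrow (b, c, d) v u)"
proof -
  have "T2 = insert (a, b, d) (insert (b, c, d) T0)" unfolding T2_eq by blast
  moreover have "(a, b, d) \<notin> insert (b, c, d) T0" using not_T0 ne by auto
  ultimately show ?thesis unfolding quiver_def by (simp add: not_T0 ne)
qed

lemma side_cases:
  obtains "u = (a, b)" | "u = (b, c)" | "u = (c, d)" | "u = (a, d)"
  | "u \<noteq> (a, b)" "u \<noteq> (b, c)" "u \<noteq> (c, d)" "u \<noteq> (a, d)"
  by blast

lemma \<beta>_simps: "\<beta> (a, b) = 1" "\<beta> (c, d) = 1" "\<beta> (b, c) = -1" "\<beta> (a, d) = -1"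
    "u \<noteq> (a, b) \<Longrightarrow> u \<noteq> (b, c) \<Longrightarrow> u \<noteq> (c, d) \<Longrightarrow> u \<noteq> (a, d) \<Longrightarrow> \<beta> u = 0"
  by (simp_all add: \<beta>_def ne)

lemma pos_part_simps: "pos_part 1 = 1" "pos_part 0 = 0" "pos_part (- 1) = 0"
  by (simp_all add: pos_part_def)

lemma quiver_diag: "quiver T1 u (a, c) = \<beta> u" "quiver T2 u (b, d) = - \<beta> u"
  unfolding quiver_T1 quiver_T2 quiver_T0
  by (cases u rule: side_cases; simp add: \<beta>_simps arrow_triple ne)+

text \<open>The column of (a, c) is \<open>\<beta>\<close> and its row is \<open>- \<beta>\<close>,
  so this is matrix mutation at (a, c). At (b, d) both signs are reversed, and the same identity
  solved for \<open>quiver T1 u v\<close> is the mutation back.\<close>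

lemma quiver_flip:
  assumes "u \<noteq> (a, c)" "v \<noteq> (a, c)" "u \<noteq> (b, d)" "v \<noteq> (b, d)"
  shows "quiver T2 u v = quiver T1 u v + pos_part (\<beta> u) * pos_part (- \<beta> v)
           - pos_part (- \<beta> u) * pos_part (\<beta> v)"
  \<comment> \<open>The common summand \<open>quiver T0 u v\<close> cancels; the rest depends only
    on which of the four sides \<open>u\<close> and \<open>v\<close> are, if any.\<close>
  unfolding quiver_T1 quiver_T2 using assms
  by (cases u rule: side_cases; cases v rule: side_cases;
      simp add: \<beta>_simps pos_part_simps arrow_triple ne)

lemma quiver_antisym: "quiver T u v = - quiver T v u"
  unfolding quiver_def by (simp add: sum_subtractf)

lemma triangulation12: "triangulation N X1 \<longleftrightarrow> triangulation N X2"
proof -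
  have "(\<forall>e\<in>X1. (\<exists>m. inner T1 e m) \<and> (\<exists>m. outer T1 e m)) \<longleftrightarrow>
        (\<forall>e\<in>X. (\<exists>m. inner T1 e m) \<and> (\<exists>m. outer T1 e m))"
    using diag_inner_outer by blast
  also have "\<dots> \<longleftrightarrow> (\<forall>e\<in>X. (\<exists>m. inner T2 e m) \<and> (\<exists>m. outer T2 e m))"
  proof (intro ball_cong refl)
    fix e assume "e \<in> X"
    then have e: "e \<noteq> (a, c)" "e \<noteq> (b, d)" using diags by auto
    show "(\<exists>m. inner T1 e m) \<and> (\<exists>m. outer T1 e m) \<longleftrightarrow> (\<exists>m. inner T2 e m) \<and> (\<exists>m. outer T2 e m)"
      using inner12[OF _ e(1)] inner21[OF _ e(2)] outer12[OF _ e(1)] outer21[OF _ e(2)] by blast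
  qed
  also have "\<dots> \<longleftrightarrow> (\<forall>e\<in>X2. (\<exists>m. inner T2 e m) \<and> (\<exists>m. outer T2 e m))"
    using diag_inner_outer by blast
  finally show ?thesis unfolding triangulation_def using nc1 nc2 X12 by blast
qed

end

lemma edge_remove: "edge N X f \<Longrightarrow> f \<noteq> e \<Longrightarrow> edge N (X - {e}) f"
  by (auto simp: edge_def)

lemma flip_square_triangles:
  assumes X: "triangulation N X"
  shows "(a, b, c) \<in> triangles N X \<Longrightarrow> (a, c, d) \<in> triangles N X \<Longrightarrow>
      (a, c) \<in> X \<and> flip_square N (X - {(a, c)}) a b c d"
    and "(a, b, d) \<in> triangles N X \<Longrightarrow> (b, c, d) \<in> triangles N X \<Longrightarrow>
      (b, d) \<in> X \<and> flip_square N (X - {(b, d)}) a b c d"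
proof -
  have dg: "X \<subseteq> diagonals N" and nc: "noncrossing X" using X by (auto simp: triangulation_def)
  {
    assume t: "(a, b, c) \<in> triangles N X" "(a, c, d) \<in> triangles N X"
    have e: "(a, c) \<in> X" using t by (auto simp: triangles_def edge_def)
    then have ins: "insert (a, c) (X - {(a, c)}) = X" by blast
    have "square N (X - {(a, c)}) a b c d"
      using t dg nc e
      by unfold_locales (auto simp: triangles_def noncrossing_def intro!: edge_remove)
    then interpret square N "X - {(a, c)}" a b c d .
    have "flip_square N (X - {(a, c)}) a b c d"
      by unfold_locales (simp only: ins nc)
    with e show "(a, c) \<in> X \<and> flip_square N (X - {(a, c)}) a b c d" ..
  next
    assume t: "(a, b, d) \<in> triangles N X" "(b, c, d) \<in> triangles N X"
    have e: "(b, d) \<in> X" using t by (auto simp: triangles_def edge_def)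
    then have ins: "insert (b, d) (X - {(b, d)}) = X" by blast
    have "square N (X - {(b, d)}) a b c d"
      using t dg nc e
      by unfold_locales (auto simp: triangles_def noncrossing_def intro!: edge_remove)
    then interpret square N "X - {(b, d)}" a b c d .
    have "flip_square N (X - {(b, d)}) a b c d"
      by unfold_locales (rule noncrossing21, simp only: ins nc)
    with e show "(b, d) \<in> X \<and> flip_square N (X - {(b, d)}) a b c d" ..
  }
qed

text \<open>The triangles below and above \<open>e\<close> form the quadrilateral: \<open>e\<close>
  is its diagonal (a, c) if it is the left side of the triangle above, and (b, d) if it is the right
  side.\<close>

lemma triangulation_square:
  assumes X: "triangulation N X" and e: "e \<in> X"
  obtains a b c d where "flip_square N (X - {e}) a b c d" "e = (a, c)"
  | a b c d where "flip_square N (X - {e}) a b c d" "e = (b, d)"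
proof -
  obtain p q where pq: "e = (p, q)" by (cases e)
  obtain m where m: "(p, m, q) \<in> triangles N X"
    using X e pq unfolding triangulation_def inner_def by fastforce
  obtain r s m' where o: "(r, m', s) \<in> triangles N X" "e = (r, m') \<or> e = (m', s)"
    using X e unfolding triangulation_def outer_def by fastforce
  from o(2) show thesis
  proof
    assume "e = (r, m')"
    then show thesis using flip_square_triangles(1)[OF X, of p m q s] m o(1) pq that(1) by auto
  next
    assume "e = (m', s)"
    then show thesis using flip_square_triangles(2)[OF X, of r p q m] m o(1) pq that(2) by auto
  qed
qed

section \<open>Seeds of triangulations\<close>

lemma semifield_right_inverse: "a * inverse a = (1 :: 'a::semifield)"
  using semifield_left_inverse[of a] by (simp add: mult.commute)

lemma semifield_cancel: "a * (inverse a * b) = (b :: 'a::semifield)" "inverse a * (a * b) = b"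
  by (simp_all add: semifield_right_inverse semifield_left_inverse flip: mult.assoc)

lemma semifield_telescope:
  "x * inverse y * (y * inverse z) = x * inverse (z :: 'a::semifield)"
  "y * inverse z * (x * inverse y) = x * inverse (z :: 'a::semifield)"
proof -
  show *: "x * inverse y * (y * inverse z) = x * inverse z" for x y z :: 'a
    by (simp add: mult.assoc semifield_cancel)
  show "y * inverse z * (x * inverse y) = x * inverse z"
    using *[of x y z] by (simp add: mult.commute)
qed

lemma semifield_inverse_eqI:
  assumes "a * b = (1 :: 'a::semifield)"
  shows "inverse a = b"
proof -
  have "inverse a * (a * b) = inverse a * 1" using assms by simp
  then show ?thesis by (simp add: semifield_cancel)
qed

lemma semifield_inverse_divide: "inverse (a * inverse b) = b * inverse (a :: 'a::semifield)"
proof (rule semifield_inverse_eqI)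
  have "a * inverse b * (b * inverse a) = a * (inverse b * (b * inverse a))" by (simp only: mult.assoc)
  then show "a * inverse b * (b * inverse a) = 1" by (simp add: semifield_cancel semifield_right_inverse)
qed

lemma semifield_inverse_one: "inverse 1 = (1 :: 'a::semifield)"
  by (rule semifield_inverse_eqI) simp

lemma semifield_powi_simps [simp]:
  "(1 :: 'a::semifield) powi n = 1" "(a :: 'a) powi 0 = 1" "a powi 1 = a" "a powi (- 1) = inverse a"
  by (simp_all add: power_int_def semifield_inverse_one)

text \<open>Collects what the flips use about minors. \<open>Y b c\<close> stands for y_b ...
  y_(c-1), and all coefficients are quotients of values of the tropical elements \<open>Z\<close>.
  In a quadrilateral a < b < c < d the vertices b and c satisfy 0 < b and c < N, hence the range in
  the assumptions.\<close>

locale triangulation_seeds =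
  fixes N :: nat and \<iota> :: "'p::semifield \<Rightarrow> 'f::field" and P :: "nat \<times> nat \<Rightarrow> 'f"
    and Z :: "nat \<Rightarrow> 'p" and Y :: "nat \<Rightarrow> nat \<Rightarrow> 'f"
  assumes P_boundary: "P (p, p + 1) = 1" "P (0, N) = 1"
    and P_diagonal: "e \<in> diagonals N \<Longrightarrow> P e \<noteq> 0" "e \<in> diagonals N \<Longrightarrow> P e \<noteq> 1"
    and ptolemy: "\<lbrakk>a < b; b < c; c < d; d \<le> N\<rbrakk> \<Longrightarrow>
      P (a, c) * P (b, d) = Y b c * P (a, b) * P (c, d) + P (a, d) * P (b, c)"
    and Y_nonzero: "\<lbrakk>0 < b; b < c; c < N\<rbrakk> \<Longrightarrow> Y b c \<noteq> 0"
    and \<iota>_Z: "\<lbrakk>0 < b; b < c; c < N\<rbrakk> \<Longrightarrow> \<iota> (Z c * inverse (Z b)) = Y b c"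
      "\<lbrakk>0 < b; b < c; c < N\<rbrakk> \<Longrightarrow> \<iota> (Z b * inverse (Z c)) = inverse (Y b c)"
    and \<iota>_one: "\<iota> 1 = 1"
    and Z_plus_one: "\<lbrakk>0 < b; b < c; c < N\<rbrakk> \<Longrightarrow> Z c * inverse (Z b) + 1 = 1"
      "\<lbrakk>0 < b; b < c; c < N\<rbrakk> \<Longrightarrow> Z b * inverse (Z c) + 1 = Z b * inverse (Z c)"
begin

text \<open>In a triangulation both middle vertices at a diagonal exist and are unique, so the last
  clause determines every coefficient although it is stated as an implication.\<close>

definition seed_of :: "('n::finite \<Rightarrow> nat \<times> nat) \<Rightarrow> ('n, 'p, 'f) seed \<Rightarrow> bool" where
  "seed_of D S \<longleftrightarrow> inj D \<and> triangulation N (range D) \<and> cluster S = P \<circ> D \<and>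
     exmat S = (\<lambda>i j. quiver (triangles N (range D)) (D i) (D j)) \<and>
     (\<forall>i m m'. inner (triangles N (range D)) (D i) m \<longrightarrow> outer (triangles N (range D)) (D i) m' \<longrightarrow>
        coeffs S i = Z m' * inverse (Z m))"

definition ptolemy_relation :: "nat \<Rightarrow> nat \<Rightarrow> nat \<Rightarrow> nat \<Rightarrow> 'f exrel" where
  "ptolemy_relation a b c d =
     ({# P (a, c), P (b, d) #},
      {# (Y b c, filter_mset (\<lambda>z. z \<noteq> 1) {# P (a, b), P (c, d) #}),
         (1, filter_mset (\<lambda>z. z \<noteq> 1) {# P (a, d), P (b, c) #}) #})"

lemma P_edge:
  assumes "edge N X e" "X \<subseteq> diagonals N"
  shows "e \<in> X \<longleftrightarrow> P e \<noteq> 1"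
  using assms P_boundary P_diagonal(2) by (cases e) (auto simp: edge_def)

text \<open>A boundary edge belongs to no index, but its value is 1, so the empty product is correct
  for it too.\<close>

lemma prod_edge:
  fixes D :: "'n::finite \<Rightarrow> nat \<times> nat"
  assumes D: "inj D" "range D \<subseteq> diagonals N" and e: "edge N (range D) e"
  shows "(\<Prod>i\<in>UNIV. if D i = e then P (D i) else 1) = P e"
proof (cases "e \<in> range D")
  case True
  then obtain k where k: "e = D k" by blast
  then have "(\<Prod>i\<in>UNIV. if D i = e then P (D i) else 1) = (\<Prod>i\<in>UNIV. if i = k then P e else 1)"
    using D(1) by (auto intro!: prod.cong simp: inj_eq)
  then show ?thesis by simp
next
  case False
  then have "D i \<noteq> e" for i by auto
  then show ?thesis using P_edge[OF e D(2)] False by simp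
qed

lemma mset_edge:
  fixes D :: "'n::finite \<Rightarrow> nat \<times> nat"
  assumes D: "inj D" "range D \<subseteq> diagonals N" and e: "edge N (range D) e"
  shows "(\<Sum>i\<in>UNIV. if D i = e then {# P (D i) #} else {#}) = filter_mset (\<lambda>z. z \<noteq> 1) {# P e #}"
proof (cases "e \<in> range D")
  case True
  then obtain k where k: "e = D k" by blast
  then have "(\<Sum>i\<in>UNIV. if D i = e then {# P (D i) #} else {#}) = (\<Sum>i\<in>UNIV. if i = k then {# P e #} else {#})"
    using D(1) by (auto intro!: sum.cong simp: inj_eq)
  then show ?thesis using P_edge[OF e D(2)] True by simp
next
  case False
  then have "D i \<noteq> e" for i by auto
  then show ?thesis using P_edge[OF e D(2)] False by simp
qed

lemma monomials:
  fixes D :: "'n::finite \<Rightarrow> nat \<times> nat"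
  assumes D: "inj D" "range D \<subseteq> diagonals N"
    and ef: "edge N (range D) e" "edge N (range D) f" "e \<noteq> f"
    and m: "\<And>i. m i = of_bool (D i = e) + of_bool (D i = f)"
  shows "(\<Prod>i\<in>UNIV. P (D i) powi m i) = P e * P f"
    and "(\<Sum>i\<in>UNIV. replicate_mset (nat (m i)) (P (D i))) = filter_mset (\<lambda>z. z \<noteq> 1) {# P e, P f #}"
proof -
  have "(\<Prod>i\<in>UNIV. P (D i) powi m i) =
      (\<Prod>i\<in>UNIV. (if D i = e then P (D i) else 1) * (if D i = f then P (D i) else 1))"
    using ef(3) by (intro prod.cong) (auto simp: m)
  then show "(\<Prod>i\<in>UNIV. P (D i) powi m i) = P e * P f"
    by (simp add: prod.distrib prod_edge[OF D] ef)
  have "(\<Sum>i\<in>UNIV. replicate_mset (nat (m i)) (P (D i))) =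
      (\<Sum>i\<in>UNIV. (if D i = e then {# P (D i) #} else {#}) + (if D i = f then {# P (D i) #} else {#}))"
    using ef(3) by (intro sum.cong) (auto simp: m)
  also have "\<dots> = filter_mset (\<lambda>z. z \<noteq> 1) {# P e #} + filter_mset (\<lambda>z. z \<noteq> 1) {# P f #}"
    by (simp only: sum.distrib mset_edge[OF D] ef)
  finally show "(\<Sum>i\<in>UNIV. replicate_mset (nat (m i)) (P (D i))) = filter_mset (\<lambda>z. z \<noteq> 1) {# P e, P f #}"
    by simp
qed

end

context flip_square
begin

lemma pos_part_\<beta>:
  "pos_part (\<beta> u) = of_bool (u = (a, b)) + of_bool (u = (c, d))"
  "pos_part (- \<beta> u) = of_bool (u = (a, d)) + of_bool (u = (b, c))"
  by (cases u rule: side_cases; simp add: \<beta>_simps pos_part_simps ne)+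

lemma range_flip:
  fixes D :: "'n \<Rightarrow> nat \<times> nat"
  assumes "X = range D - {D k}" "inj D"
  shows "range (D(k := e)) = insert e X" "i \<noteq> k \<Longrightarrow> D i \<in> X"
proof -
  show "i \<noteq> k \<Longrightarrow> D i \<in> X" using assms by (auto simp: inj_eq)
  show "range (D(k := e)) = insert e X"
    unfolding assms(1) using assms(2) by (auto simp: inj_eq image_iff split: if_splits)
qed

lemma inj_flip:
  fixes D :: "'n \<Rightarrow> nat \<times> nat"
  assumes "X = range D - {D k}" "inj D" "e \<notin> X"
  shows "inj (D(k := e))"
  using assms range_flip(2)[OF assms(1,2)] by (auto simp: inj_def)

end

context triangulation_seeds
begin

text \<open>At (a, c) the middle vertices are b below and c above. So y_k = Z_c / Z_b and y_k
  \<oplus> 1 = 1, and the new variable is the Ptolemy relation solved for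
  \<open>P (b, d)\<close>.\<close>

lemma flip_ac:
  fixes D :: "'n::finite \<Rightarrow> nat \<times> nat"
  assumes S: "seed_of D S" and sq: "flip_square N (range D - {D k}) a b c d" and k: "D k = (a, c)"
  shows "seed_of (D(k := (b, d))) (mutate \<iota> k S)"
    and "exchange_relation \<iota> k S = ptolemy_relation a b c d"
proof -
  define X where "X = range D - {D k}"
  interpret flip_square N X a b c d using sq unfolding X_def .
  have inj: "inj D" and tri: "triangulation N (range D)" and cl: "cluster S = P \<circ> D"
    and B: "exmat S = (\<lambda>i j. quiver (triangles N (range D)) (D i) (D j))"
    and y: "\<And>i m m'. inner (triangles N (range D)) (D i) m \<Longrightarrow> outer (triangles N (range D)) (D i) m' \<Longrightarrow>
        coeffs S i = Z m' * inverse (Z m)"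
    using S unfolding seed_of_def by auto
  have R: "range D = X1" unfolding X_def using k by (metis insert_Diff rangeI)
  have D: "range D \<subseteq> diagonals N" using tri by (simp add: triangulation_def)
  have DX: "D i \<in> X" "D i \<noteq> (a, c)" "D i \<noteq> (b, d)" if "i \<noteq> k" for i
    using range_flip(2)[OF X_def inj that] diags by auto
  have R': "range (D(k := (b, d))) = X2" by (rule range_flip(1)[OF X_def inj])
  have bc: "0 < b" "b < c" "c < N" using ord by auto
  have ed: "edge N (range D) (a, b)" "edge N (range D) (b, c)" "edge N (range D) (c, d)"
    "edge N (range D) (a, d)" unfolding R by (auto simp: edge_insert sides)
  have Bk: "exmat S i k = \<beta> (D i)" for i unfolding B R k by (rule quiver_diag)
  have Bk': "exmat S k i = - \<beta> (D i)" for i unfolding B R k by (subst quiver_antisym) (simp add: quiver_diag)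
  have yk: "coeffs S k = Z c * inverse (Z b)"
    by (rule y) (simp_all add: R k diag_inner_outer)
  have \<iota>y: "\<iota> (coeffs S k) = Y b c" "coeffs S k + 1 = 1"
    using \<iota>_Z(1)[OF bc] Z_plus_one(1)[OF bc] by (simp_all add: yk)
  note m1 = monomials[OF inj D ed(1,3), of "\<lambda>i. pos_part (exmat S i k)"]
  note m2 = monomials[OF inj D ed(4,2), of "\<lambda>i. pos_part (- exmat S i k)"]
  have mon1: "(\<Prod>i\<in>UNIV. cluster S i powi pos_part (exmat S i k)) = P (a, b) * P (c, d)"
    "(\<Sum>i\<in>UNIV. replicate_mset (nat (pos_part (exmat S i k))) (cluster S i)) =
       filter_mset (\<lambda>z. z \<noteq> 1) {# P (a, b), P (c, d) #}"
    using m1 by (simp_all add: Bk pos_part_\<beta> ne cl)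
  have mon2: "(\<Prod>i\<in>UNIV. cluster S i powi pos_part (- exmat S i k)) = P (a, d) * P (b, c)"
    "(\<Sum>i\<in>UNIV. replicate_mset (nat (pos_part (- exmat S i k))) (cluster S i)) =
       filter_mset (\<lambda>z. z \<noteq> 1) {# P (a, d), P (b, c) #}"
    using m2 by (simp_all add: Bk pos_part_\<beta> ne cl)
  have xk: "cluster S k = P (a, c)" by (simp add: cl k)
  have pt: "P (a, c) * P (b, d) = Y b c * (P (a, b) * P (c, d)) + P (a, d) * P (b, c)"
    using ptolemy[OF ord] by (simp add: mult.assoc)
  have x': "mutate_cluster \<iota> k S = (cluster S)(k := P (b, d))"
    using P_diagonal(1)[OF diags12(1)] unfolding mutate_cluster_def Let_def mon1 mon2 \<iota>y xk \<iota>_one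
    by (simp add: pt[symmetric])
  show "exchange_relation \<iota> k S = ptolemy_relation a b c d"
    unfolding exchange_relation_def Let_def x' mon1 mon2 \<iota>y \<iota>_one xk ptolemy_relation_def by simp
  have inj': "inj (D(k := (b, d)))" by (rule inj_flip[OF X_def inj diags(3)])
  have tri': "triangulation N (range (D(k := (b, d))))"
    using tri unfolding R R' triangulation12 .
  have B': "mutate_exmat k (exmat S) i j = quiver T2 ((D(k := (b, d))) i) ((D(k := (b, d))) j)" for i j
  proof -
    have "quiver T2 ((D(k := (b, d))) i) ((D(k := (b, d))) j) = - exmat S i j" if "i = k \<or> j = k"
    proof (cases "i = j")
      case True
      then show ?thesis by (simp add: B quiver_def)
    next
      case False
      then show ?thesis using that Bk[of i] Bk'[of j]
        by (auto simp: quiver_diag quiver_antisym[of _ "(b, d)"])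
    qed
    moreover have "quiver T2 (D i) (D j) = exmat S i j + pos_part (exmat S i k) * pos_part (exmat S k j)
        - pos_part (- exmat S i k) * pos_part (- exmat S k j)" if "i \<noteq> k" "j \<noteq> k"
      using quiver_flip[of "D i" "D j"] DX[OF that(1)] DX[OF that(2)] by (simp add: Bk Bk') (simp add: B R)
    ultimately show ?thesis by (auto simp: mutate_exmat_def)
  qed
  have y': "mutate_coeffs k (exmat S) (coeffs S) i = Z m' * inverse (Z m)"
    if io: "inner T2 ((D(k := (b, d))) i) m" "outer T2 ((D(k := (b, d))) i) m'" for i m m'
  proof (cases "i = k")
    case True
    then have "m = c" "m' = b"
      using inner_unique[OF nc2 X12(2) _ diag_inner_outer(3)] outer_unique[OF nc2 X12(2) _ diag_inner_outer(4)] io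
      by auto
    then show ?thesis using True by (simp add: mutate_coeffs_def yk semifield_inverse_divide)
  next
    case False
    then have i: "inner T2 (D i) m" "outer T2 (D i) m'" using io by auto
    \<comment> \<open>The old middle vertices are recovered from the new ones by the reverse
      flip.\<close>
    have "coeffs S i = Z (if D i = (b, c) then b else m') * inverse (Z (if D i = (a, d) then c else m))"
      using inner21[OF i(1) DX(3)[OF False]] outer21[OF i(2) DX(3)[OF False]] unfolding R[symmetric] by (intro y)
    moreover have "D i = (a, d) \<Longrightarrow> m = b" using inner12[OF inner21[OF i(1)]] DX[OF False] i
      inner_unique[OF nc2 X12(2) i(1)] by auto
    moreover have "D i = (b, c) \<Longrightarrow> m' = c" using outer12[OF outer21[OF i(2)]] DX[OF False] i
      outer_unique[OF nc2 X12(2) i(2)] by auto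
    \<comment> \<open>Row \<open>k\<close> of the exchange matrix is \<open>- \<beta>\<close>, so
      y_k = Z_c / Z_b is multiplied in only at (a, d) and (b, c). There it telescopes: Z_m' / Z_c
      becomes Z_m' / Z_b, and Z_b / Z_m becomes Z_c / Z_m.\<close>
    moreover have "mutate_coeffs k (exmat S) (coeffs S) i =
        coeffs S i * (Z c * inverse (Z b)) powi pos_part (- \<beta> (D i))"
      using False by (simp add: mutate_coeffs_def Bk' \<iota>y(2)) (simp add: yk)
    ultimately show ?thesis
      by (cases "D i" rule: side_cases)
        (simp_all add: \<beta>_simps pos_part_simps ne semifield_telescope)
  qed
  show "seed_of (D(k := (b, d))) (mutate \<iota> k S)"
    unfolding seed_of_def mutate_def seed.simps R' x' cl
    using inj' tri'[unfolded R'] B' y' by (auto simp: fun_eq_iff)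
qed

text \<open>At (b, d) the coefficient is y_k = Z_b / Z_c with y_k \<oplus> 1 = y_k. Division by it
  leaves the coefficient 1 on the first term and \<open>Y b c\<close> on the second, so the two
  terms of the Ptolemy relation appear in the opposite order.\<close>

lemma flip_bd:
  fixes D :: "'n::finite \<Rightarrow> nat \<times> nat"
  assumes S: "seed_of D S" and sq: "flip_square N (range D - {D k}) a b c d" and k: "D k = (b, d)"
  shows "seed_of (D(k := (a, c))) (mutate \<iota> k S)"
    and "exchange_relation \<iota> k S = ptolemy_relation a b c d"
proof -
  define X where "X = range D - {D k}"
  interpret flip_square N X a b c d using sq unfolding X_def .
  have inj: "inj D" and tri: "triangulation N (range D)" and cl: "cluster S = P \<circ> D"
    and B: "exmat S = (\<lambda>i j. quiver (triangles N (range D)) (D i) (D j))"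
    and y: "\<And>i m m'. inner (triangles N (range D)) (D i) m \<Longrightarrow> outer (triangles N (range D)) (D i) m' \<Longrightarrow>
        coeffs S i = Z m' * inverse (Z m)"
    using S unfolding seed_of_def by auto
  have R: "range D = X2" unfolding X_def using k by (metis insert_Diff rangeI)
  have D: "range D \<subseteq> diagonals N" using tri by (simp add: triangulation_def)
  have DX: "D i \<in> X" "D i \<noteq> (a, c)" "D i \<noteq> (b, d)" if "i \<noteq> k" for i
    using range_flip(2)[OF X_def inj that] diags by auto
  have R': "range (D(k := (a, c))) = X1" by (rule range_flip(1)[OF X_def inj])
  have bc: "0 < b" "b < c" "c < N" using ord by auto
  have ed: "edge N (range D) (a, b)" "edge N (range D) (b, c)" "edge N (range D) (c, d)"
    "edge N (range D) (a, d)" unfolding R by (auto simp: edge_insert sides)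
  have Bk: "exmat S i k = - \<beta> (D i)" for i unfolding B R k by (rule quiver_diag)
  have Bk': "exmat S k i = \<beta> (D i)" for i unfolding B R k by (subst quiver_antisym) (simp add: quiver_diag)
  have yk: "coeffs S k = Z b * inverse (Z c)"
    by (rule y) (simp_all add: R k diag_inner_outer)
  have \<iota>y: "\<iota> (coeffs S k) = inverse (Y b c)" "coeffs S k + 1 = coeffs S k"
    using \<iota>_Z(2)[OF bc] Z_plus_one(2)[OF bc] by (simp_all add: yk)
  note m1 = monomials[OF inj D ed(4,2), of "\<lambda>i. pos_part (exmat S i k)"]
  note m2 = monomials[OF inj D ed(1,3), of "\<lambda>i. pos_part (- exmat S i k)"]
  have mon1: "(\<Prod>i\<in>UNIV. cluster S i powi pos_part (exmat S i k)) = P (a, d) * P (b, c)"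
    "(\<Sum>i\<in>UNIV. replicate_mset (nat (pos_part (exmat S i k))) (cluster S i)) =
       filter_mset (\<lambda>z. z \<noteq> 1) {# P (a, d), P (b, c) #}"
    using m1 by (simp_all add: Bk pos_part_\<beta> ne cl)
  have mon2: "(\<Prod>i\<in>UNIV. cluster S i powi pos_part (- exmat S i k)) = P (a, b) * P (c, d)"
    "(\<Sum>i\<in>UNIV. replicate_mset (nat (pos_part (- exmat S i k))) (cluster S i)) =
       filter_mset (\<lambda>z. z \<noteq> 1) {# P (a, b), P (c, d) #}"
    using m2 by (simp_all add: Bk pos_part_\<beta> ne cl)
  have xk: "cluster S k = P (b, d)" by (simp add: cl k)
  have pt: "P (a, c) * P (b, d) = Y b c * (P (a, b) * P (c, d)) + P (a, d) * P (b, c)"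
    using ptolemy[OF ord] by (simp add: mult.assoc)
  have "(inverse (Y b c) * (P (a, d) * P (b, c)) + P (a, b) * P (c, d)) / inverse (Y b c) / P (b, d) = P (a, c)"
    using P_diagonal(1)[OF diags12(2)] Y_nonzero[OF bc] pt by (simp add: field_simps)
  then have x': "mutate_cluster \<iota> k S = (cluster S)(k := P (a, c))"
    unfolding mutate_cluster_def Let_def mon1 mon2 \<iota>y xk by simp
  show "exchange_relation \<iota> k S = ptolemy_relation a b c d"
    using Y_nonzero[OF bc]
    unfolding exchange_relation_def Let_def x' mon1 mon2 \<iota>y xk ptolemy_relation_def
    by (simp add: add_mset_commute inverse_eq_divide)
  have inj': "inj (D(k := (a, c)))" by (rule inj_flip[OF X_def inj diags(2)])
  have tri': "triangulation N (range (D(k := (a, c))))"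
    using tri unfolding R R' triangulation12 .
  have B': "mutate_exmat k (exmat S) i j = quiver T1 ((D(k := (a, c))) i) ((D(k := (a, c))) j)" for i j
  proof -
    have "quiver T1 ((D(k := (a, c))) i) ((D(k := (a, c))) j) = - exmat S i j" if "i = k \<or> j = k"
    proof (cases "i = j")
      case True
      then show ?thesis by (simp add: B quiver_def)
    next
      case False
      then show ?thesis using that Bk[of i] Bk'[of j]
        by (auto simp: quiver_diag quiver_antisym[of _ "(a, c)"])
    qed
    moreover have "quiver T1 (D i) (D j) = exmat S i j + pos_part (exmat S i k) * pos_part (exmat S k j)
        - pos_part (- exmat S i k) * pos_part (- exmat S k j)" if "i \<noteq> k" "j \<noteq> k"
      using quiver_flip[of "D i" "D j"] DX[OF that(1)] DX[OF that(2)] by (simp add: Bk Bk') (simp add: B R)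
    ultimately show ?thesis by (auto simp: mutate_exmat_def)
  qed
  have y': "mutate_coeffs k (exmat S) (coeffs S) i = Z m' * inverse (Z m)"
    if io: "inner T1 ((D(k := (a, c))) i) m" "outer T1 ((D(k := (a, c))) i) m'" for i m m'
  proof (cases "i = k")
    case True
    then have "m = b" "m' = c"
      using inner_unique[OF nc1 X12(1) _ diag_inner_outer(1)] outer_unique[OF nc1 X12(1) _ diag_inner_outer(2)] io
      by auto
    then show ?thesis using True by (simp add: mutate_coeffs_def yk semifield_inverse_divide)
  next
    case False
    then have i: "inner T1 (D i) m" "outer T1 (D i) m'" using io by auto
    have "coeffs S i = Z (if D i = (b, c) then c else m') * inverse (Z (if D i = (a, d) then b else m))"
      using inner12[OF i(1) DX(2)[OF False]] outer12[OF i(2) DX(2)[OF False]] unfolding R[symmetric] by (intro y)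
    moreover have "D i = (a, d) \<Longrightarrow> m = c" using inner21[OF inner12[OF i(1)]] DX[OF False] i
      inner_unique[OF nc1 X12(1) i(1)] by auto
    moreover have "D i = (b, c) \<Longrightarrow> m' = b" using outer21[OF outer12[OF i(2)]] DX[OF False] i
      outer_unique[OF nc1 X12(1) i(2)] by auto
    \<comment> \<open>As y_k \<oplus> 1 = y_k, the exponents of y_k add up to [\<beta>]_+ - \<beta>
      = [-\<beta>]_+, so again only (a, d) and (b, c) are affected.\<close>
    moreover have "mutate_coeffs k (exmat S) (coeffs S) i =
        coeffs S i * (Z b * inverse (Z c)) powi pos_part (\<beta> (D i)) * (Z b * inverse (Z c)) powi (- \<beta> (D i))"
      using False by (simp add: mutate_coeffs_def Bk' \<iota>y(2)) (simp add: yk)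
    ultimately show ?thesis
      by (cases "D i" rule: side_cases)
        (simp_all add: \<beta>_simps pos_part_simps ne semifield_telescope mult.assoc[of _ "Z b * _"]
          semifield_right_inverse)
  qed
  show "seed_of (D(k := (a, c))) (mutate \<iota> k S)"
    unfolding seed_of_def mutate_def seed.simps R' x' cl
    using inj' tri'[unfolded R'] B' y' by (auto simp: fun_eq_iff)
qed

lemma mutation_flips:
  fixes D :: "'n::finite \<Rightarrow> nat \<times> nat"
  assumes "seed_of D S"
  obtains a b c d where "a < b" "b < c" "c < d" "d \<le> N"
    "exchange_relation \<iota> k S = ptolemy_relation a b c d"
    "\<exists>D'. seed_of D' (mutate \<iota> k S)"
proof -
  have tri: "triangulation N (range D)" using assms by (simp add: seed_of_def)
  show thesis
  proof (rule triangulation_square[OF tri, of "D k"])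
    fix a b c d assume sq: "flip_square N (range D - {D k}) a b c d" "D k = (a, c)"
    interpret flip_square N "range D - {D k}" a b c d by (rule sq)
    show thesis using that[OF ord] flip_ac[OF assms sq] by blast
  next
    fix a b c d assume sq: "flip_square N (range D - {D k}) a b c d" "D k = (b, d)"
    interpret flip_square N "range D - {D k}" a b c d by (rule sq)
    show thesis using that[OF ord] flip_bd[OF assms sq] by blast
  qed simp
qed

end

section \<open>All quadrilaterals are reached from a fan\<close>

context triangulation_seeds
begin

text \<open>Sets of triangles are tracked instead of diagonals: a flip exchanges two members, and
  what matters later is that certain triangles are present.\<close>

definition reachable :: "('n::finite, 'p, 'f) seed \<Rightarrow> (nat \<times> nat \<times> nat) set \<Rightarrow> bool" where
  "reachable S0 T \<longleftrightarrow> (\<exists>S\<in>mutation_class \<iota> S0. \<exists>D. seed_of D S \<and> triangles N (range D) = T)"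

lemma mutation_class_seed_of:
  assumes "S \<in> mutation_class \<iota> S0" "seed_of D0 S0"
  shows "\<exists>D. seed_of D S"
  using assms
proof induction
  case (step S k)
  then show ?case using mutation_flips by metis
qed blast

text \<open>Flips from (a, c) to (b, d) are enough to meet every quadrilateral, so only this
  direction is recorded.\<close>

lemma reachable_flip:
  fixes S0 :: "('n::finite, 'p, 'f) seed"
  assumes "reachable S0 T" and t: "(a, b, c) \<in> T" "(a, c, d) \<in> T"
  shows "reachable S0 (T - {(a, b, c), (a, c, d)} \<union> {(a, b, d), (b, c, d)})"
    and "ptolemy_relation a b c d \<in> exchange_relations \<iota> S0"
proof -
  obtain S and D :: "'n \<Rightarrow> nat \<times> nat" where S: "S \<in> mutation_class \<iota> S0" "seed_of D S"
    and T: "T = triangles N (range D)"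
    using assms(1) unfolding reachable_def by blast
  have tri: "triangulation N (range D)" using S(2) by (simp add: seed_of_def)
  note fs = flip_square_triangles(1)[OF tri t[unfolded T]]
  then obtain k where k: "D k = (a, c)" by auto
  then have sq: "flip_square N (range D - {D k}) a b c d" using fs by simp
  then interpret flip_square N "range D - {D k}" a b c d .
  have "range (D(k := (b, d))) = X2"
    using S(2) by (intro range_flip(1)) (auto simp: seed_of_def)
  moreover have "T = T1" unfolding T using k by (metis insert_Diff rangeI)
  then have "T2 = T - {(a, b, c), (a, c, d)} \<union> {(a, b, d), (b, c, d)}"
    unfolding T2_eq T1_eq using not_T0 by auto
  ultimately show "reachable S0 (T - {(a, b, c), (a, c, d)} \<union> {(a, b, d), (b, c, d)})"
    unfolding reachable_def using flip_ac(1)[OF S(2) sq k] mutation_class.step[OF S(1)] by metis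
  show "ptolemy_relation a b c d \<in> exchange_relations \<iota> S0"
    using flip_ac(2)[OF S(2) sq k, symmetric] S(1) unfolding exchange_relations_def by blast
qed

text \<open>The diagonals (a, m) for m = e, ..., d - 1 are flipped in turn, each in the
  quadrilateral a, b, m, m + 1. This widens the triangle (a, b, e) to (a, b, d) and hands the fan
  between e and d over from a to b. Every removed triangle has middle vertex b or belongs to the
  swept fan, which explains the last clause.\<close>

lemma reachable_sweep:
  assumes "reachable S0 T" "(a, b, e) \<in> T" "a < b" "b < e" "e \<le> d"
    and "\<And>m. e \<le> m \<Longrightarrow> m < d \<Longrightarrow> (a, m, m + 1) \<in> T"
  shows "\<exists>T'. reachable S0 T' \<and> (a, b, d) \<in> T' \<and> (\<forall>m. e \<le> m \<and> m < d \<longrightarrow> (b, m, m + 1) \<in> T') \<and>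
     (\<forall>t\<in>T. fst (snd t) \<noteq> b \<and> (\<forall>m. e \<le> m \<and> m < d \<longrightarrow> t \<noteq> (a, m, m + 1)) \<longrightarrow> t \<in> T')"
  using \<open>e \<le> d\<close> assms(6)
proof (induction d rule: dec_induct)
  case base
  then show ?case using assms by (intro exI[of _ T]) auto
next
  case (step d)
  obtain T' where T': "reachable S0 T'" "(a, b, d) \<in> T'"
    and fan: "\<And>m. e \<le> m \<Longrightarrow> m < d \<Longrightarrow> (b, m, m + 1) \<in> T'"
    and keep: "\<And>t. t \<in> T \<Longrightarrow> fst (snd t) \<noteq> b \<Longrightarrow> (\<And>m. e \<le> m \<Longrightarrow> m < d \<Longrightarrow> t \<noteq> (a, m, m + 1)) \<Longrightarrow> t \<in> T'"
    using step.IH step.prems by (metis less_Suc_eq)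
  have nx: "(a, d, d + 1) \<in> T'"
    using step.prems[of d] step.hyps assms(4) by (intro keep) auto
  have "reachable S0 (T' - {(a, b, d), (a, d, d + 1)} \<union> {(a, b, d + 1), (b, d, d + 1)})"
    by (rule reachable_flip(1)[OF T' nx])
  then show ?case
    using fan keep assms(3,4) step.hyps
    by (intro exI[of _ "T' - {(a, b, d), (a, d, d + 1)} \<union> {(a, b, d + 1), (b, d, d + 1)}"])
      (auto simp: less_Suc_eq)
qed

lemma reachable_square:
  assumes "reachable S0 T0" "\<And>m. 0 < m \<Longrightarrow> m < N \<Longrightarrow> (0, m, m + 1) \<in> T0"
    and o: "a < b" "b < c" "c < d" "d \<le> N"
  shows "\<exists>T. reachable S0 T \<and> (a, b, c) \<in> T \<and> (a, c, d) \<in> T"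
proof -
  have "\<exists>T. reachable S0 T \<and> (\<forall>m. a < m \<and> m < N \<longrightarrow> (a, m, m + 1) \<in> T)" if "a + 1 < N" for a
    using that
  proof (induction a)
    case 0
    then show ?case using assms(1,2) by blast
  next
    case (Suc a)
    then obtain T where "reachable S0 T" "\<And>m. a < m \<Longrightarrow> m < N \<Longrightarrow> (a, m, m + 1) \<in> T" by auto
    \<comment> \<open>A sweep from the triangle (a, a + 1, a + 2) up to N moves the apex of the fan
      from a to a + 1.\<close>
    then show ?case
      using reachable_sweep[of S0 T a "Suc a" "a + 2" N] Suc.prems by (auto simp: Suc_le_eq)
  qed
  then obtain T where T: "reachable S0 T" "\<And>m. a < m \<Longrightarrow> m < N \<Longrightarrow> (a, m, m + 1) \<in> T"
    using o by (metis add.commute less_trans_Suc order_less_le_trans plus_1_eq_Suc)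
  \<comment> \<open>The sweep between b and c produces (a, b, c) and spares the fan beyond c. A
    second sweep, between c and d, produces (a, c, d) and spares (a, b, c), whose middle vertex is
    not c.\<close>
  obtain T' where T': "reachable S0 T'" "(a, b, c) \<in> T'"
    and fan: "\<And>m. c \<le> m \<Longrightarrow> m < N \<Longrightarrow> (a, m, m + 1) \<in> T'"
    using reachable_sweep[of S0 T a b "b + 1" c] T o by fastforce
  then show ?thesis
    using reachable_sweep[of S0 T' a c "c + 1" d] o by fastforce
qed

lemma seeds_from_fan:
  fixes S0 :: "('n::finite, 'p, 'f) seed"
  assumes S0: "seed_of D0 S0" and fan: "\<And>m. 0 < m \<Longrightarrow> m < N \<Longrightarrow> (0, m, m + 1) \<in> triangles N (range D0)"
  shows "cluster_variables \<iota> S0 = P ` diagonals N"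
    and "exchange_relations \<iota> S0 = {ptolemy_relation a b c d |a b c d. a < b \<and> b < c \<and> c < d \<and> d \<le> N}"
proof -
  have "reachable S0 (triangles N (range D0))"
    using S0 mutation_class.initial unfolding reachable_def by blast
  note sq = reachable_square[OF this fan]
  have cv: "P e \<in> cluster_variables \<iota> S0" if T: "reachable S0 T" "(p, m, q) \<in> T"
    and e: "e = (p, m) \<or> e = (p, q)" "e \<in> diagonals N" for T p m q e
  proof -
    obtain S and D :: "'n \<Rightarrow> nat \<times> nat" where S: "S \<in> mutation_class \<iota> S0" "seed_of D S"
      and TD: "T = triangles N (range D)"
      using T(1) unfolding reachable_def by blast
    have "e \<in> range D" using T(2) e unfolding TD by (auto simp: triangles_def edge_def diagonals_def)
    then show ?thesis using S unfolding cluster_variables_def seed_of_def by force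
  qed
  show "cluster_variables \<iota> S0 = P ` diagonals N"
  proof (intro equalityI subsetI)
    fix x assume "x \<in> cluster_variables \<iota> S0"
    then obtain S where S: "S \<in> mutation_class \<iota> S0" "x \<in> range (cluster S)"
      unfolding cluster_variables_def by blast
    then obtain D :: "'n \<Rightarrow> nat \<times> nat" where "seed_of D S" using mutation_class_seed_of S0 by blast
    then show "x \<in> P ` diagonals N" using S(2) unfolding seed_of_def triangulation_def by auto
  next
    fix x assume "x \<in> P ` diagonals N"
    then obtain p q where x: "x = P (p, q)" and pq: "(p, q) \<in> diagonals N" by auto
    show "x \<in> cluster_variables \<iota> S0"
    proof (cases "q < N")
      case True
      then obtain T where "reachable S0 T" "(p, q, q + 1) \<in> T"
        using sq[of p "p + 1" q "q + 1"] pq by (auto simp: diagonals_def)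
      then show ?thesis using cv pq x by blast
    next
      \<comment> \<open>A chord (p, N) is never the diagonal (a, c) of a quadrilateral, so it is
        obtained as the new diagonal after a flip in 0, p, p + 1, N.\<close>
      case False
      then obtain T where T: "reachable S0 T" "(0, p, p + 1) \<in> T" "(0, p + 1, q) \<in> T"
        using sq[of 0 p "p + 1" q] pq by (auto simp: diagonals_def)
      then show ?thesis using cv[OF reachable_flip(1)[OF T], of p "p + 1" q] pq x by blast
    qed
  qed
  show "exchange_relations \<iota> S0 = {ptolemy_relation a b c d |a b c d. a < b \<and> b < c \<and> c < d \<and> d \<le> N}"
  proof (intro equalityI subsetI)
    fix r assume "r \<in> exchange_relations \<iota> S0"
    then obtain S k where S: "S \<in> mutation_class \<iota> S0" "r = exchange_relation \<iota> k S"
      unfolding exchange_relations_def by blast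
    obtain D where "seed_of D S" using mutation_class_seed_of S(1) S0 by blast
    then show "r \<in> {ptolemy_relation a b c d |a b c d. a < b \<and> b < c \<and> c < d \<and> d \<le> N}"
      by (rule mutation_flips[of D S k]) (use S(2) in blast)
  next
    fix r assume "r \<in> {ptolemy_relation a b c d |a b c d. a < b \<and> b < c \<and> c < d \<and> d \<le> N}"
    then show "r \<in> exchange_relations \<iota> S0" using sq reachable_flip(2) by blast
  qed
qed

end

section \<open>Ptolemy relations for minors\<close>

text \<open>The value 0 at \<open>b = a\<close> makes the recurrence in \<open>b\<close> start at \<open>b = a + 1\<close>; it differs from the
  convention that \<open>minor\<close> is 1 at degenerate indices.\<close>

definition chord_continuant :: "(nat \<Rightarrow> 'a::comm_ring_1) \<Rightarrow> (nat \<Rightarrow> 'a) \<Rightarrow> nat \<Rightarrow> nat \<Rightarrow> 'a" where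
  "chord_continuant v y a b =
     (if b \<le> a then 0 else continuant (b - a - 1) (\<lambda>i. v (a + 1 + i)) (\<lambda>i. y (a + 1 + i)))"

lemma chord_continuant_simps [simp]:
  "chord_continuant v y a a = 0" "chord_continuant v y a (Suc a) = 1"
  by (simp_all add: chord_continuant_def)

lemma chord_continuant_Suc:
  assumes "a < b"
  shows "chord_continuant v y a (Suc b) =
    v b * chord_continuant v y a b - y (b - 1) * chord_continuant v y a (b - 1)"
proof -
  obtain m where b: "b = Suc a + m" using assms less_iff_Suc_add by auto
  show ?thesis unfolding b by (cases m) (simp_all add: chord_continuant_def)
qed

text \<open>The difference of the two products is the Casoratian of two solutions, in
  \<open>c\<close>, of one three-term recurrence. Each step multiplies it by \<open>y c\<close>, and
  at c = b it equals \<open>chord_continuant v y a b\<close>, since the solution starting at b has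
  the values 0 and 1 there.\<close>

lemma chord_continuant_adjacent:
  assumes "a < b" "b \<le> c"
  shows "chord_continuant v y a c * chord_continuant v y b (Suc c)
      = (\<Prod>m\<in>{b..<c}. y m) * chord_continuant v y a b
        + chord_continuant v y a (Suc c) * chord_continuant v y b c"
  using assms(2)
proof (induction c rule: dec_induct)
  case (step c)
  have "chord_continuant v y a (Suc c) * chord_continuant v y b (Suc (Suc c))
      - chord_continuant v y a (Suc (Suc c)) * chord_continuant v y b (Suc c)
    = y c * (chord_continuant v y a c * chord_continuant v y b (Suc c)
      - chord_continuant v y a (Suc c) * chord_continuant v y b c)"
    using assms(1) step.hyps by (simp add: chord_continuant_Suc[of _ "Suc c"]) (simp add: algebra_simps)
  also have "\<dots> = (\<Prod>m\<in>{b..<Suc c}. y m) * chord_continuant v y a b"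
    using step.hyps by (simp add: step.IH algebra_simps)
  finally show ?case by (simp add: algebra_simps)
qed simp

text \<open>A three-term recurrence needs two initial values, so the induction carries d and d + 1
  together. At d = c the identity is trivial, and at d = c + 1 it is
  \<open>chord_continuant_adjacent\<close>.\<close>

lemma chord_continuant_ptolemy:
  assumes "a < b" "b \<le> c" "c \<le> d"
  shows "chord_continuant v y a c * chord_continuant v y b d
      = (\<Prod>m\<in>{b..<c}. y m) * chord_continuant v y a b * chord_continuant v y c d
        + chord_continuant v y a d * chord_continuant v y b c"
proof -
  let ?K = "chord_continuant v y"
  let ?Y = "\<Prod>m\<in>{b..<c}. y m"
  have "?K a c * ?K b d = ?Y * ?K a b * ?K c d + ?K a d * ?K b c \<and>
     ?K a c * ?K b (Suc d) = ?Y * ?K a b * ?K c (Suc d) + ?K a (Suc d) * ?K b c"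
    using assms(3)
  proof (induction d rule: dec_induct)
    case base
    then show ?case using chord_continuant_adjacent[OF assms(1,2), of v y] by simp
  next
    case (step d)
    have r: "?K x (Suc (Suc d)) = v (Suc d) * ?K x (Suc d) - y d * ?K x d" if "x \<le> d" for x
      using chord_continuant_Suc[of x "Suc d" v y] that by simp
    have "?K a c * ?K b (Suc (Suc d)) =
        v (Suc d) * (?K a c * ?K b (Suc d)) - y d * (?K a c * ?K b d)"
      using assms step.hyps by (simp add: r algebra_simps)
    also have "\<dots> = ?Y * ?K a b * ?K c (Suc (Suc d)) + ?K a (Suc (Suc d)) * ?K b c"
      using assms step.hyps step.IH by (simp add: r algebra_simps)
    finally show ?case using step.IH by blast
  qed
  then show ?thesis ..
qed

section \<open>Evaluation of coordinate functions and minors at points of the variety\<close>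

lemma fun_of_simps:
  "fun_of (f + g) M = fun_of f M + fun_of g M"
  "fun_of (f * g) M = fun_of f M * fun_of g M"
  "fun_of (f - g) M = fun_of f M - fun_of g M"
  "fun_of 0 M = 0"
  unfolding minus_coord_ring_def plus_coord_ring.rep_eq times_coord_ring.rep_eq
    uminus_coord_ring.rep_eq zero_coord_ring.rep_eq by simp_all

lemma fun_of_on_variety:
  fixes f :: "'n::finite coord_ring"
  assumes "M \<in> tridiag_variety CARD('n)"
  shows "fun_of (1 :: 'n coord_ring) M = 1" "fun_of (scalar c :: 'n coord_ring) M = c"
    "fun_of (f ^ k) M = fun_of f M ^ k" "fun_of (\<Prod>a\<in>A. g a :: 'n coord_ring) M = (\<Prod>a\<in>A. fun_of (g a) M)"
    "fun_of (continuant m v y :: 'n coord_ring) M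
       = continuant m (\<lambda>i. fun_of (v i) M) (\<lambda>i. fun_of (y i) M)"
proof -
  show one: "fun_of (1 :: 'n coord_ring) M = 1" "fun_of (scalar c :: 'n coord_ring) M = c"
    using assms by (simp_all add: one_coord_ring.rep_eq scalar.rep_eq)
  show "fun_of (f ^ k) M = fun_of f M ^ k" by (induction k) (simp_all add: fun_of_simps one)
  show "fun_of (\<Prod>a\<in>A. g a) M = (\<Prod>a\<in>A. fun_of (g a) M)"
    by (induction A rule: infinite_finite_induct) (simp_all add: fun_of_simps one)
  show "fun_of (continuant m v y) M = continuant m (\<lambda>i. fun_of (v i) M) (\<lambda>i. fun_of (y i) M)"
    by (induction m v y rule: continuant.induct) (simp_all add: fun_of_simps one)
qed

lemma coord_ring_eqI:
  fixes f g :: "'n::finite coord_ring"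
  assumes "\<And>M. M \<in> tridiag_variety CARD('n) \<Longrightarrow> fun_of f M = fun_of g M"
  shows "f = g"
proof -
  have "fun_of f M = fun_of g M" for M
    using assms regular_functions_outside[OF fun_of, of M f] regular_functions_outside[OF fun_of, of M g]
    by (cases "M \<in> tridiag_variety CARD('n)") auto
  then show ?thesis by (simp add: fun_of_inject[symmetric] fun_eq_iff)
qed

lemma pick_atLeastAtMost:
  assumes "t < q + 1 - p"
  shows "pick {p..q} t = p + t"
proof -
  have "{a \<in> {p..q}. a < p + t} = {p..<p + t}" using assms by auto
  then show ?thesis using pick_card_in_set[of "p + t" "{p..q}"] assms by simp
qed

lemma det_submatrix_variety:
  assumes M: "M \<in> tridiag_variety n" and pq: "p \<le> q" "q \<le> n"
  shows "det (submatrix M {p..q} {p..q}) =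
    continuant (q + 1 - p) (\<lambda>t. M $$ (p + t, p + t)) (\<lambda>t. M $$ (p + t, p + t + 1))"
proof -
  have dim: "M \<in> carrier_mat (n + 1) (n + 1)" using M by (simp add: tridiag_variety_def)
  have "{k. k < n + 1 \<and> k \<in> {p..q}} = {p..q}" using pq by auto
  then have sub: "submatrix M {p..q} {p..q} =
      mat (q + 1 - p) (q + 1 - p) (\<lambda>(a, b). M $$ (pick {p..q} a, pick {p..q} b))"
    using dim by (simp add: submatrix_def)
  have "submatrix M {p..q} {p..q} =
      tri_mat (q + 1 - p) (\<lambda>t. M $$ (p + t, p + t)) (\<lambda>t. M $$ (p + t, p + t + 1))" (is "_ = ?R")
  proof (rule eq_matI)
    fix a b assume "a < dim_row ?R" "b < dim_col ?R"
    then have ab: "a < q + 1 - p" "b < q + 1 - p" by (auto simp: tri_mat_def)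
    have "submatrix M {p..q} {p..q} $$ (a, b) = M $$ (p + a, p + b)"
      unfolding sub using ab pick_atLeastAtMost[OF ab(1)] pick_atLeastAtMost[OF ab(2)] by simp
    also have "M $$ (p + a, p + b) = ?R $$ (a, b)"
    proof -
      consider "a = b" | "b = a + 1" | "a = b + 1" | "a + 1 < b \<or> b + 1 < a" by linarith
      then show ?thesis
        using ab pq M by cases (auto simp: tri_mat_def tridiag_variety_def)
    qed
    finally show "submatrix M {p..q} {p..q} $$ (a, b) = ?R $$ (a, b)" .
  qed (simp_all add: sub tri_mat_def)
  then show ?thesis by (simp add: det_tri_mat)
qed

lemma fun_of_y_fun:
  assumes "M \<in> tridiag_variety CARD('n)" "1 \<le> i" "i \<le> CARD('n)"
  shows "fun_of (y_fun i :: 'n::finite coord_ring) M = M $$ (i - 1, i)"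
  using assms by (simp add: y_fun.rep_eq)

text \<open>The case i = j + 1 is the empty minor, where both sides are 1; it is included for the
  sake of the boundary edges (a, a + 1).\<close>

lemma fun_of_minor:
  assumes M: "M \<in> tridiag_variety CARD('n)" and ij: "1 \<le> i" "i \<le> j + 1" "j \<le> CARD('n) + 1"
  shows "fun_of (minor i j :: 'n::finite coord_ring) M =
    continuant (j + 1 - i) (\<lambda>t. M $$ (i - 1 + t, i - 1 + t)) (\<lambda>t. M $$ (i - 1 + t, i + t))"
proof (cases "i \<le> j")
  case True
  then show ?thesis
    using M ij det_submatrix_variety[OF M, of "i - 1" "j - 1"] by (simp add: minor.rep_eq)
next
  case False
  then have "i = j + 1" using ij by simp
  then show ?thesis using M by (simp add: minor.rep_eq)
qed

lemma minor_continuant: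
  assumes ij: "1 \<le> i" "i \<le> j + 1" "j \<le> CARD('n) + 1"
  shows "(minor i j :: 'n::finite coord_ring) =
    continuant (j + 1 - i) (\<lambda>t. minor (i + t) (i + t)) (\<lambda>t. y_fun (i + t))"
proof (rule coord_ring_eqI)
  fix M assume M: "M \<in> tridiag_variety CARD('n)"
  show "fun_of (minor i j :: 'n coord_ring) M =
    fun_of (continuant (j + 1 - i) (\<lambda>t. minor (i + t) (i + t)) (\<lambda>t. y_fun (i + t)) :: 'n coord_ring) M"
    unfolding fun_of_on_variety[OF M] fun_of_minor[OF M ij]
  proof (rule continuant_cong)
    fix t assume "t < j + 1 - i"
    then show "M $$ (i - 1 + t, i - 1 + t) = fun_of (minor (i + t) (i + t) :: 'n coord_ring) M"
      using ij by (subst fun_of_minor[OF M]) simp_all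
  next
    fix t assume "Suc t < j + 1 - i"
    then show "M $$ (i - 1 + t, i + t) = fun_of (y_fun (i + t) :: 'n coord_ring) M"
      using ij by (subst fun_of_y_fun[OF M]) simp_all
  qed
qed

lemma minor_chord_continuant:
  assumes "a < b" "b \<le> CARD('n) + 2"
  shows "(minor (a + 1) (b - 1) :: 'n::finite coord_ring)
    = chord_continuant (\<lambda>i. minor i i) y_fun a b"
proof -
  have "\<not> b \<le> a" "b - 1 + 1 - (a + 1) = b - a - 1" using assms by auto
  then show ?thesis
    unfolding chord_continuant_def using assms by (subst minor_continuant) (simp_all del: One_nat_def)
qed

lemma minor_ptolemy:
  assumes "a < b" "b < c" "c < d" "d \<le> CARD('n) + 2"
  shows "(minor (a + 1) (c - 1) * minor (b + 1) (d - 1) :: 'n::finite coord_ring) =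
    (\<Prod>m\<in>{b..<c}. y_fun m) * minor (a + 1) (b - 1) * minor (c + 1) (d - 1)
     + minor (a + 1) (d - 1) * minor (b + 1) (c - 1)"
proof -
  note m = minor_chord_continuant[where 'n = 'n]
  have "a < c" "b < d" "a < d" "b \<le> CARD('n) + 2" "c \<le> CARD('n) + 2" using assms by auto
  then show ?thesis
    unfolding m[OF \<open>a < c\<close> \<open>c \<le> CARD('n) + 2\<close>] m[OF \<open>b < d\<close> assms(4)] m[OF assms(1) \<open>b \<le> CARD('n) + 2\<close>]
      m[OF assms(3,4)] m[OF \<open>a < d\<close> assms(4)] m[OF assms(2) \<open>c \<le> CARD('n) + 2\<close>]
    using assms by (intro chord_continuant_ptolemy) auto
qed

lemma minor_trivial:
  assumes "\<not> (1 \<le> i \<and> i \<le> j \<and> j \<le> CARD('n) + 1)"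
  shows "(minor i j :: 'n::finite coord_ring) = 1"
proof (rule coord_ring_eqI)
  fix M assume M: "M \<in> tridiag_variety CARD('n)"
  have F: "(1 \<le> i \<and> i \<le> j \<and> j \<le> CARD('n) + 1) = False" using assms by blast
  show "fun_of (minor i j :: 'n coord_ring) M = fun_of (1 :: 'n coord_ring) M"
    unfolding minor.rep_eq F fun_of_on_variety(1)[OF M] using M by simp
qed

lemma minor_full: "(minor 1 (CARD('n) + 1) :: 'n::finite coord_ring) = 1"
proof (rule coord_ring_eqI)
  fix M assume M: "M \<in> tridiag_variety CARD('n)"
  have "continuant (Suc CARD('n)) (\<lambda>i. M $$ (i, i)) (\<lambda>i. M $$ (i, Suc i)) = 1"
    using variety_tri_mat[OF M] M tri_mat_in_variety by metis
  then show "fun_of (minor 1 (CARD('n) + 1) :: 'n coord_ring) M = fun_of (1 :: 'n coord_ring) M"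
    using fun_of_minor[OF M, of 1 "CARD('n) + 1"] by (simp add: fun_of_on_variety[OF M])
qed

text \<open>The diagonal entries are solved from the leading minors by the continuant recurrence.\<close>

lemma variety_point:
  fixes x y :: "nat \<Rightarrow> complex"
  assumes "\<And>i. 1 \<le> i \<Longrightarrow> i \<le> CARD('n) \<Longrightarrow> x i \<noteq> 0 \<and> y i \<noteq> 0"
  obtains M where "M \<in> tridiag_variety CARD('n)"
    "\<And>i. 1 \<le> i \<Longrightarrow> i \<le> CARD('n) \<Longrightarrow> fun_of (minor 1 i :: 'n::finite coord_ring) M = x i"
    "\<And>i. 1 \<le> i \<Longrightarrow> i \<le> CARD('n) \<Longrightarrow> fun_of (y_fun i :: 'n coord_ring) M = y i"
proof -
  define n where "n = CARD('n)"
  \<comment> \<open>The value 1 at index 0 is the empty minor, and at index n + 1 it prescribes det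
    M = 1, so that the matrix built from \<open>X\<close> lies on the variety.\<close>
  define X where "X i = (if i = 0 \<or> n < i then 1 else x i)" for i
  define u where "u i = y (i + 1)" for i
  define v where "v i = (case i of 0 \<Rightarrow> X 1 | Suc m \<Rightarrow> (X (m + 2) + u m * X m) / X (m + 1))" for i
  have X0: "X i \<noteq> 0" for i using assms[of i] by (auto simp: X_def n_def)
  have c: "continuant i v u = X i" for i
  proof (induction i rule: induct_nat_012)
    case (ge2 m)
    then show ?case using X0[of "Suc m"] by (simp add: v_def)
  qed (simp_all add: v_def X_def)
  define M where "M = tri_mat (Suc n) v u"
  have M: "M \<in> tridiag_variety CARD('n)"
    unfolding M_def n_def[symmetric] tri_mat_in_variety c using assms by (auto simp: X_def u_def n_def)
  have "fun_of (minor 1 i :: 'n coord_ring) M = x i" if "1 \<le> i" "i \<le> n" for i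
  proof -
    have "fun_of (minor 1 i :: 'n coord_ring) M = continuant i v u"
      using that by (subst fun_of_minor[OF M]) (auto simp: n_def[symmetric] M_def tri_mat_def intro!: continuant_cong)
    then show ?thesis using that by (simp add: c X_def)
  qed
  moreover have "fun_of (y_fun i :: 'n coord_ring) M = y i" if "1 \<le> i" "i \<le> n" for i
    using that by (subst fun_of_y_fun[OF M]) (auto simp: n_def[symmetric] M_def tri_mat_def u_def)
  ultimately show thesis using that M by (simp add: n_def)
qed

text \<open>One point of the variety with a value other than 0 and 1 settles both claims. Leading
  minors need a point of their own, since they all equal 1 at the matrix used for i > 1.\<close>

lemma minor_nontrivial:
  assumes "1 \<le> i" "i \<le> j" "j \<le> CARD('n) + 1" "(i, j) \<noteq> (1, CARD('n) + 1)"
  shows "(minor i j :: 'n::finite coord_ring) \<noteq> 0" "(minor i j :: 'n::finite coord_ring) \<noteq> 1"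
proof -
  have "\<exists>M\<in>tridiag_variety CARD('n). fun_of (minor i j :: 'n coord_ring) M \<noteq> 0 \<and> fun_of (minor i j :: 'n coord_ring) M \<noteq> 1"
  proof (cases "i = 1")
    case True
    obtain M where "M \<in> tridiag_variety CARD('n)"
      "\<And>i. 1 \<le> i \<Longrightarrow> i \<le> CARD('n) \<Longrightarrow> fun_of (minor 1 i :: 'n::finite coord_ring) M = 2"
      by (rule variety_point[of "\<lambda>_. 2" "\<lambda>_. 1", where 'n = 'n]) (simp, blast)
    moreover have "1 \<le> j" "j \<le> CARD('n)" using True assms by auto
    ultimately have "M \<in> tridiag_variety CARD('n)" "fun_of (minor i j :: 'n coord_ring) M = 2"
      unfolding True by blast+
    then show ?thesis by (intro bexI[of _ M]) simp_all
  next
    case False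
    txt \<open>At the matrix with diagonal \<open>1, 2, \<dots>, 2\<close> and \<open>y = 1\<close> the minor has the value \<open>j + 2 - i\<close>.\<close>
    define v :: "nat \<Rightarrow> complex" where "v i = (if i = 0 then 1 else 2)" for i
    define M where "M = tri_mat (Suc CARD('n)) v (\<lambda>_. 1)"
    have "continuant m v (\<lambda>_. 1) = 1" for m
      by (induction m rule: induct_nat_012) (auto simp: v_def)
    then have M: "M \<in> tridiag_variety CARD('n)"
      unfolding M_def tri_mat_in_variety by simp
    have c: "continuant m (\<lambda>_. 2) (\<lambda>_. 1 :: complex) = of_nat (m + 1)" for m
      by (induction m rule: induct_nat_012) (auto simp: algebra_simps)
    have "fun_of (minor i j :: 'n coord_ring) M = continuant (j + 1 - i) (\<lambda>_. 2) (\<lambda>_. 1)"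
      using False assms
      by (subst fun_of_minor[OF M]) (auto simp: M_def tri_mat_def v_def intro!: continuant_cong)
    then have "fun_of (minor i j :: 'n coord_ring) M = of_nat (j + 2 - i)"
      using assms by (simp add: c)
    moreover have "of_nat (j + 2 - i) \<noteq> (0 :: complex)" "of_nat (j + 2 - i) \<noteq> (of_nat 1 :: complex)"
      unfolding of_nat_eq_iff of_nat_eq_0_iff using assms by auto
    ultimately have "fun_of (minor i j :: 'n coord_ring) M \<noteq> 0"
      "fun_of (minor i j :: 'n coord_ring) M \<noteq> 1" by (simp_all only: of_nat_1 not_False_eq_True)
    then show ?thesis using M by blast
  qed
  then show "(minor i j :: 'n coord_ring) \<noteq> 0" "(minor i j :: 'n coord_ring) \<noteq> 1"
    by (auto simp: fun_of_simps fun_of_on_variety)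
qed

section \<open>Generation and algebraic independence\<close>

lemma subalgebra_generated_prod:
  assumes "\<kappa> 1 = 1" "\<And>a. a \<in> A \<Longrightarrow> f a \<in> subalgebra_generated \<kappa> S"
  shows "(\<Prod>a\<in>A. f a) \<in> subalgebra_generated \<kappa> S"
  using assms(2)
proof (induction A rule: infinite_finite_induct)
  case (insert a A)
  then show ?case by (auto intro: subalgebra_generated.mult)
qed (use subalgebra_generated.scalar[of \<kappa> 1 S] assms(1) in auto)

lemma subalgebra_generated_power:
  assumes "\<kappa> 1 = 1" "f \<in> subalgebra_generated \<kappa> S"
  shows "f ^ k \<in> subalgebra_generated \<kappa> S"
  using subalgebra_generated_prod[of \<kappa> "{..<k}" "\<lambda>_. f" S] assms by simp

lemma scalar_hom: "complex_algebra (scalar :: complex \<Rightarrow> 'n::finite coord_ring)"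
proof -
  have "scalar 1 = (1 :: 'n coord_ring)"
    by (rule coord_ring_eqI) (simp add: fun_of_on_variety)
  moreover have "scalar (a + b) = (scalar a + scalar b :: 'n coord_ring)" for a b
    by (rule coord_ring_eqI) (simp add: fun_of_on_variety fun_of_simps)
  moreover have "scalar (a * b) = (scalar a * scalar b :: 'n coord_ring)" for a b
    by (rule coord_ring_eqI) (simp add: fun_of_on_variety fun_of_simps)
  ultimately show ?thesis unfolding complex_algebra_def by blast
qed

text \<open>Regular functions have powers of y_1 ... y_n as denominators, so 1 / y_i is written as
  the product of the other y_j divided by y_1 ... y_n.\<close>

lemma y_fun_unit:
  assumes "1 \<le> i" "i \<le> CARD('n)"
  shows "\<exists>g. y_fun i * g = (1 :: 'n::finite coord_ring)"
proof -
  define f where "f M = (if M \<in> tridiag_variety CARD('n) then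
    (\<Prod>j\<in>{..<CARD('n)} - {i - 1}. M $$ (j, j + 1)) / superdiag_prod CARD('n) M else 0)" for M
  have "(\<lambda>M. \<Prod>j\<in>{..<CARD('n)} - {i - 1}. M $$ (j, j + 1)) \<in> polynomial_functions CARD('n)"
    by (intro polynomial_functions_prod polynomial_functions.entry) auto
  then have f: "f \<in> regular_functions CARD('n)"
    by (rule regular_functionsI[where k = 1]) (simp_all add: f_def)
  have "y_fun i * Coord f = (1 :: 'n coord_ring)"
  proof (rule coord_ring_eqI)
    fix M assume M: "M \<in> tridiag_variety CARD('n)"
    have "superdiag_prod CARD('n) M =
        M $$ (i - 1, i) * (\<Prod>j\<in>{..<CARD('n)} - {i - 1}. M $$ (j, j + 1))"
      unfolding superdiag_prod_def using assms by (subst prod.remove[of _ "i - 1"]) auto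
    then show "fun_of (y_fun i * Coord f :: 'n coord_ring) M = fun_of (1 :: 'n coord_ring) M"
      using M superdiag_prod_nonzero[OF M] assms
      by (simp add: fun_of_simps fun_of_on_variety fun_of_y_fun Coord_inverse[OF f]) (simp add: f_def)
  qed
  then show ?thesis by blast
qed

text \<open>The ring type carries no inverse operation, so the inverses of the y_i are described by
  their defining equation.\<close>

definition coord_generators :: "'n::finite coord_ring set" where
  "coord_generators = y_fun ` {1..CARD('n)} \<union> {g. \<exists>i\<in>{1..CARD('n)}. y_fun i * g = 1}
     \<union> (\<lambda>i. minor i i) ` {1..CARD('n) + 1}"

lemma polynomial_functions_generated:
  assumes "p \<in> polynomial_functions CARD('n)"
  shows "\<exists>f\<in>subalgebra_generated scalar (coord_generators :: 'n::finite coord_ring set).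
    \<forall>M\<in>tridiag_variety CARD('n). fun_of f M = p M"
  using assms
proof induction
  case (const c)
  show ?case
    by (rule bexI[of _ "scalar c"]) (auto simp: fun_of_on_variety intro: subalgebra_generated.scalar)
next
  case (entry i j)
  consider "i = j" | "j = i + 1" | "i = j + 1" | "i + 1 < j \<or> j + 1 < i" by linarith
  then show ?case
  proof cases
    case 1
    have "(minor (i + 1) (i + 1) :: 'n coord_ring) \<in> coord_generators"
      using entry by (auto simp: coord_generators_def)
    moreover have "fun_of (minor (i + 1) (i + 1) :: 'n coord_ring) M = M $$ (i, j)"
      if "M \<in> tridiag_variety CARD('n)" for M
      using 1 entry that by (simp add: fun_of_minor)
    ultimately show ?thesis by (meson subalgebra_generated.gen)
  next
    case 2
    have "(y_fun (i + 1) :: 'n coord_ring) \<in> coord_generators"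
      using 2 entry by (auto simp: coord_generators_def)
    moreover have "fun_of (y_fun (i + 1) :: 'n coord_ring) M = M $$ (i, j)"
      if "M \<in> tridiag_variety CARD('n)" for M
      using 2 entry that by (simp add: fun_of_y_fun)
    ultimately show ?thesis by (meson subalgebra_generated.gen)
  next
    case 3
    have "fun_of (scalar 1 :: 'n coord_ring) M = M $$ (i, j)" if "M \<in> tridiag_variety CARD('n)" for M
      using 3 entry that by (simp add: fun_of_on_variety) (simp add: tridiag_variety_def)
    then show ?thesis by (meson subalgebra_generated.scalar)
  next
    case 4
    have "fun_of (scalar 0 :: 'n coord_ring) M = M $$ (i, j)" if "M \<in> tridiag_variety CARD('n)" for M
      using 4 entry that by (simp add: fun_of_on_variety) (auto simp: tridiag_variety_def)
    then show ?thesis by (meson subalgebra_generated.scalar)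
  qed
next
  case (add f g)
  then obtain f' g' :: "'n coord_ring" where
    "f' \<in> subalgebra_generated scalar coord_generators" "g' \<in> subalgebra_generated scalar coord_generators"
    "\<forall>M\<in>tridiag_variety CARD('n). fun_of f' M = f M" "\<forall>M\<in>tridiag_variety CARD('n). fun_of g' M = g M" by blast
  then show ?case
    by (intro bexI[of _ "f' + g'"]) (auto simp: fun_of_simps intro: subalgebra_generated.add)
next
  case (mult f g)
  then obtain f' g' :: "'n coord_ring" where
    "f' \<in> subalgebra_generated scalar coord_generators" "g' \<in> subalgebra_generated scalar coord_generators"
    "\<forall>M\<in>tridiag_variety CARD('n). fun_of f' M = f M" "\<forall>M\<in>tridiag_variety CARD('n). fun_of g' M = g M" by blast
  then show ?case
    by (intro bexI[of _ "f' * g'"]) (auto simp: fun_of_simps intro: subalgebra_generated.mult)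
qed

lemma coord_ring_generated:
  "subalgebra_generated scalar (coord_generators :: 'n::finite coord_ring set) = UNIV"
proof -
  let ?A = "subalgebra_generated scalar (coord_generators :: 'n coord_ring set)"
  have s1: "scalar 1 = (1 :: 'n coord_ring)" using scalar_hom by (auto simp: complex_algebra_def)
  obtain g where g: "\<And>i. 1 \<le> i \<Longrightarrow> i \<le> CARD('n) \<Longrightarrow> y_fun i * g i = (1 :: 'n coord_ring)"
    using y_fun_unit by metis
  \<comment> \<open>\<open>s\<close> represents 1 / (y_1 ... y_n); a regular function with numerator
    \<open>h\<close> is then \<open>h * s ^ k\<close>.\<close>
  define s where "s = (\<Prod>i<CARD('n). g (i + 1))"
  have "g (i + 1) \<in> coord_generators" if "i < CARD('n)" for i
    using g[of "i + 1"] that unfolding coord_generators_def by force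
  then have "s \<in> ?A" unfolding s_def
    by (intro subalgebra_generated_prod s1 subalgebra_generated.gen) simp
  have s: "fun_of s M = 1 / superdiag_prod CARD('n) M" if M: "M \<in> tridiag_variety CARD('n)" for M
  proof -
    have "M $$ (i, i + 1) * fun_of (g (i + 1)) M = 1" if "i < CARD('n)" for i
      using arg_cong[OF g[of "i + 1"], of "\<lambda>f. fun_of f M"] that M
      by (simp add: fun_of_simps fun_of_on_variety fun_of_y_fun)
    then have "superdiag_prod CARD('n) M * fun_of s M = 1"
      unfolding superdiag_prod_def s_def fun_of_on_variety(4)[OF M] by (simp flip: prod.distrib)
    then show ?thesis using superdiag_prod_nonzero[OF M] by (simp add: field_simps)
  qed
  have "f \<in> ?A" for f :: "'n coord_ring"
  proof -
    obtain p k where p: "p \<in> polynomial_functions CARD('n)"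
      "\<And>M. M \<in> tridiag_variety CARD('n) \<Longrightarrow> fun_of f M = p M / superdiag_prod CARD('n) M ^ k"
      using regular_functionsE[OF fun_of[of f]] by metis
    obtain h where h: "h \<in> ?A" "\<forall>M\<in>tridiag_variety CARD('n). fun_of h M = p M"
      using polynomial_functions_generated[OF p(1)] by blast
    have "f = h * s ^ k"
      using h(2) by (intro coord_ring_eqI) (simp add: fun_of_simps fun_of_on_variety s p(2) power_inverse divide_inverse)
    then show ?thesis
      using subalgebra_generated.mult[OF h(1) subalgebra_generated_power[OF s1 \<open>s \<in> ?A\<close>]] by simp
  qed
  then show ?thesis by blast
qed

section \<open>Polynomials that vanish at all points with non-zero coordinates\<close>

lemma ex_inj_primes: "\<exists>q :: 'v::finite \<Rightarrow> nat. inj q \<and> (\<forall>v. prime (q v))"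
proof -
  obtain B :: "nat set" where B: "finite B" "card B = CARD('v)" "B \<subseteq> {p. prime p}"
    using infinite_arbitrarily_large[OF primes_infinite] by metis
  then obtain q :: "'v \<Rightarrow> nat" where "bij_betw q UNIV B"
    using finite_same_card_bij[of "UNIV :: 'v set" B] by auto
  then have "inj q" "\<forall>v. prime (q v)" using B(3) by (auto simp: bij_betw_def)
  then show ?thesis by blast
qed

text \<open>By unique factorisation the exponent of a variable is the multiplicity of its
  prime.\<close>

lemma inj_prime_monomials:
  fixes q :: "'v::finite \<Rightarrow> nat"
  assumes "inj q" "\<And>v. prime (q v)"
  shows "inj (\<lambda>m. \<Prod>v\<in>Poly_Mapping.keys m. q v ^ Poly_Mapping.lookup m v)"
proof -
  have "multiplicity (q v) (\<Prod>v\<in>Poly_Mapping.keys m. q v ^ Poly_Mapping.lookup m v) = Poly_Mapping.lookup m v" for m v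
  proof -
    have "(\<Prod>v\<in>Poly_Mapping.keys m. q v ^ Poly_Mapping.lookup m v) = (\<Prod>v\<in>UNIV. q v ^ Poly_Mapping.lookup m v)"
      by (intro prod.mono_neutral_left) (auto simp: in_keys_iff)
    also have "\<dots> = (\<Prod>p\<in>range q. p ^ Poly_Mapping.lookup m (inv_into UNIV q p))"
      using assms(1) by (subst prod.reindex) simp_all
    finally have "(\<Prod>v\<in>Poly_Mapping.keys m. q v ^ Poly_Mapping.lookup m v) =
      (\<Prod>p\<in>range q. p ^ Poly_Mapping.lookup m (inv_into UNIV q p))" .
    moreover have "multiplicity (q v) (\<Prod>p\<in>range q. p ^ Poly_Mapping.lookup m (inv_into UNIV q p)) =
        Poly_Mapping.lookup m v"
      using assms by (subst multiplicity_prod_prime_powers) auto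
    ultimately show ?thesis by simp
  qed
  then have "Poly_Mapping.lookup m v = Poly_Mapping.lookup m' v"
    if "(\<Prod>v\<in>Poly_Mapping.keys m. q v ^ Poly_Mapping.lookup m v) = (\<Prod>v\<in>Poly_Mapping.keys m'. q v ^ Poly_Mapping.lookup m' v)"
    for m m' v using that by metis
  then show ?thesis by (intro injI poly_mapping_eqI)
qed

text \<open>At the points \<open>z\<^sub>v = q\<^sub>v ^ s\<close> with distinct primes \<open>q\<^sub>v\<close> the monomials become \<open>g m ^ s\<close> with distinct
  integers \<open>g m\<close>, so a Lagrange polynomial in \<open>g m\<close> isolates each coefficient.\<close>

lemma mpoly_zero_on_torus:
  fixes p :: "('v::finite \<Rightarrow>\<^sub>0 nat) \<Rightarrow>\<^sub>0 complex"
  assumes z: "\<And>z. (\<And>v. z v \<noteq> 0) \<Longrightarrow> eval_mpoly id z p = 0"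
  shows "p = 0"
proof (rule ccontr)
  assume "p \<noteq> 0"
  then obtain m0 where m0: "m0 \<in> Poly_Mapping.keys p" by (metis keys_eq_empty ex_in_conv)
  obtain q :: "'v \<Rightarrow> nat" where q: "inj q" "\<And>v. prime (q v)" using ex_inj_primes by blast
  define g where "g m = complex_of_nat (\<Prod>v\<in>Poly_Mapping.keys m. q v ^ Poly_Mapping.lookup m v)" for m
  have g: "g m = g m' \<longleftrightarrow> m = m'" for m m'
    unfolding g_def of_nat_eq_iff using inj_prime_monomials[OF q] by (auto dest: injD)
  have pow: "(\<Sum>m\<in>Poly_Mapping.keys p. Poly_Mapping.lookup p m * g m ^ s) = 0" for s
  proof -
    have "eval_mpoly id (\<lambda>v. complex_of_nat (q v) ^ s) p = 0"
      using q(2) by (intro z) (auto simp: prime_gt_0_nat)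
    then show ?thesis
      by (simp add: eval_mpoly_def g_def prod_power_distrib mult.commute flip: power_mult)
  qed
  define f where "f = (\<Prod>m\<in>Poly_Mapping.keys p - {m0}. [:- g m, 1:])"
  have "(\<Sum>m\<in>Poly_Mapping.keys p. Poly_Mapping.lookup p m * poly f (g m)) =
      (\<Sum>m\<in>Poly_Mapping.keys p. \<Sum>s\<le>degree f. coeff f s * (Poly_Mapping.lookup p m * g m ^ s))"
    by (simp add: poly_altdef sum_distrib_left mult.left_commute)
  also have "\<dots> = (\<Sum>s\<le>degree f. coeff f s * (\<Sum>m\<in>Poly_Mapping.keys p. Poly_Mapping.lookup p m * g m ^ s))"
    by (subst sum.swap) (simp add: sum_distrib_left)
  also have "\<dots> = 0" by (simp add: pow)
  also have "(\<Sum>m\<in>Poly_Mapping.keys p. Poly_Mapping.lookup p m * poly f (g m)) =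
      Poly_Mapping.lookup p m0 * poly f (g m0)"
  proof (subst sum.remove[OF finite_keys m0], subst sum.neutral)
    show "\<forall>m\<in>Poly_Mapping.keys p - {m0}. Poly_Mapping.lookup p m * poly f (g m) = 0"
      unfolding f_def poly_prod by (auto intro!: prod_zero)
  qed simp
  finally have "poly f (g m0) = 0" using m0 by (simp add: in_keys_iff)
  then show False unfolding f_def poly_prod by (auto simp: g)
qed

lemma eval_mpoly_hom:
  fixes h :: "'a::comm_ring_1 \<Rightarrow> 'b::comm_ring_1" and z :: "'v \<Rightarrow> 'a"
  assumes "h 0 = 0" "h 1 = 1" "\<And>a b. h (a + b) = h a + h b" "\<And>a b. h (a * b) = h a * h b"
  shows "h (eval_mpoly \<kappa> z p) = eval_mpoly (h \<circ> \<kappa>) (h \<circ> z) p"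
proof -
  have s: "h (\<Sum>a\<in>A. f a) = (\<Sum>a\<in>A. h (f a))" for f :: "('v \<Rightarrow>\<^sub>0 nat) \<Rightarrow> 'a" and A
    by (induction A rule: infinite_finite_induct) (simp_all add: assms)
  have pr: "h (\<Prod>a\<in>A. f a) = (\<Prod>a\<in>A. h (f a))" for f :: "'v \<Rightarrow> 'a" and A
    by (induction A rule: infinite_finite_induct) (simp_all add: assms)
  have pw: "h (a ^ k) = h a ^ k" for a k by (induction k) (simp_all add: assms)
  show ?thesis unfolding eval_mpoly_def s by (simp add: assms(4) pr pw)
qed

lemma subalgebra_generated_hom:
  assumes "\<And>a b. h (a + b) = h a + h b" "\<And>a b. h (a * b) = h a * h b" "a \<in> subalgebra_generated \<kappa> S"
  shows "h a \<in> subalgebra_generated (h \<circ> \<kappa>) (h ` S)"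
  using assms(3)
proof induction
  case (scalar c)
  show ?case using subalgebra_generated.scalar[of "h \<circ> \<kappa>" c "h ` S"] unfolding comp_apply .
qed (auto simp: assms intro: subalgebra_generated.intros)

lemma subalgebra_generated_mono:
  "a \<in> subalgebra_generated \<kappa> S \<Longrightarrow> S \<subseteq> T \<Longrightarrow> a \<in> subalgebra_generated \<kappa> T"
  by (induction rule: subalgebra_generated.induct) (auto intro: subalgebra_generated.intros)

lemma subalgebra_le_subfield:
  "a \<in> subalgebra_generated \<kappa> S \<Longrightarrow> S \<subseteq> subfield_generated \<kappa> T \<Longrightarrow> a \<in> subfield_generated \<kappa> T"
  by (induction rule: subalgebra_generated.induct) (auto intro: subfield_generated.intros)

lemma to_fract_coord_ring:
  fixes f :: "'n::finite coord_ring"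
  shows "to_fract f \<in> subalgebra_generated (to_fract \<circ> scalar)
    (to_fract ` y_fun ` {1..CARD('n)} \<union> inverse ` to_fract ` y_fun ` {1..CARD('n)}
      \<union> (\<lambda>i. to_fract (minor i i)) ` {1..CARD('n) + 1})"
proof (rule subalgebra_generated_mono)
  show "to_fract f \<in> subalgebra_generated (to_fract \<circ> scalar) (to_fract ` coord_generators)"
    by (rule subalgebra_generated_hom) (simp_all add: coord_ring_generated)
  have "to_fract g \<in> inverse ` to_fract ` y_fun ` {1..CARD('n)}"
    if "i \<in> {1..CARD('n)}" "y_fun i * g = 1" for i and g :: "'n coord_ring"
  proof -
    have "to_fract (y_fun i) * to_fract g = 1" using that(2) by (metis to_fract_mult to_fract_1)
    then have "to_fract g = inverse (to_fract (y_fun i))" by (metis inverse_unique)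
    then show ?thesis using that(1) by blast
  qed
  then show "to_fract ` (coord_generators :: 'n coord_ring set) \<subseteq>
     to_fract ` y_fun ` {1..CARD('n)} \<union> inverse ` to_fract ` y_fun ` {1..CARD('n)}
      \<union> (\<lambda>i. to_fract (minor i i)) ` {1..CARD('n) + 1}"
    unfolding coord_generators_def by blast
qed

lemma y_fun_nonzero: "1 \<le> i \<Longrightarrow> i \<le> CARD('n) \<Longrightarrow> (y_fun i :: 'n::finite coord_ring) \<noteq> 0"
  using y_fun_unit[of i, where 'n = 'n] by fastforce

section \<open>Independence, generation of the fraction field, and type of the initial seed\<close>

context
  fixes num :: "'n::finite \<Rightarrow> nat"
  assumes num: "bij_betw num UNIV {1..CARD('n)}"
begin

lemma num_bounds: "1 \<le> num i" "num i \<le> CARD('n)"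
  using num by (auto simp: bij_betw_def)

lemma num_inj: "num i = num j \<longleftrightarrow> i = j"
  using num by (auto simp: bij_betw_def inj_eq)

lemma num_surj:
  assumes "1 \<le> m" "m \<le> CARD('n)"
  obtains i where "num i = m"
proof -
  have "m \<in> range num" using num assms by (auto simp: bij_betw_def)
  then show thesis using that by blast
qed

lemma range_initial: "range (initial_x num) = (\<lambda>i. to_fract (minor 1 i)) ` {1..CARD('n)}"
  "range (initial_y num) = to_fract ` y_fun ` {1..CARD('n)}"
proof -
  have "range num = {1..CARD('n)}" using num by (simp add: bij_betw_def)
  then show "range (initial_x num) = (\<lambda>i. to_fract (minor 1 i)) ` {1..CARD('n)}"
    "range (initial_y num) = to_fract ` y_fun ` {1..CARD('n)}"
    unfolding initial_x_def initial_y_def by (metis image_image)+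
qed

text \<open>A polynomial relation can be evaluated at points of the variety, where the initial x and
  y attain every tuple of non-zero values. So its polynomial vanishes on the whole torus.\<close>

lemma initial_algebraically_independent:
  "algebraically_independent (to_fract \<circ> scalar) (case_sum (initial_x num) (initial_y num))"
  unfolding algebraically_independent_def
proof (intro allI impI)
  fix p :: "('n + 'n \<Rightarrow>\<^sub>0 nat) \<Rightarrow>\<^sub>0 complex"
  define w :: "'n + 'n \<Rightarrow> 'n coord_ring" where
    "w = case_sum (\<lambda>i. minor 1 (num i)) (\<lambda>i. y_fun (num i))"
  assume "eval_mpoly (to_fract \<circ> scalar) (case_sum (initial_x num) (initial_y num)) p = 0"
  also have "case_sum (initial_x num) (initial_y num) = to_fract \<circ> w"
    by (auto simp: w_def initial_x_def initial_y_def fun_eq_iff split: sum.splits)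
  also have "eval_mpoly (to_fract \<circ> scalar) (to_fract \<circ> w) p = to_fract (eval_mpoly scalar w p)"
    by (rule eval_mpoly_hom[symmetric]) simp_all
  finally have w0: "eval_mpoly scalar w p = 0" by simp
  show "p = 0"
  proof (rule mpoly_zero_on_torus)
    fix z :: "'n + 'n \<Rightarrow> complex" assume z: "\<And>v. z v \<noteq> 0"
    obtain M where M: "M \<in> tridiag_variety CARD('n)"
      "\<And>i. 1 \<le> i \<Longrightarrow> i \<le> CARD('n) \<Longrightarrow> fun_of (minor 1 i :: 'n coord_ring) M = z (Inl (inv_into UNIV num i))"
      "\<And>i. 1 \<le> i \<Longrightarrow> i \<le> CARD('n) \<Longrightarrow> fun_of (y_fun i :: 'n coord_ring) M = z (Inr (inv_into UNIV num i))"
      by (rule variety_point[of "\<lambda>i. z (Inl (inv_into UNIV num i))" "\<lambda>i. z (Inr (inv_into UNIV num i))", where 'n = 'n])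
        (simp add: z, blast)
    have "inv_into UNIV num (num i) = i" for i using num by (simp add: bij_betw_def)
    then have wz: "(\<lambda>f. fun_of f M) \<circ> w = z"
      using M(2,3) num_bounds by (auto simp: w_def fun_eq_iff split: sum.splits)
    have "fun_of (eval_mpoly scalar w p) M =
        eval_mpoly ((\<lambda>f. fun_of f M) \<circ> (scalar :: complex \<Rightarrow> 'n coord_ring)) ((\<lambda>f. fun_of f M) \<circ> w) p"
      by (rule eval_mpoly_hom) (simp_all add: fun_of_simps fun_of_on_variety[OF M(1)])
    also have "(\<lambda>f. fun_of f M) \<circ> (scalar :: complex \<Rightarrow> 'n coord_ring) = id"
      by (auto simp: fun_of_on_variety[OF M(1)])
    finally show "eval_mpoly id z p = 0" unfolding wz w0 fun_of_simps ..
  qed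
qed

lemma minor_first_nonzero: "j \<le> CARD('n) + 1 \<Longrightarrow> (minor 1 j :: 'n coord_ring) \<noteq> 0"
  using minor_nontrivial(1)[of 1 j, where 'n = 'n] minor_full[where 'n = 'n] minor_trivial[of 1 j, where 'n = 'n]
  by (cases "j = 0"; cases "j = CARD('n) + 1") auto

text \<open>It is enough to reach the diagonal entries v_i of M. The recurrence x_[1,i] = v_i
  x_[1,i-1] - y_(i-1) x_[1,i-2] is solved for v_i, dividing by a leading minor, which is
  non-zero.\<close>

lemma initial_subfield:
  "subfield_generated (to_fract \<circ> scalar) (range (initial_x num) \<union> range (initial_y num)) = UNIV"
  (is "?F = UNIV")
proof -
  let ?v = "\<lambda>i. minor i i :: 'n coord_ring"
  have one: "1 \<in> ?F" using subfield_generated.scalar[of "to_fract \<circ> (scalar :: complex \<Rightarrow> 'n coord_ring)" 1]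
      scalar_hom[where 'n = 'n] by (simp add: complex_algebra_def)
  have x: "to_fract (minor 1 j :: 'n coord_ring) \<in> ?F" if j: "j \<le> CARD('n) + 1" for j
  proof -
    consider "j = 0" | "j = CARD('n) + 1" | "1 \<le> j" "j \<le> CARD('n)" using j by linarith
    then show ?thesis
    proof cases
      case 1
      then have "(minor 1 j :: 'n coord_ring) = 1" by (intro minor_trivial) simp
      then show ?thesis using one by simp
    next
      case 2
      then show ?thesis using one minor_full[where 'n = 'n] by simp
    next
      case 3
      then show ?thesis unfolding range_initial by (intro subfield_generated.gen) auto
    qed
  qed
  have y: "to_fract (y_fun j :: 'n coord_ring) \<in> ?F" if "1 \<le> j" "j \<le> CARD('n)" for j
    using that unfolding range_initial by (intro subfield_generated.gen) auto
  have v: "to_fract (?v i) \<in> ?F" if i: "1 \<le> i" "i \<le> CARD('n) + 1" for i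
  proof (cases "i = 1")
    case True
    then show ?thesis using x by simp
  next
    case False
    have K: "chord_continuant ?v y_fun 0 (Suc j) = minor 1 j" if "j \<le> CARD('n) + 1" for j
      using minor_chord_continuant[of 0 "Suc j", where 'n = 'n] that by simp
    obtain k where k: "i = Suc (Suc k)" using False i by (metis One_nat_def Suc_le_D old.nat.exhaust)
    have "(minor 1 i :: 'n coord_ring) = ?v i * minor 1 (i - 1) - y_fun (i - 1) * minor 1 (i - 2)"
      using chord_continuant_Suc[of 0 i ?v y_fun] K[of i] K[of "i - 1"] K[of "i - 2"] i k by simp
    then have "to_fract (?v i) * to_fract (minor 1 (i - 1)) =
        to_fract (minor 1 i) + to_fract (y_fun (i - 1)) * to_fract (minor 1 (i - 2))"
      by (metis diff_add_cancel to_fract_add to_fract_mult)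
    moreover have "to_fract (minor 1 (i - 1) :: 'n coord_ring) \<noteq> 0"
      using minor_first_nonzero[of "i - 1"] i by simp
    ultimately have "to_fract (?v i) = (to_fract (minor 1 i) + to_fract (y_fun (i - 1)) * to_fract (minor 1 (i - 2)))
        * inverse (to_fract (minor 1 (i - 1)))"
      by (simp add: field_simps)
    then show ?thesis using i k x[of i] x[of "i - 1"] x[of "i - 2"] y[of "i - 1"]
      by (auto intro!: subfield_generated.add subfield_generated.mult subfield_generated.inv)
  qed
  have f: "to_fract f \<in> ?F" for f :: "'n coord_ring"
    using to_fract_coord_ring by (rule subalgebra_le_subfield) (use y v in \<open>auto intro: subfield_generated.inv\<close>)
  have "e \<in> ?F" for e
  proof (cases e)
    case (Fract a b)
    then have "e = to_fract a * inverse (to_fract b)" by (simp add: Fract_conv_to_fract divide_inverse)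
    then show ?thesis using f by (auto intro: subfield_generated.mult subfield_generated.inv)
  qed
  then show ?thesis by blast
qed

text \<open>The initial seed is itself the witness, with the reflections ordered along
  \<open>num\<close>: precedence then is \<open>num i < num j\<close>, and b_(i,i+1) = - a_(i,i+1) =
  1.\<close>

lemma initial_type_A:
  "cluster_type_A (principal_coeff (initial_y num)) (principal_seed (initial_x num) (initial_B num))"
proof -
  define a :: "'n \<Rightarrow> 'n \<Rightarrow> int" where
    "a i j = (if i = j then 2 else if num i = num j + 1 \<or> num j = num i + 1 then -1 else 0)" for i j
  define c where "c = map (inv_into UNIV num) [1..<CARD('n) + 1]"
  have inv: "inv_into UNIV num (num i) = i" for i using num by (simp add: bij_betw_def)
  have inv': "num (inv_into UNIV num m) = m" if "1 \<le> m" "m \<le> CARD('n)" for m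
    using that num_surj inv by metis
  have nth: "c ! p = i \<longleftrightarrow> num i = p + 1" if "p < CARD('n)" for p i
  proof -
    have "c ! p = inv_into UNIV num (p + 1)" using that by (simp add: c_def del: upt_Suc)
    then show ?thesis using inv[of i] inv'[of "p + 1"] that by auto
  qed
  have len: "length c = CARD('n)" by (simp add: c_def)
  have pr: "precedes c i j \<longleftrightarrow> num i < num j" for i j
  proof
    assume "precedes c i j"
    then obtain p q where "p < q" "q < CARD('n)" "c ! p = i" "c ! q = j" by (auto simp: precedes_def len)
    then show "num i < num j" using nth[of p i] nth[of q j] by simp
  next
    assume "num i < num j"
    then show "precedes c i j"
      using nth[of "num i - 1" i] nth[of "num j - 1" j] num_bounds[of i] num_bounds[of j] unfolding precedes_def len
      by (intro exI[of _ "num i - 1"] exI[of _ "num j - 1"]) auto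
  qed
  have "set c = UNIV"
  proof -
    have "i \<in> set c" for i
      using nth[of "num i - 1" i] num_bounds[of i] len
      by (metis One_nat_def Suc_diff_1 Suc_eq_plus1 Suc_le_eq nth_mem)
    then show ?thesis by blast
  qed
  moreover have "distinct c"
    using \<open>set c = UNIV\<close> len by (simp add: card_distinct)
  moreover have "type_A_cartan a" unfolding type_A_cartan_def a_def using num by blast
  moreover have "initial_B num = coxeter_exmat a c"
    by (auto simp: fun_eq_iff initial_B_def coxeter_exmat_def pr a_def)
  ultimately show ?thesis
    unfolding cluster_type_A_def
    by (intro bexI[OF _ mutation_class.initial] exI[of _ a] exI[of _ c]) (simp add: principal_seed_def)
qed

end

section \<open>Minors as values of chords\<close>

context
  fixes num :: "'n::finite \<Rightarrow> nat"
  assumes num: "bij_betw num UNIV {1..CARD('n)}"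
begin

definition minor_chord :: "nat \<times> nat \<Rightarrow> 'n coord_ring fract" where
  "minor_chord e = to_fract (minor (fst e + 1) (snd e - 1))"

definition y_between :: "nat \<Rightarrow> nat \<Rightarrow> 'n coord_ring fract" where
  "y_between b c = (\<Prod>m\<in>{b..<c}. to_fract (y_fun m))"

definition y_below :: "nat \<Rightarrow> 'n trop" where
  "y_below m = Trop (\<lambda>j. of_bool (num j < m))"

lemma expo_y_below: "expo (y_below m) j = of_bool (num j < m)"
  unfolding y_below_def by (subst Trop_inverse) auto

lemma expo_y_quotient: "expo (y_below c * inverse (y_below b)) j = of_bool (num j < c) - of_bool (num j < b)"
  by (simp add: times_trop.rep_eq inverse_trop.rep_eq expo_y_below)

lemma principal_coeff_one: "principal_coeff y (1 :: 'n trop) = 1"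
  by (simp add: principal_coeff_def one_trop.rep_eq)

lemma prod_y_between:
  assumes "0 < b" "c \<le> CARD('n) + 1"
  shows "(\<Prod>i\<in>UNIV. if b \<le> num i \<and> num i < c then initial_y num i else 1) = y_between b c"
proof -
  have "(\<Prod>i\<in>UNIV. if b \<le> num i \<and> num i < c then initial_y num i else 1)
      = (\<Prod>m\<in>{1..CARD('n)}. if b \<le> m \<and> m < c then to_fract (y_fun m :: 'n coord_ring) else 1)"
    unfolding initial_y_def by (rule prod.reindex_bij_betw[OF num])
  also have "\<dots> = (\<Prod>m\<in>{b..<c}. to_fract (y_fun m))"
    using assms by (intro prod.mono_neutral_cong_right) auto
  finally show ?thesis unfolding y_between_def .
qed

lemma principal_coeff_y_quotient:
  assumes "0 < b" "b < c" "c < CARD('n) + 2"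
  shows "principal_coeff (initial_y num) (y_below c * inverse (y_below b)) = y_between b c"
    "principal_coeff (initial_y num) (y_below b * inverse (y_below c)) = inverse (y_between b c)"
proof -
  have "initial_y num i powi expo (y_below c * inverse (y_below b)) i =
      (if b \<le> num i \<and> num i < c then initial_y num i else 1)" for i
    using assms(2) by (simp add: expo_y_quotient)
  then show "principal_coeff (initial_y num) (y_below c * inverse (y_below b)) = y_between b c"
    using prod_y_between[of b c] assms unfolding principal_coeff_def by simp
  have "initial_y num i powi expo (y_below b * inverse (y_below c)) i =
      inverse (if b \<le> num i \<and> num i < c then initial_y num i else 1)" for i
    using assms(2) by (simp add: expo_y_quotient power_int_minus)
  then have "principal_coeff (initial_y num) (y_below b * inverse (y_below c)) =
      inverse (\<Prod>i\<in>UNIV. if b \<le> num i \<and> num i < c then initial_y num i else 1)"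
    unfolding principal_coeff_def prod_inversef[symmetric] comp_def by simp
  then show "principal_coeff (initial_y num) (y_below b * inverse (y_below c)) = inverse (y_between b c)"
    using prod_y_between[of b c] assms by simp
qed

lemma trop_eqI: "(\<And>j. expo p j = expo q j) \<Longrightarrow> p = q"
  by (metis ext expo_inject)

text \<open>The two kinds of boundary edges have the value 1 for different reasons: (p, p + 1) gives
  an empty minor, and (0, n + 2) gives det M.\<close>

interpretation minors: triangulation_seeds "CARD('n) + 2" "principal_coeff (initial_y num)" minor_chord y_below y_between
proof
  show "minor_chord (p, p + 1) = 1" for p
    unfolding minor_chord_def by (subst minor_trivial) auto
  show "minor_chord (0, CARD('n) + 2) = 1"
    unfolding minor_chord_def using minor_full[where 'n = 'n] by simp
  show "minor_chord e \<noteq> 0" "minor_chord e \<noteq> 1" if "e \<in> diagonals (CARD('n) + 2)" for e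
  proof -
    obtain p q where pq: "e = (p, q)" by (cases e)
    then have m: "1 \<le> p + 1" "p + 1 \<le> q - 1" "q - 1 \<le> CARD('n) + 1" "(p + 1, q - 1) \<noteq> (1, CARD('n) + 1)"
      using that by (auto simp: diagonals_def)
    show "minor_chord e \<noteq> 0" "minor_chord e \<noteq> 1"
      using minor_nontrivial[OF m] unfolding minor_chord_def pq by (simp_all flip: to_fract_1)
  qed
  fix a b c d :: nat
  assume o: "a < b" "b < c" "c < d" "d \<le> CARD('n) + 2"
  show "minor_chord (a, c) * minor_chord (b, d) =
    y_between b c * minor_chord (a, b) * minor_chord (c, d) + minor_chord (a, d) * minor_chord (b, c)"
  proof -
    have "to_fract (\<Prod>m\<in>A. f m) = (\<Prod>m\<in>A. to_fract (f m))" for A :: "nat set" and f :: "nat \<Rightarrow> 'n coord_ring"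
      by (induction A rule: infinite_finite_induct) simp_all
    then show ?thesis
      using arg_cong[OF minor_ptolemy[OF o], of to_fract]
      unfolding minor_chord_def y_between_def by simp
  qed
next
  fix b c :: nat
  assume bc: "0 < b" "b < c" "c < CARD('n) + 2"
  show "y_between b c \<noteq> 0"
    unfolding y_between_def using bc by (auto simp: y_fun_nonzero)
  show "principal_coeff (initial_y num) (y_below c * inverse (y_below b)) = y_between b c"
    "principal_coeff (initial_y num) (y_below b * inverse (y_below c)) = inverse (y_between b c)"
    by (fact principal_coeff_y_quotient[OF bc])+
  \<comment> \<open>Adding 1 tropically takes the minimum of each exponent with 0; the exponents are
    0 or 1 here and 0 or -1 in the next claim.\<close>
  show "y_below c * inverse (y_below b) + 1 = 1"
    by (rule trop_eqI) (use bc in \<open>simp add: plus_trop.rep_eq one_trop.rep_eq expo_y_quotient\<close>)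
  show "y_below b * inverse (y_below c) + 1 = y_below b * inverse (y_below c)"
    by (rule trop_eqI) (use bc in \<open>simp add: plus_trop.rep_eq one_trop.rep_eq expo_y_quotient\<close>)
next
  show "principal_coeff (initial_y num) 1 = 1" by (rule principal_coeff_one)
qed

section \<open>The initial seed as the fan at vertex 0\<close>

definition fan :: "'n \<Rightarrow> nat \<times> nat" where
  "fan i = (0, num i + 1)"

lemma range_fan: "range fan = {(0, q) |q. 2 \<le> q \<and> q \<le> CARD('n) + 1}"
proof -
  have "(0, q) \<in> range fan" if q: "2 \<le> q" "q \<le> CARD('n) + 1" for q
  proof -
    have "1 \<le> q - 1" "q - 1 \<le> CARD('n)" using q by auto
    then obtain i where "num i = q - 1" using num_surj[OF num] by metis
    then have "(0, q) = fan i" using q by (simp add: fan_def)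
    then show ?thesis by blast
  qed
  then show ?thesis using num_bounds[OF num] by (auto simp: fan_def)
qed

lemma triangles_fan: "triangles (CARD('n) + 2) (range fan) = (\<lambda>m. (0, m, m + 1)) ` {1..CARD('n) + 1}"
proof (intro equalityI subsetI)
  fix t assume "t \<in> triangles (CARD('n) + 2) (range fan)"
  then obtain p m q where t: "t = (p, m, q)" "p < m" "m < q" "q \<le> CARD('n) + 2"
    "edge (CARD('n) + 2) (range fan) (p, m)" "edge (CARD('n) + 2) (range fan) (m, q)" "edge (CARD('n) + 2) (range fan) (p, q)"
    by (auto simp: triangles_def)
  have "p = 0" using t by (auto simp: edge_def range_fan)
  moreover have "q = m + 1" using t by (auto simp: edge_def range_fan)
  ultimately show "t \<in> (\<lambda>m. (0, m, m + 1)) ` {1..CARD('n) + 1}" using t by auto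
qed (auto simp: triangles_def edge_def range_fan)

lemma in_triangles_fan:
  "(p, m, q) \<in> triangles (CARD('n) + 2) (range fan) \<longleftrightarrow> p = 0 \<and> q = m + 1 \<and> 1 \<le> m \<and> m \<le> CARD('n) + 1"
  unfolding triangles_fan by auto

lemma arrow_fan: "1 \<le> m \<Longrightarrow> arrow (0, m, m + 1) (0, u) (0, v) = of_bool (m = u \<and> v = m + 1)"
  unfolding arrow_triple by auto

lemma quiver_fan: "quiver (triangles (CARD('n) + 2) (range fan)) (fan i) (fan j) = initial_B num i j"
proof -
  have "(\<Sum>t\<in>triangles (CARD('n) + 2) (range fan). arrow t (fan i) (fan j)) = of_bool (num j = num i + 1)" for i j
  proof -
    have "(\<Sum>t\<in>triangles (CARD('n) + 2) (range fan). arrow t (fan i) (fan j)) =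
        (\<Sum>m\<in>{1..CARD('n) + 1}. arrow (0, m, m + 1) (fan i) (fan j))"
      unfolding triangles_fan by (subst sum.reindex) (auto simp: inj_on_def)
    also have "\<dots> = (\<Sum>m\<in>{1..CARD('n) + 1}. if m = num i + 1 then of_bool (num j = num i + 1) else 0)"
      unfolding fan_def by (intro sum.cong refl, subst arrow_fan) auto
    also have "\<dots> = of_bool (num j = num i + 1)" using num_bounds[OF num, of i] by simp
    finally show ?thesis .
  qed
  then show ?thesis unfolding quiver_def sum_subtractf by (simp add: initial_B_def)
qed

lemma inner_fan: "inner (triangles (CARD('n) + 2) (range fan)) (fan i) m \<longleftrightarrow> m = num i"
  using num_bounds[OF num, of i] unfolding inner_def in_triangles_fan fan_def by auto

lemma outer_fan: "outer (triangles (CARD('n) + 2) (range fan)) (fan i) m \<longleftrightarrow> m = num i + 1"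
  using num_bounds[OF num, of i] unfolding outer_def in_triangles_fan fan_def by auto

lemma seed_of_fan: "minors.seed_of fan (principal_seed (initial_x num) (initial_B num))"
proof -
  have "inj fan" using num_inj[OF num] by (auto simp: inj_def fan_def)
  moreover have "triangulation (CARD('n) + 2) (range fan)"
    unfolding triangulation_def noncrossing_def
  proof (intro conjI ballI)
    fix e assume "e \<in> range fan"
    then show "\<exists>m. inner (triangles (CARD('n) + 2) (range fan)) e m" "\<exists>m. outer (triangles (CARD('n) + 2) (range fan)) e m"
      using inner_fan outer_fan by blast+
  qed (auto simp: range_fan diagonals_def)
  moreover have "initial_x num = minor_chord \<circ> fan"
    by (auto simp: fun_eq_iff initial_x_def minor_chord_def fan_def)
  \<comment> \<open>On the fan the middle vertices at index \<open>i\<close> are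
    \<open>num i\<close> below and \<open>num i + 1\<close> above, so the quotient is a single
    generator.\<close>
  moreover have "trop_var i = y_below (num i + 1) * inverse (y_below (num i))" for i
    by (rule trop_eqI) (auto simp: trop_var.rep_eq expo_y_quotient num_inj[OF num] less_Suc_eq)
  ultimately show ?thesis
    unfolding minors.seed_of_def principal_seed_def seed.simps
    unfolding quiver_fan inner_fan outer_fan by auto
qed

lemma ptolemy_minor_relation:
  "minors.ptolemy_relation a b c d = minor_relation (a + 1) (b + 1) (c - 1) (d - 1)"
  if "a < b" "b < c" "c < d"
proof -
  have "{b..<c} = {b..c - 1}" using that by auto
  moreover have "c - 1 + 2 = c + 1" "b + 1 - 2 = b - 1" using that by auto
  ultimately show ?thesis
    unfolding minors.ptolemy_relation_def minor_relation_def Let_def y_between_def minor_chord_def fst_conv snd_conv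
    by simp
qed

lemma minor_chord_diagonals:
  "minor_chord ` diagonals (CARD('n) + 2) =
     {to_fract (minor i j) |i j. 1 \<le> i \<and> i \<le> j \<and> j \<le> CARD('n) + 1 \<and> (i, j) \<noteq> (1, CARD('n) + 1)}"
proof (intro equalityI subsetI)
  fix x assume "x \<in> minor_chord ` diagonals (CARD('n) + 2)"
  then obtain p q where "x = to_fract (minor (p + 1) (q - 1))" "(p, q) \<in> diagonals (CARD('n) + 2)"
    by (auto simp: minor_chord_def)
  then show "x \<in> {to_fract (minor i j) |i j. 1 \<le> i \<and> i \<le> j \<and> j \<le> CARD('n) + 1 \<and> (i, j) \<noteq> (1, CARD('n) + 1)}"
    unfolding mem_Collect_eq by (intro exI[of _ "p + 1"] exI[of _ "q - 1"]) (auto simp: diagonals_def)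
next
  fix x :: "'n coord_ring fract"
  assume "x \<in> {to_fract (minor i j) |i j. 1 \<le> i \<and> i \<le> j \<and> j \<le> CARD('n) + 1 \<and> (i, j) \<noteq> (1, CARD('n) + 1)}"
  then obtain i j where "x = to_fract (minor i j)" "1 \<le> i" "i \<le> j" "j \<le> CARD('n) + 1" "(i, j) \<noteq> (1, CARD('n) + 1)"
    by blast
  then show "x \<in> minor_chord ` diagonals (CARD('n) + 2)"
    by (intro image_eqI[of _ _ "(i - 1, j + 1)"]) (auto simp: minor_chord_def diagonals_def)
qed

lemma minor_cluster_variables:
  "cluster_variables (principal_coeff (initial_y num)) (principal_seed (initial_x num) (initial_B num))
     = {to_fract (minor i j) |i j. 1 \<le> i \<and> i \<le> j \<and> j \<le> CARD('n) + 1 \<and> (i, j) \<noteq> (1, CARD('n) + 1)}"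
  unfolding minor_chord_diagonals[symmetric]
  by (rule minors.seeds_from_fan(1)[OF seed_of_fan]) (subst in_triangles_fan, auto)

lemma minor_exchange_relations:
  "exchange_relations (principal_coeff (initial_y num)) (principal_seed (initial_x num) (initial_B num))
     = {minor_relation i j k l |i j k l. 1 \<le> i \<and> i \<le> j - 1 \<and> j - 1 \<le> k \<and> k \<le> l - 1 \<and> l - 1 \<le> CARD('n)}"
proof -
  have "exchange_relations (principal_coeff (initial_y num)) (principal_seed (initial_x num) (initial_B num))
     = {minors.ptolemy_relation a b c d |a b c d. a < b \<and> b < c \<and> c < d \<and> d \<le> CARD('n) + 2}"
    by (rule minors.seeds_from_fan(2)[OF seed_of_fan]) (subst in_triangles_fan, auto)
  also have "\<dots> = {minor_relation i j k l |i j k l. 1 \<le> i \<and> i \<le> j - 1 \<and> j - 1 \<le> k \<and> k \<le> l - 1 \<and> l - 1 \<le> CARD('n)}"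
  proof (intro equalityI subsetI)
    fix r assume "r \<in> {minors.ptolemy_relation a b c d |a b c d. a < b \<and> b < c \<and> c < d \<and> d \<le> CARD('n) + 2}"
    then obtain a b c d where "r = minors.ptolemy_relation a b c d" "a < b" "b < c" "c < d" "d \<le> CARD('n) + 2" by blast
    then show "r \<in> {minor_relation i j k l |i j k l. 1 \<le> i \<and> i \<le> j - 1 \<and> j - 1 \<le> k \<and> k \<le> l - 1 \<and> l - 1 \<le> CARD('n)}"
      unfolding mem_Collect_eq
      by (intro exI[of _ "a + 1"] exI[of _ "b + 1"] exI[of _ "c - 1"] exI[of _ "d - 1"])
        (auto simp: ptolemy_minor_relation)
  next
    fix r :: "'n coord_ring fract exrel"
    assume "r \<in> {minor_relation i j k l |i j k l. 1 \<le> i \<and> i \<le> j - 1 \<and> j - 1 \<le> k \<and> k \<le> l - 1 \<and> l - 1 \<le> CARD('n)}"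
    then obtain i j k l where r: "r = minor_relation i j k l"
      and o: "1 \<le> i" "i \<le> j - 1" "j - 1 \<le> k" "k \<le> l - 1" "l - 1 \<le> CARD('n)" by blast
    \<comment> \<open>The inequalities force i \<ge> 1, j \<ge> 2 and l \<ge> 2, so the truncated
      subtractions are exact and the shift of indices is invertible.\<close>
    have "r = minors.ptolemy_relation (i - 1) (j - 1) (k + 1) (l + 1)"
      using o by (subst ptolemy_minor_relation) (auto simp: r)
    then show "r \<in> {minors.ptolemy_relation a b c d |a b c d. a < b \<and> b < c \<and> c < d \<and> d \<le> CARD('n) + 2}"
      unfolding mem_Collect_eq using o
      by (intro exI[of _ "i - 1"] exI[of _ "j - 1"] exI[of _ "k + 1"] exI[of _ "l + 1"]) auto
  qed
  finally show ?thesis .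
qed

text \<open>The diagonal entries v_i = x_[i,i] are cluster variables, as n \<ge> 1 keeps (1, 1)
  apart from the excluded pair (1, n + 1); together with the y_i and their inverses they generate
  the coordinate ring. Conversely all cluster variables are minors and the y_i are units, so nothing
  outside the coordinate ring is generated.\<close>

lemma initial_principal_cluster_algebra:
  "principal_cluster_algebra (scalar :: complex \<Rightarrow> 'n coord_ring)
     (initial_x num) (initial_y num) (initial_B num)"
proof -
  let ?G = "range (initial_y num) \<union> inverse ` range (initial_y num) \<union>
    cluster_variables (principal_coeff (initial_y num)) (principal_seed (initial_x num) (initial_B num))"
  let ?A = "subalgebra_generated (to_fract \<circ> scalar) ?G"
  have "to_fract f \<in> ?A" for f :: "'n coord_ring"
  proof (rule subalgebra_generated_mono[OF to_fract_coord_ring])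
    have "to_fract (minor i i :: 'n coord_ring) \<in> ?G" if "i \<in> {1..CARD('n) + 1}" for i
      using that unfolding minor_cluster_variables by force
    then show "to_fract ` y_fun ` {1..CARD('n)} \<union> inverse ` to_fract ` y_fun ` {1..CARD('n)}
      \<union> (\<lambda>i. to_fract (minor i i)) ` {1..CARD('n) + 1} \<subseteq> ?G"
      unfolding range_initial(2)[OF num] by blast
  qed
  moreover have "x \<in> range to_fract" if "x \<in> ?A" for x
    using that
  proof induction
    case (gen x)
    have "inverse (to_fract (y_fun i)) \<in> range (to_fract :: 'n coord_ring \<Rightarrow> _)" if i: "1 \<le> i" "i \<le> CARD('n)" for i
    proof -
      obtain g where "y_fun i * g = (1 :: 'n coord_ring)" using y_fun_unit[OF i] by blast
      then have "to_fract (y_fun i) * to_fract g = 1" by (metis to_fract_mult to_fract_1)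
      then have "inverse (to_fract (y_fun i)) = to_fract g" by (rule inverse_unique)
      then show ?thesis by blast
    qed
    then show ?case using gen unfolding range_initial(2)[OF num] minor_cluster_variables by auto
  next
    case (add a b)
    then obtain f g :: "'n coord_ring" where "a = to_fract f" "b = to_fract g" by blast
    then have "a + b = to_fract (f + g)" by simp
    then show ?case by blast
  next
    case (mult a b)
    then obtain f g :: "'n coord_ring" where "a = to_fract f" "b = to_fract g" by blast
    then have "a * b = to_fract (f * g)" by simp
    then show ?case by blast
  qed simp
  ultimately have "range to_fract = ?A" by blast
  moreover have "skew_symmetrizable (initial_B num)"
    unfolding skew_symmetrizable_def by (rule exI[of _ "\<lambda>_. 1"]) (auto simp: initial_B_def)
  ultimately show ?thesis
    unfolding principal_cluster_algebra_def
    using scalar_hom initial_algebraically_independent[OF num] initial_subfield[OF num] by blast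
qed

end

theorem theorem1p1:
  fixes num :: "'n::finite \<Rightarrow> nat" and n :: nat
  assumes "n = CARD('n)" and "bij_betw num UNIV {1..n}"
  shows
    "(principal_cluster_algebra (scalar :: complex \<Rightarrow> 'n coord_ring)
        (initial_x num) (initial_y num) (initial_B num) \<and>
      cluster_type_A (principal_coeff (initial_y num))
        (principal_seed (initial_x num) (initial_B num))) \<and>
     cluster_variables (principal_coeff (initial_y num))
         (principal_seed (initial_x num) (initial_B num))
       = {to_fract (minor i j) |i j. 1 \<le> i \<and> i \<le> j \<and> j \<le> n + 1 \<and> (i, j) \<noteq> (1, n + 1)} \<and>
     (\<forall>i j k l. 1 \<le> i \<and> i \<le> j - 1 \<and> j - 1 \<le> k \<and> k \<le> l - 1 \<and> l - 1 \<le> n \<longrightarrow>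
        (minor i k * minor j l :: 'n coord_ring)
          = (\<Prod>m\<in>{j - 1..k}. y_fun m) * minor i (j - 2) * minor (k + 2) l
            + minor i l * minor j k) \<and>
     exchange_relations (principal_coeff (initial_y num))
         (principal_seed (initial_x num) (initial_B num))
       = {minor_relation i j k l |i j k l.
            1 \<le> i \<and> i \<le> j - 1 \<and> j - 1 \<le> k \<and> k \<le> l - 1 \<and> l - 1 \<le> n}"
proof -
  have num: "bij_betw num UNIV {1..CARD('n)}" using assms by simp
  have "(minor i k * minor j l :: 'n coord_ring)
          = (\<Prod>m\<in>{j - 1..k}. y_fun m) * minor i (j - 2) * minor (k + 2) l + minor i l * minor j k"
    if o: "1 \<le> i" "i \<le> j - 1" "j - 1 \<le> k" "k \<le> l - 1" "l - 1 \<le> n" for i j k l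
  proof -
    have "{j - 1..<k + 1} = {j - 1..k}" "i - 1 + 1 = i" "j - 1 + 1 = j" "k + 1 - 1 = k" "l + 1 - 1 = l"
      "j - 1 - 1 = j - 2" "k + 1 + 1 = k + 2" using o by auto
    moreover have "i - 1 < j - 1" "j - 1 < k + 1" "k + 1 < l + 1" "l + 1 \<le> CARD('n) + 2"
      using o assms(1) by auto
    ultimately show ?thesis
      using minor_ptolemy[of "i - 1" "j - 1" "k + 1" "l + 1", where 'n = 'n] by metis
  qed
  then show ?thesis
    using initial_principal_cluster_algebra[OF num] initial_type_A[OF num] minor_cluster_variables[OF num]
      minor_exchange_relations[OF num] unfolding assms(1) by blast
qed

end
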